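(* (1) Two infinite atomic regular MV-chains are elementarily equivalent if, and only if, they satisfy the same formulas $D_{p^m,k}$ ($p$ prime, $m\ge1$, $0\le k\le p^m-1$). (2) An infinite MV-chain is pseudofinite if, and only if, it is atomic and regular. (3) Let $U$ be a non-principal ultrafilter on $\mathbb{N}^*$ and $A$ the ultraproduct over $U$ of the finite MV-chains $[0,n]$, $n\in\mathbb{N}^*$. Let $p$ be a prime, $m\in\mathbb{N}^*$ and $k\in\{0,\dots,p^m-1\}$. Then $A$ satisfies $D_{p^m,k}$ if, and only if, $\{p^mj-k\mid j\in\mathbb{N}^*\}\in U$.
   Context: An MV-chain is an MV-algebra $(A,\oplus,\neg,0)$ (with $1=\neg0$) whose natural order is linear; $n.x=x\oplus\cdots\oplus x$. It is atomic if it has an atom (an element $x>0$ with $\{y\mid y\le x\}=\{0,x\}$); an atomic MV-chain has a least positive element $\varepsilon_A$. It is regular if for every $n\ge2$ and all $0<x_1<\cdots<x_n$ there is $x$ with $x_1\le n.x\le x_n$ and $0<x<2.x<\cdots<n.x$. It is pseudofinite if it satisfies every first-order sentence (language $(0,\oplus,\neg)$) true in all finite MV-chains. The Chang $\ell$-group $(G_A,u_A)$ is the linearly ordered abelian group with strong unit $u_A$ such that $A\cong[0,u_A]$ with $x\oplus y=\min(x+y,u_A)$, $\neg x=u_A-x$. For an infinite atomic MV-chain $A$, $p$ prime, $m\ge1$ and $0\le k\le p^m-1$, $D_{p^m,k}$ is the (first-order expressible) statement: there exists $x\in A$ with $0<x<2.x<\cdots<(p^m-1).x$ and $p^mx-k\varepsilon_A\in\mathbb{Z}u_A$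 in $G_A$ (equivalently, $p^m\bar x=k\bar\varepsilon_A$ in the cyclically ordered group $G_A/\mathbb{Z}u_A$). $[0,n]$ denotes the MV-chain $\{0,1,\dots,n\}\subset\mathbb{Z}$ with $x\oplus y=\min(x+y,n)$, $\neg x=n-x$.
   Formalization: In D_{p^m,k} the extra condition (p^m−1).x < 1 is required; without it (3) fails for p^m = 2 and 3 (x = 1 always witnesses D_{2,0}), while for p^m ≥ 4 and infinite atomic chains it is automatic. *)

theory Defs
  imports "HOL-Algebra.Group" "HOL-Computational_Algebra.Primes" "HOL-Library.FuncSet"
begin

section \<open>MV-algebras and MV-chains\<close>

record 'a mv = "'a partial_object" +
  mv_zero :: 'a ("\<zero>\<index>")
  mv_add :: "'a \<Rightarrow> 'a \<Rightarrow> 'a" (infixl "\<oplus>\<index>" 65)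
  mv_neg :: "'a \<Rightarrow> 'a" ("\<sim>\<index> _" [81] 80)

abbreviation mv_one :: "('a, 'b) mv_scheme \<Rightarrow> 'a"
  where "mv_one A \<equiv> mv_neg A (mv_zero A)"

definition mv_le :: "('a, 'b) mv_scheme \<Rightarrow> 'a \<Rightarrow> 'a \<Rightarrow> bool"
  where "mv_le A x y \<longleftrightarrow> mv_add A (mv_neg A x) y = mv_one A"

definition mv_lt :: "('a, 'b) mv_scheme \<Rightarrow> 'a \<Rightarrow> 'a \<Rightarrow> bool"
  where "mv_lt A x y \<longleftrightarrow> mv_le A x y \<and> x \<noteq> y"

primrec mv_mult :: "('a, 'b) mv_scheme \<Rightarrow> nat \<Rightarrow> 'a \<Rightarrow> 'a"
  where
    "mv_mult A 0 x = mv_zero A"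
  | "mv_mult A (Suc n) x = mv_add A (mv_mult A n x) x"

locale mv_algebra =
  fixes A (structure)
  assumes zero_closed: "\<zero> \<in> carrier A"
    and add_closed: "\<lbrakk>x \<in> carrier A; y \<in> carrier A\<rbrakk> \<Longrightarrow> x \<oplus> y \<in> carrier A"
    and neg_closed: "x \<in> carrier A \<Longrightarrow> \<sim> x \<in> carrier A"
    and add_assoc: "\<lbrakk>x \<in> carrier A; y \<in> carrier A; z \<in> carrier A\<rbrakk>
      \<Longrightarrow> (x \<oplus> y) \<oplus> z = x \<oplus> (y \<oplus> z)"
    and add_comm: "\<lbrakk>x \<in> carrier A; y \<in> carrier A\<rbrakk> \<Longrightarrow> x \<oplus> y = y \<oplus> x"
    and add_zero: "x \<in> carrier A \<Longrightarrow> x \<oplus> \<zero> = x"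
    and neg_neg: "x \<in> carrier A \<Longrightarrow> \<sim> (\<sim> x) = x"
    and add_one: "x \<in> carrier A \<Longrightarrow> x \<oplus> \<sim> \<zero> = \<sim> \<zero>"
    and lukasiewicz: "\<lbrakk>x \<in> carrier A; y \<in> carrier A\<rbrakk>
      \<Longrightarrow> \<sim> (\<sim> x \<oplus> y) \<oplus> y = \<sim> (\<sim> y \<oplus> x) \<oplus> x"

locale mv_chain = mv_algebra +
  assumes linear: "\<lbrakk>x \<in> carrier A; y \<in> carrier A\<rbrakk> \<Longrightarrow> mv_le A x y \<or> mv_le A y x"

definition mv_atom :: "('a, 'b) mv_scheme \<Rightarrow> 'a \<Rightarrow> bool"
  where "mv_atom A x \<longleftrightarrow> x \<in> carrier A \<and> mv_lt A (mv_zero A) x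
    \<and> {y \<in> carrier A. mv_le A y x} = {mv_zero A, x}"

definition mv_atomic :: "('a, 'b) mv_scheme \<Rightarrow> bool"
  where "mv_atomic A \<longleftrightarrow> (\<exists>x. mv_atom A x)"

text \<open>The least positive element; meaningful for atomic MV-chains only.\<close>

definition mv_eps :: "('a, 'b) mv_scheme \<Rightarrow> 'a"
  where "mv_eps A = (THE e. e \<in> carrier A \<and> mv_lt A (mv_zero A) e
    \<and> (\<forall>y\<in>carrier A. mv_lt A (mv_zero A) y \<longrightarrow> mv_le A e y))"

text \<open>\<open>mv_increasing A n x\<close> says \<open>0 < x < 2.x < \<dots> < n.x\<close>.\<close>

definition mv_increasing :: "('a, 'b) mv_scheme \<Rightarrow> nat \<Rightarrow> 'a \<Rightarrow> bool"
  where "mv_increasing A n x \<longleftrightarrow> (\<forall>i<n. mv_lt A (mv_mult A i x) (mv_mult A (Suc i) x))"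

definition mv_regular :: "('a, 'b) mv_scheme \<Rightarrow> bool"
  where "mv_regular A \<longleftrightarrow>
    (\<forall>n\<ge>2. \<forall>xs \<in> {1..n} \<rightarrow> carrier A.
      mv_lt A (mv_zero A) (xs 1) \<and> (\<forall>i\<in>{1..<n}. mv_lt A (xs i) (xs (Suc i))) \<longrightarrow>
      (\<exists>x\<in>carrier A. mv_le A (xs 1) (mv_mult A n x) \<and> mv_le A (mv_mult A n x) (xs n)
        \<and> mv_increasing A n x))"


section \<open>First-order logic over the language of MV-algebras\<close>

datatype mv_term = Var nat | Zero | Add mv_term mv_term | Neg mv_term

datatype mv_formula =
    Equal mv_term mv_term
  | Not mv_formula
  | And mv_formula mv_formula
  | Exists nat mv_formula

primrec term_vars :: "mv_term \<Rightarrow> nat set"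
  where
    "term_vars (Var i) = {i}"
  | "term_vars Zero = {}"
  | "term_vars (Add s t) = term_vars s \<union> term_vars t"
  | "term_vars (Neg t) = term_vars t"

primrec free_vars :: "mv_formula \<Rightarrow> nat set"
  where
    "free_vars (Equal s t) = term_vars s \<union> term_vars t"
  | "free_vars (Not \<phi>) = free_vars \<phi>"
  | "free_vars (And \<phi> \<psi>) = free_vars \<phi> \<union> free_vars \<psi>"
  | "free_vars (Exists i \<phi>) = free_vars \<phi> - {i}"

definition sentence :: "mv_formula \<Rightarrow> bool"
  where "sentence \<phi> \<longleftrightarrow> free_vars \<phi> = {}"

primrec term_val :: "('a, 'b) mv_scheme \<Rightarrow> (nat \<Rightarrow> 'a) \<Rightarrow> mv_term \<Rightarrow> 'a"
  where
    "term_val A e (Var i) = e i"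
  | "term_val A e Zero = mv_zero A"
  | "term_val A e (Add s t) = mv_add A (term_val A e s) (term_val A e t)"
  | "term_val A e (Neg t) = mv_neg A (term_val A e t)"

primrec sat :: "('a, 'b) mv_scheme \<Rightarrow> (nat \<Rightarrow> 'a) \<Rightarrow> mv_formula \<Rightarrow> bool"
  where
    "sat A e (Equal s t) \<longleftrightarrow> term_val A e s = term_val A e t"
  | "sat A e (Not \<phi>) \<longleftrightarrow> \<not> sat A e \<phi>"
  | "sat A e (And \<phi> \<psi>) \<longleftrightarrow> sat A e \<phi> \<and> sat A e \<psi>"
  | "sat A e (Exists i \<phi>) \<longleftrightarrow> (\<exists>a\<in>carrier A. sat A (e(i := a)) \<phi>)"

definition models :: "('a, 'b) mv_scheme \<Rightarrow> mv_formula \<Rightarrow> bool"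
  where "models A \<phi> \<longleftrightarrow> (\<forall>e \<in> UNIV \<rightarrow> carrier A. sat A e \<phi>)"

definition elem_equiv :: "('a, 'c) mv_scheme \<Rightarrow> ('b, 'd) mv_scheme \<Rightarrow> bool"
  where "elem_equiv A B \<longleftrightarrow> (\<forall>\<phi>. sentence \<phi> \<longrightarrow> (models A \<phi> \<longleftrightarrow> models B \<phi>))"

text \<open>Every finite structure has an isomorphic copy with carrier a set of natural numbers, so
  quantifying over finite MV-chains on \<^typ>\<open>nat\<close> captures all finite MV-chains; see
  \<open>models_all_finite\<close> below.\<close>

definition pseudofinite :: "('a, 'b) mv_scheme \<Rightarrow> bool"
  where "pseudofinite A \<longleftrightarrow>
    (\<forall>\<phi>. sentence \<phi> \<and> (\<forall>B :: nat mv. mv_chain B \<and> finite (carrier B) \<longrightarrow> models B \<phi>)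
      \<longrightarrow> models A \<phi>)"

lemma term_val_closed:
  assumes "mv_algebra A" "e \<in> UNIV \<rightarrow> carrier A"
  shows "term_val A e t \<in> carrier A"
proof -
  interpret mv_algebra A by fact
  show ?thesis using assms(2) by (induction t) (auto simp: zero_closed add_closed neg_closed)
qed

lemma sat_iso:
  assumes A: "mv_algebra A"
    and f: "bij_betw f (carrier A) (carrier B)"
    and f0: "f (mv_zero A) = mv_zero B"
    and fadd: "\<And>x y. x \<in> carrier A \<Longrightarrow> y \<in> carrier A \<Longrightarrow> f (mv_add A x y) = mv_add B (f x) (f y)"
    and fneg: "\<And>x. x \<in> carrier A \<Longrightarrow> f (mv_neg A x) = mv_neg B (f x)"
    and e: "e \<in> UNIV \<rightarrow> carrier A"
  shows "sat A e \<phi> \<longleftrightarrow> sat B (f \<circ> e) \<phi>"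
proof -
  have tv: "f (term_val A e t) = term_val B (f \<circ> e) t" if "e \<in> UNIV \<rightarrow> carrier A" for e t
    using that by (induction t) (auto simp: f0 fadd fneg term_val_closed[OF A])
  show ?thesis using e
  proof (induction \<phi> arbitrary: e)
    case (Equal s t)
    have "inj_on f (carrier A)" using f by (rule bij_betw_imp_inj_on)
    then have "term_val A e s = term_val A e t \<longleftrightarrow> f (term_val A e s) = f (term_val A e t)"
      using term_val_closed[OF A Equal] by (auto simp: inj_on_eq_iff)
    then show ?case by (simp only: tv[OF Equal] sat.simps)
  next
    case (Exists i \<phi>)
    have "sat A (e(i := a)) \<phi> \<longleftrightarrow> sat B ((f \<circ> e)(i := f a)) \<phi>" if "a \<in> carrier A" for a
    proof -
      have "e(i := a) \<in> UNIV \<rightarrow> carrier A" using that Exists.prems by auto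
      moreover have "f \<circ> e(i := a) = (f \<circ> e)(i := f a)" by auto
      ultimately show ?thesis using Exists.IH by metis
    qed
    moreover have "carrier B = f ` carrier A" using f by (simp add: bij_betw_def)
    ultimately show ?case by (simp only: sat.simps bex_simps cong: bex_cong)
  qed auto
qed

lemma models_all_finite:
  fixes A :: "('a, 'b) mv_scheme"
  assumes all: "\<And>B :: nat mv. mv_chain B \<Longrightarrow> finite (carrier B) \<Longrightarrow> models B \<phi>"
    and A: "mv_chain A" and fin: "finite (carrier A)"
  shows "models A \<phi>"
proof -
  interpret mv_chain A by fact
  obtain f :: "'a \<Rightarrow> nat" where inj: "inj_on f (carrier A)"
    using finite_imp_inj_to_nat_seg[OF fin] by blast
  define g where "g = the_inv_into (carrier A) f"
  have gf [simp]: "g (f x) = x" if "x \<in> carrier A" for x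
    using that inj by (simp add: g_def the_inv_into_f_f)
  define B :: "nat mv" where "B = \<lparr>carrier = f ` carrier A, mv_zero = f (mv_zero A),
    mv_add = (\<lambda>x y. f (mv_add A (g x) (g y))), mv_neg = (\<lambda>x. f (mv_neg A (g x)))\<rparr>"
  note cl = zero_closed add_closed neg_closed
  have [simp]: "carrier B = f ` carrier A" "mv_zero B = f (mv_zero A)"
    "mv_add B x y = f (mv_add A (g x) (g y))" "mv_neg B x = f (mv_neg A (g x))" for x y
    by (auto simp: B_def)
  have "mv_chain B"
  proof
    fix x y assume "x \<in> carrier B" "y \<in> carrier B"
    then show "mv_le B x y \<or> mv_le B y x"
      using linear unfolding mv_le_def by (fastforce simp: cl)
  next
    fix x y assume "x \<in> carrier B" "y \<in> carrier B"
    then show "mv_add B x y = mv_add B y x" by (auto simp: cl add_comm)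
  qed (auto simp: cl add_assoc add_zero neg_neg add_one lukasiewicz)
  with all fin have B: "models B \<phi>" by auto
  have "sat A e \<phi>" if "e \<in> UNIV \<rightarrow> carrier A" for e
  proof -
    have "sat A e \<phi> \<longleftrightarrow> sat B (f \<circ> e) \<phi>"
      using that inj by (intro sat_iso) (auto simp: cl bij_betw_def mv_algebra_axioms)
    moreover have "f \<circ> e \<in> UNIV \<rightarrow> carrier B" using that by auto
    ultimately show ?thesis using B by (auto simp: models_def)
  qed
  then show ?thesis by (simp add: models_def)
qed


section \<open>The Chang group of an MV-chain\<close>

text \<open>Chang's construction: the pair \<open>(m, x)\<close> stands for \<open>m u + x\<close> with \<open>0 \<le> x < u\<close>. The group is
  written multiplicatively in order to use the library's \<^locale>\<open>group\<close>. That this is a linearly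
  ordered abelian group with strong unit whose unit interval is \<open>A\<close> is proved below.\<close>

definition chang_group :: "('a, 'b) mv_scheme \<Rightarrow> (int \<times> 'a) monoid"
  where "chang_group A = \<lparr>
    carrier = UNIV \<times> (carrier A - {mv_one A}),
    monoid.mult = (\<lambda>(m, x) (n, y).
      if mv_add A x y = mv_one A
      then (m + n + 1, mv_neg A (mv_add A (mv_neg A x) (mv_neg A y)))
      else (m + n, mv_add A x y)),
    one = (0, mv_zero A)\<rparr>"

definition chang_le :: "('a, 'b) mv_scheme \<Rightarrow> int \<times> 'a \<Rightarrow> int \<times> 'a \<Rightarrow> bool"
  where "chang_le A g h \<longleftrightarrow> fst g < fst h \<or> fst g = fst h \<and> mv_le A (snd g) (snd h)"

definition chang_unit :: "('a, 'b) mv_scheme \<Rightarrow> int \<times> 'a"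
  where "chang_unit A = (1, mv_zero A)"

definition chang_emb :: "('a, 'b) mv_scheme \<Rightarrow> 'a \<Rightarrow> int \<times> 'a"
  where "chang_emb A x = (if x = mv_one A then chang_unit A else (0, x))"

context mv_chain
begin

abbreviation one_A ("\<one>\<^sub>A") where "\<one>\<^sub>A \<equiv> mv_one A"

lemmas closed [simp, intro] = zero_closed add_closed neg_closed

lemmas ac = add_assoc add_comm

lemma left_comm: "\<lbrakk>x \<in> carrier A; y \<in> carrier A; z \<in> carrier A\<rbrakk> \<Longrightarrow> x \<oplus> (y \<oplus> z) = y \<oplus> (x \<oplus> z)"
  by (metis add_assoc add_comm)

lemma zero_add: "x \<in> carrier A \<Longrightarrow> \<zero> \<oplus> x = x"
  by (metis add_comm add_zero closed(1))

lemma one_add: "x \<in> carrier A \<Longrightarrow> \<one>\<^sub>A \<oplus> x = \<one>\<^sub>A"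
  by (metis add_comm add_one closed)

lemma add_neg: "x \<in> carrier A \<Longrightarrow> x \<oplus> \<sim> x = \<one>\<^sub>A"
  using lukasiewicz[of "\<one>\<^sub>A" x]
  by (metis add_comm add_one closed neg_neg zero_add)

lemma neg_add: "x \<in> carrier A \<Longrightarrow> \<sim> x \<oplus> x = \<one>\<^sub>A"
  by (metis add_comm add_neg closed(3))

lemma neg_inj: "\<lbrakk>x \<in> carrier A; y \<in> carrier A\<rbrakk> \<Longrightarrow> \<sim> x = \<sim> y \<longleftrightarrow> x = y"
  by (metis neg_neg)

lemma le_refl: "x \<in> carrier A \<Longrightarrow> mv_le A x x"
  by (simp add: mv_le_def neg_add)

text \<open>If \<open>x \<le> y\<close> then \<open>y = x \<oplus> d\<close> with \<open>d = y \<odot> \<not>x\<close>.\<close>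

lemma le_diff:
  assumes "x \<in> carrier A" "y \<in> carrier A" "mv_le A x y"
  shows "y = x \<oplus> \<sim> (\<sim> y \<oplus> x)"
  using assms lukasiewicz[of x y]
  by (metis add_comm closed mv_le_def neg_neg zero_add)

lemma le_antisym:
  assumes "x \<in> carrier A" "y \<in> carrier A" "mv_le A x y" "mv_le A y x"
  shows "x = y"
  using assms lukasiewicz[of x y]
  by (metis closed mv_le_def neg_neg zero_add)

lemma le_add: "\<lbrakk>x \<in> carrier A; y \<in> carrier A\<rbrakk> \<Longrightarrow> mv_le A x (x \<oplus> y)"
  by (simp add: mv_le_def neg_add one_add flip: add_assoc)

lemma le_trans:
  assumes "x \<in> carrier A" "y \<in> carrier A" "z \<in> carrier A" "mv_le A x y" "mv_le A y z"
  shows "mv_le A x z"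
proof -
  have "z = x \<oplus> (\<sim> (\<sim> y \<oplus> x) \<oplus> \<sim> (\<sim> z \<oplus> y))"
    using le_diff[of x y] le_diff[of y z] assms by (metis add_assoc closed)
  then show ?thesis using assms le_add by (metis closed)
qed

lemma add_mono:
  assumes "x \<in> carrier A" "y \<in> carrier A" "z \<in> carrier A" "mv_le A x y"
  shows "mv_le A (x \<oplus> z) (y \<oplus> z)"
proof -
  have "y \<oplus> z = (x \<oplus> z) \<oplus> \<sim> (\<sim> y \<oplus> x)"
    using le_diff[of x y] assms by (metis add_assoc add_comm closed)
  then show ?thesis using assms le_add by (metis closed)
qed

lemma le_one: "x \<in> carrier A \<Longrightarrow> mv_le A x \<one>\<^sub>A"
  by (simp add: mv_le_def add_one)

lemma zero_le: "x \<in> carrier A \<Longrightarrow> mv_le A \<zero> x"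
  by (simp add: mv_le_def one_add)

lemma one_le: "x \<in> carrier A \<Longrightarrow> mv_le A \<one>\<^sub>A x \<Longrightarrow> x = \<one>\<^sub>A"
  using le_antisym le_one by auto

lemma neg_mono: "\<lbrakk>x \<in> carrier A; y \<in> carrier A; mv_le A x y\<rbrakk> \<Longrightarrow> mv_le A (\<sim> y) (\<sim> x)"
  unfolding mv_le_def by (metis add_comm closed(3) neg_neg)

lemma add_eq_one: "\<lbrakk>x \<in> carrier A; y \<in> carrier A\<rbrakk> \<Longrightarrow> x \<oplus> y = \<one>\<^sub>A \<longleftrightarrow> mv_le A (\<sim> x) y"
  by (simp add: mv_le_def neg_neg)

lemma not_one_le:
  assumes "x \<in> carrier A" "y \<in> carrier A" "x \<oplus> y \<noteq> \<one>\<^sub>A"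
  shows "mv_le A y (\<sim> x)"
  using assms linear[of y "\<sim> x"] by (simp add: add_eq_one)

text \<open>Cancellation below \<open>1\<close>.\<close>

lemma cancel:
  assumes [simp]: "x \<in> carrier A" "y \<in> carrier A" "z \<in> carrier A"
    and "z \<oplus> x = z \<oplus> y" "z \<oplus> x \<noteq> \<one>\<^sub>A"
  shows "x = y"
proof -
  have *: "\<sim> (z \<oplus> \<sim> (z \<oplus> w)) = w" if [simp]: "w \<in> carrier A" and ne: "z \<oplus> w \<noteq> \<one>\<^sub>A" for w
  proof -
    have "w \<oplus> z \<noteq> \<one>\<^sub>A" using ne by (simp add: add_comm)
    then have "mv_le A z (\<sim> w)" by (intro not_one_le) auto
    then have "\<sim> w = z \<oplus> \<sim> (\<sim> (\<sim> w) \<oplus> z)" by (intro le_diff) auto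
    then have "\<sim> w = z \<oplus> \<sim> (z \<oplus> w)"
      by (simp only: neg_neg that(1) add_comm[OF that(1) assms(3)])
    then have "\<sim> (z \<oplus> \<sim> (z \<oplus> w)) = \<sim> (\<sim> w)" by (simp only:)
    then show ?thesis by (simp only: neg_neg that(1))
  qed
  have "z \<oplus> y \<noteq> \<one>\<^sub>A" using assms(4,5) by (simp only:) simp
  from *[OF assms(2) this] *[OF assms(1,5)] assms(4) show ?thesis by metis
qed

abbreviation odot (infixl "\<odot>" 70) where "x \<odot> y \<equiv> \<sim> (\<sim> x \<oplus> \<sim> y)"

lemma odot_comm: "\<lbrakk>x \<in> carrier A; y \<in> carrier A\<rbrakk> \<Longrightarrow> x \<odot> y = y \<odot> x"
  by (simp add: add_comm)

lemma odot_assoc: "\<lbrakk>x \<in> carrier A; y \<in> carrier A; z \<in> carrier A\<rbrakk> \<Longrightarrow> (x \<odot> y) \<odot> z = x \<odot> (y \<odot> z)"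
  by (simp add: neg_neg add_assoc)

text \<open>If \<open>x \<oplus> y = 1\<close> then \<open>y = \<not>x \<oplus> (x \<odot> y)\<close>.\<close>

lemma carry_split:
  assumes "x \<in> carrier A" "y \<in> carrier A" "x \<oplus> y = \<one>\<^sub>A"
  shows "\<sim> x \<oplus> (x \<odot> y) = y"
  using le_diff[of "\<sim> x" y] assms by (metis add_comm add_eq_one closed(3))

lemma odot_neq_one:
  assumes "x \<in> carrier A" "y \<in> carrier A" "y \<noteq> \<one>\<^sub>A"
  shows "x \<odot> y \<noteq> \<one>\<^sub>A"
proof
  assume "x \<odot> y = \<one>\<^sub>A"
  then have "\<sim> x \<oplus> \<sim> y = \<zero>" using assms by (metis closed(1,2,3) neg_inj)
  moreover have "mv_le A (\<sim> y) (\<sim> y \<oplus> \<sim> x)" using assms by (intro le_add) auto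
  ultimately have "\<sim> y = \<zero>" using assms zero_le le_antisym by (metis add_comm closed(1,3))
  with assms show False by (metis neg_neg)
qed

lemma carry_mixed:
  assumes [simp]: "a \<in> carrier A" "b \<in> carrier A" "c \<in> carrier A"
    and ab: "a \<oplus> b = \<one>\<^sub>A" and bc: "b \<oplus> c \<noteq> \<one>\<^sub>A"
  shows "(a \<odot> b) \<oplus> c = a \<odot> (b \<oplus> c)"
proof -
  let ?d = "a \<odot> b"
  have b: "\<sim> a \<oplus> ?d = b" by (rule carry_split) (use ab in auto)
  have "\<sim> a \<oplus> (?d \<oplus> c) = (\<sim> a \<oplus> ?d) \<oplus> c" by (simp add: add_assoc)
  then have s: "\<sim> a \<oplus> (?d \<oplus> c) = b \<oplus> c" by (simp only: b)
  have "a \<oplus> (b \<oplus> c) = (a \<oplus> b) \<oplus> c" by (simp add: add_assoc)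
  then have "a \<oplus> (b \<oplus> c) = \<one>\<^sub>A" by (simp add: ab one_add)
  then have "\<sim> a \<oplus> (a \<odot> (b \<oplus> c)) = b \<oplus> c" by (rule carry_split[rotated 2]) simp_all
  then have eq: "\<sim> a \<oplus> (?d \<oplus> c) = \<sim> a \<oplus> (a \<odot> (b \<oplus> c))" by (simp only: s)
  have ne: "\<sim> a \<oplus> (?d \<oplus> c) \<noteq> \<one>\<^sub>A" by (simp only: s bc not_False_eq_True)
  show ?thesis by (rule cancel[OF _ _ _ eq ne]) simp_all
qed

lemma carry_late:
  assumes [simp]: "a \<in> carrier A" "b \<in> carrier A" "c \<in> carrier A"
    and ab: "a \<oplus> b \<noteq> \<one>\<^sub>A" and bc: "b \<oplus> c \<noteq> \<one>\<^sub>A"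
  shows "(a \<oplus> b) \<odot> c = a \<odot> (b \<oplus> c)"
proof -
  define s t where "s = \<sim> (a \<oplus> b)" and "t = \<sim> (b \<oplus> c)"
  have [simp]: "s \<in> carrier A" "t \<in> carrier A" by (simp_all add: s_def t_def)
  have "\<sim> a = b \<oplus> \<sim> (\<sim> (\<sim> a) \<oplus> b)"
    using ab by (intro le_diff not_one_le) auto
  then have a: "\<sim> a = b \<oplus> s" by (simp only: s_def neg_neg assms(1))
  have "c \<oplus> b \<noteq> \<one>\<^sub>A" using bc by (simp only: add_comm[of c b] assms(2,3)) simp
  then have "\<sim> c = b \<oplus> \<sim> (\<sim> (\<sim> c) \<oplus> b)"
    by (intro le_diff not_one_le) auto
  then have c: "\<sim> c = b \<oplus> t" by (simp only: t_def neg_neg assms(2,3) add_comm[of c b])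
  have "s \<oplus> \<sim> c = \<sim> a \<oplus> t"
    unfolding a c by (simp add: add_assoc left_comm[of s b t])
  then show ?thesis by (simp only: s_def t_def)
qed

lemma carry_twice:
  assumes [simp]: "a \<in> carrier A" "b \<in> carrier A" "c \<in> carrier A"
    and ab: "a \<oplus> b = \<one>\<^sub>A" and bc: "b \<oplus> c = \<one>\<^sub>A"
  shows "(a \<odot> b) \<oplus> c = a \<oplus> (b \<odot> c)"
proof -
  have ba: "b \<oplus> a = \<one>\<^sub>A" using ab by (metis add_comm assms(1,2))
  have a: "\<sim> b \<oplus> (b \<odot> a) = a" by (rule carry_split) (use ba in auto)
  have c: "\<sim> b \<oplus> (b \<odot> c) = c" by (rule carry_split) (use bc in auto)
  have "(a \<odot> b) \<oplus> c = (b \<odot> a) \<oplus> (\<sim> b \<oplus> (b \<odot> c))"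
    by (simp only: c odot_comm[of a b] assms(1,2))
  also have "\<dots> = (\<sim> b \<oplus> (b \<odot> a)) \<oplus> (b \<odot> c)"
    using add_assoc[of "b \<odot> a" "\<sim> b" "b \<odot> c"] add_comm[of "b \<odot> a" "\<sim> b"] by simp
  also have "\<dots> = a \<oplus> (b \<odot> c)" by (simp only: a)
  finally show ?thesis .
qed

lemma chang_carrier: "(m, x) \<in> carrier (chang_group A) \<longleftrightarrow> x \<in> carrier A \<and> x \<noteq> \<one>\<^sub>A"
  by (auto simp: chang_group_def)

lemma chang_mult: "(m, x) \<otimes>\<^bsub>chang_group A\<^esub> (n, y) =
    (if x \<oplus> y = \<one>\<^sub>A then (m + n + 1, x \<odot> y) else (m + n, x \<oplus> y))"
  by (simp add: chang_group_def)

lemma chang_one: "\<one>\<^bsub>chang_group A\<^esub> = (0, \<zero>)"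
  by (simp add: chang_group_def)

lemma chang_closed:
  assumes "g \<in> carrier (chang_group A)" "h \<in> carrier (chang_group A)"
  shows "g \<otimes>\<^bsub>chang_group A\<^esub> h \<in> carrier (chang_group A)"
  using assms by (cases g; cases h) (auto simp: chang_carrier chang_mult odot_neq_one)

lemma chang_comm:
  assumes "g \<in> carrier (chang_group A)" "h \<in> carrier (chang_group A)"
  shows "g \<otimes>\<^bsub>chang_group A\<^esub> h = h \<otimes>\<^bsub>chang_group A\<^esub> g"
  using assms by (cases g; cases h) (auto simp: chang_carrier chang_mult add_comm)

lemma carry_mixed':
  assumes [simp]: "a \<in> carrier A" "b \<in> carrier A" "c \<in> carrier A"
    and ab: "a \<oplus> b \<noteq> \<one>\<^sub>A" and bc: "b \<oplus> c = \<one>\<^sub>A"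
  shows "a \<oplus> (b \<odot> c) = (a \<oplus> b) \<odot> c"
  using carry_mixed[of c b a] assms by (simp add: add_comm)

lemma chang_assoc:
  assumes "g \<in> carrier (chang_group A)" "h \<in> carrier (chang_group A)" "k \<in> carrier (chang_group A)"
  shows "(g \<otimes>\<^bsub>chang_group A\<^esub> h) \<otimes>\<^bsub>chang_group A\<^esub> k = g \<otimes>\<^bsub>chang_group A\<^esub> (h \<otimes>\<^bsub>chang_group A\<^esub> k)"
proof -
  obtain l a m b n c where g: "g = (l, a)" and h: "h = (m, b)" and k: "k = (n, c)"
    by (metis surj_pair)
  have [simp]: "a \<in> carrier A" "b \<in> carrier A" "c \<in> carrier A"
    and ne: "a \<noteq> \<one>\<^sub>A" "b \<noteq> \<one>\<^sub>A" "c \<noteq> \<one>\<^sub>A"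
    using assms by (auto simp: g h k chang_carrier)
  have as: "(a \<oplus> b) \<oplus> c = a \<oplus> (b \<oplus> c)" by (simp add: add_assoc)
  consider (ll) "a \<oplus> b \<noteq> \<one>\<^sub>A" "b \<oplus> c \<noteq> \<one>\<^sub>A" | (lh) "a \<oplus> b \<noteq> \<one>\<^sub>A" "b \<oplus> c = \<one>\<^sub>A"
    | (hl) "a \<oplus> b = \<one>\<^sub>A" "b \<oplus> c \<noteq> \<one>\<^sub>A" | (hh) "a \<oplus> b = \<one>\<^sub>A" "b \<oplus> c = \<one>\<^sub>A" by blast
  then show ?thesis
  proof cases
    case ll
    then show ?thesis using carry_late[of a b c] as by (simp add: g h k chang_mult)
  next
    case lh
    have "(a \<oplus> b) \<oplus> c = \<one>\<^sub>A" using lh as by (simp add: add_one)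
    moreover have "(a \<oplus> b) \<odot> c \<noteq> \<one>\<^sub>A" using ne by (intro odot_neq_one) auto
    ultimately show ?thesis using lh carry_mixed'[of a b c] by (simp add: g h k chang_mult)
  next
    case hl
    have "a \<oplus> (b \<oplus> c) = \<one>\<^sub>A" using hl as by (simp add: one_add)
    moreover have "a \<odot> (b \<oplus> c) \<noteq> \<one>\<^sub>A" using hl by (intro odot_neq_one) auto
    ultimately show ?thesis using hl carry_mixed[of a b c] by (simp add: g h k chang_mult)
  next
    case hh
    then show ?thesis using carry_twice[of a b c] odot_assoc[of a b c]
      by (simp add: g h k chang_mult)
  qed
qed

end

text \<open>A nontrivial MV-chain has a Chang group with the defining properties.\<close>

locale nontrivial_mv_chain = mv_chain +
  assumes nontrivial: "\<zero> \<noteq> \<sim> \<zero>"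
begin

abbreviation "G \<equiv> chang_group A"
abbreviation "u \<equiv> chang_unit A"

theorem chang_comm_group: "comm_group G"
proof (rule comm_groupI)
  show "\<one>\<^bsub>G\<^esub> \<in> carrier G" using nontrivial by (simp add: chang_one chang_carrier)
next
  fix g assume "g \<in> carrier G"
  then show "\<one>\<^bsub>G\<^esub> \<otimes>\<^bsub>G\<^esub> g = g"
    by (cases g) (auto simp: chang_carrier chang_one chang_mult zero_add)
next
  fix g assume g: "g \<in> carrier G"
  obtain m x where [simp]: "g = (m, x)" by (cases g)
  have x: "x \<in> carrier A" "x \<noteq> \<one>\<^sub>A" using g by (auto simp: chang_carrier)
  show "\<exists>h\<in>carrier G. h \<otimes>\<^bsub>G\<^esub> g = \<one>\<^bsub>G\<^esub>"
  proof (cases "x = \<zero>")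
    case True
    then show ?thesis using nontrivial
      by (intro bexI[of _ "(- m, \<zero>)"]) (auto simp: chang_carrier chang_one chang_mult zero_add)
  next
    case False
    then have "\<sim> x \<noteq> \<one>\<^sub>A" using x by (simp add: neg_inj)
    then show ?thesis using x
      by (intro bexI[of _ "(- m - 1, \<sim> x)"])
        (auto simp: chang_carrier chang_one chang_mult neg_add add_neg neg_neg)
  qed
qed (auto simp: chang_closed chang_assoc intro: chang_comm)

theorem chang_order:
  shows "g \<in> carrier G \<Longrightarrow> chang_le A g g"
    and "\<lbrakk>g \<in> carrier G; h \<in> carrier G; chang_le A g h; chang_le A h g\<rbrakk> \<Longrightarrow> g = h"
    and "\<lbrakk>g \<in> carrier G; h \<in> carrier G; k \<in> carrier G; chang_le A g h; chang_le A h k\<rbrakk>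
      \<Longrightarrow> chang_le A g k"
    and "\<lbrakk>g \<in> carrier G; h \<in> carrier G\<rbrakk> \<Longrightarrow> chang_le A g h \<or> chang_le A h g"
proof -
  show "g \<in> carrier G \<Longrightarrow> chang_le A g g"
    by (cases g) (auto simp: chang_le_def chang_carrier le_refl)
  show "\<lbrakk>g \<in> carrier G; h \<in> carrier G; chang_le A g h; chang_le A h g\<rbrakk> \<Longrightarrow> g = h"
    by (cases g; cases h) (auto simp: chang_le_def chang_carrier intro: le_antisym)
  show "\<lbrakk>g \<in> carrier G; h \<in> carrier G; k \<in> carrier G; chang_le A g h; chang_le A h k\<rbrakk>
      \<Longrightarrow> chang_le A g k"
    by (cases g; cases h; cases k) (auto simp: chang_le_def chang_carrier intro: le_trans)
  show "\<lbrakk>g \<in> carrier G; h \<in> carrier G\<rbrakk> \<Longrightarrow> chang_le A g h \<or> chang_le A h g"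
    using linear by (cases g; cases h) (auto simp: chang_le_def chang_carrier)
qed

theorem chang_translation:
  assumes "g \<in> carrier G" "h \<in> carrier G" "k \<in> carrier G" and le: "chang_le A g h"
  shows "chang_le A (g \<otimes>\<^bsub>G\<^esub> k) (h \<otimes>\<^bsub>G\<^esub> k)"
proof -
  obtain l a m b n c where g: "g = (l, a)" and h: "h = (m, b)" and k: "k = (n, c)"
    by (metis surj_pair)
  have [simp]: "a \<in> carrier A" "b \<in> carrier A" "c \<in> carrier A"
    and ne: "a \<noteq> \<one>\<^sub>A" "b \<noteq> \<one>\<^sub>A" "c \<noteq> \<one>\<^sub>A"
    using assms by (auto simp: g h k chang_carrier)
  have mono: "mv_le A (a \<odot> c) (b \<odot> c)" if "mv_le A a b"
    using that by (intro neg_mono add_mono) auto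
  have wrap: "mv_le A (x \<odot> c) (y \<oplus> c)" if "x \<in> carrier A" "y \<in> carrier A" for x y
  proof -
    have "mv_le A (\<sim> c) (\<sim> c \<oplus> \<sim> x)" using that by (intro le_add) auto
    then have "mv_le A (x \<odot> c) c"
      using neg_mono[of "\<sim> c" "\<sim> x \<oplus> \<sim> c"] that by (simp add: neg_neg add_comm)
    moreover have "mv_le A c (y \<oplus> c)" using that le_add[of c y] by (simp add: add_comm)
    ultimately show ?thesis using that by (meson le_trans closed \<open>c \<in> carrier A\<close>)
  qed
  have one_mono: "b \<oplus> c = \<one>\<^sub>A" if "mv_le A a b" "a \<oplus> c = \<one>\<^sub>A"
    using add_mono[OF _ _ _ that(1), of c] that(2) by (intro one_le) auto
  from le consider "l < m" | "l = m" "mv_le A a b" by (auto simp: chang_le_def g h)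
  then show ?thesis
  proof cases
    case 1
    then show ?thesis using wrap[of a b] by (auto simp: chang_le_def g h k chang_mult)
  next
    case 2
    then show ?thesis using mono one_mono add_mono[of a b c]
      by (auto simp: chang_le_def g h k chang_mult)
  qed
qed

lemma chang_unit_pow: "u [^]\<^bsub>G\<^esub> (n::nat) = (int n, \<zero>)"
  using nontrivial
  by (induction n) (auto simp: nat_pow_def chang_unit_def chang_one chang_mult add_zero)

theorem chang_strong_unit:
  assumes "g \<in> carrier G"
  shows "\<exists>n::nat. chang_le A g (u [^]\<^bsub>G\<^esub> n)"
  by (rule exI[of _ "nat (fst g + 1)"]) (auto simp: chang_unit_pow chang_le_def)

theorem chang_emb_bij:
  "bij_betw (chang_emb A) (carrier A) {g \<in> carrier G. chang_le A \<one>\<^bsub>G\<^esub> g \<and> chang_le A g u}"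
proof (rule bij_betwI')
  fix x y assume "x \<in> carrier A" "y \<in> carrier A"
  then show "chang_emb A x = chang_emb A y \<longleftrightarrow> x = y"
    by (auto simp: chang_emb_def chang_unit_def)
next
  fix x assume "x \<in> carrier A"
  then show "chang_emb A x \<in> {g \<in> carrier G. chang_le A \<one>\<^bsub>G\<^esub> g \<and> chang_le A g u}"
    using nontrivial
    by (auto simp: chang_emb_def chang_unit_def chang_one chang_le_def chang_carrier zero_le le_refl)
next
  fix g assume "g \<in> {g \<in> carrier G. chang_le A \<one>\<^bsub>G\<^esub> g \<and> chang_le A g u}"
  then obtain m x where g: "g = (m, x)" "x \<in> carrier A" "x \<noteq> \<one>\<^sub>A"
    and le: "chang_le A \<one>\<^bsub>G\<^esub> (m, x)" "chang_le A (m, x) u"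
    by (cases g) (auto simp: chang_carrier)
  from le have "m = 0 \<or> m = 1 \<and> mv_le A x \<zero>"
    by (auto simp: chang_le_def chang_one chang_unit_def)
  then have "m = 0 \<or> m = 1 \<and> x = \<zero>" using g le_antisym zero_le by auto
  then show "\<exists>y\<in>carrier A. g = chang_emb A y"
    using g by (auto simp: chang_emb_def chang_unit_def)
qed

theorem chang_emb_ops:
  assumes "x \<in> carrier A" "y \<in> carrier A"
  shows "chang_emb A \<zero> = \<one>\<^bsub>G\<^esub>"
    and "chang_emb A \<one>\<^sub>A = u"
    and "chang_emb A (\<sim> x) = u \<otimes>\<^bsub>G\<^esub> inv\<^bsub>G\<^esub> (chang_emb A x)"
    and "chang_emb A (x \<oplus> y) =
      (let s = chang_emb A x \<otimes>\<^bsub>G\<^esub> chang_emb A y in if chang_le A s u then s else u)"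
proof -
  interpret G: comm_group G by (rule chang_comm_group)
  note emb = chang_emb_def chang_unit_def chang_one
  have cl: "chang_emb A z \<in> carrier G" if "z \<in> carrier A" for z
    using bij_betwE[OF chang_emb_bij] that by auto
  show "chang_emb A \<zero> = \<one>\<^bsub>G\<^esub>" "chang_emb A \<one>\<^sub>A = u"
    using nontrivial by (auto simp: emb)
  have uc: "u \<in> carrier G" using nontrivial by (simp add: chang_unit_def chang_carrier)
  have "chang_emb A (\<sim> x) \<otimes>\<^bsub>G\<^esub> chang_emb A x = u"
    using assms nontrivial
    by (auto simp: emb chang_mult neg_neg neg_inj zero_add add_zero neg_add add_neg)
  then show "chang_emb A (\<sim> x) = u \<otimes>\<^bsub>G\<^esub> inv\<^bsub>G\<^esub> (chang_emb A x)"
    using assms uc cl by (metis G.inv_solve_right closed(3))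
  have z: "mv_le A z \<zero> \<Longrightarrow> z = \<zero>" if "z \<in> carrier A" for z
    using that le_antisym zero_le by auto
  show "chang_emb A (x \<oplus> y) =
      (let s = chang_emb A x \<otimes>\<^bsub>G\<^esub> chang_emb A y in if chang_le A s u then s else u)"
    using assms nontrivial z[of x] z[of y] z[of "x \<odot> y"]
    by (auto simp: emb chang_mult chang_le_def Let_def zero_add add_zero one_add add_one le_refl)
qed

end


section \<open>The statements \<open>D\<^bsub>q,k\<^esub>\<close>\<close>

text \<open>\<open>mv_D A q k\<close> is \<open>D\<^bsub>q,k\<^esub>\<close> for a prime power \<open>q\<close>: some \<open>x\<close> has \<open>0 < x < 2.x < \<dots> < (q - 1).x\<close>
  and \<open>q x - k \<epsilon> \<in> \<int> u\<close> in the Chang group.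

  The multiples of \<open>x\<close> are elements of the cyclically ordered group \<open>G\<^sub>A / \<int> u\<^sub>A\<close>, whose underlying
  set is \<open>[0, u)\<close>; hence the clause \<open>(q - 1).x < 1\<close>. For infinite atomic \<open>A\<close> and \<open>q \<ge> 4\<close> that clause
  follows from the others. For \<open>q = 2\<close> and \<open>q = 3\<close> the truncation in \<open>(q - 1).x\<close> makes it
  necessary: without it \<open>x = 1\<close> would witness \<open>D\<^bsub>2,0\<^esub>\<close> in every nontrivial MV-chain.\<close>

definition mv_D :: "('a, 'b) mv_scheme \<Rightarrow> nat \<Rightarrow> nat \<Rightarrow> bool"
  where "mv_D A q k \<longleftrightarrow> (\<exists>x\<in>carrier A.
    mv_increasing A (q - 1) x \<and> mv_lt A (mv_mult A (q - 1) x) (mv_one A) \<and>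
    (chang_emb A x [^]\<^bsub>chang_group A\<^esub> q)
      \<otimes>\<^bsub>chang_group A\<^esub> inv\<^bsub>chang_group A\<^esub> (chang_emb A (mv_eps A) [^]\<^bsub>chang_group A\<^esub> k)
      \<in> range (\<lambda>z::int. chang_unit A [^]\<^bsub>chang_group A\<^esub> z))"


section \<open>Finite chains and ultraproducts\<close>

definition fin_chain :: "nat \<Rightarrow> nat mv"
  where "fin_chain n = \<lparr>carrier = {0..n}, mv_zero = 0,
    mv_add = (\<lambda>x y. min (x + y) n), mv_neg = (\<lambda>x. n - x)\<rparr>"

lemma fin_chain_mv_chain: "mv_chain (fin_chain n)"
  by unfold_locales (auto simp: fin_chain_def mv_le_def)

text \<open>Ultrafilters on \<open>I\<close> are represented as filters on the ambient type that contain \<open>I\<close>;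
  membership of \<open>S\<close> is \<open>eventually (\<lambda>i. i \<in> S) U\<close>.\<close>

definition ultrafilter_on :: "'i set \<Rightarrow> 'i filter \<Rightarrow> bool"
  where "ultrafilter_on I U \<longleftrightarrow> U \<noteq> bot \<and> U \<le> principal I
    \<and> (\<forall>P. eventually P U \<or> eventually (\<lambda>i. \<not> P i) U)"

definition nonprincipal :: "'i filter \<Rightarrow> bool"
  where "nonprincipal U \<longleftrightarrow> (\<forall>i. U \<noteq> principal {i})"

definition ultra_rel :: "'i set \<Rightarrow> 'i filter \<Rightarrow> ('i \<Rightarrow> 'a mv) \<Rightarrow> (('i \<Rightarrow> 'a) \<times> ('i \<Rightarrow> 'a)) set"
  where "ultra_rel I U M = {(f, g). f \<in> (\<Pi>\<^sub>E i\<in>I. carrier (M i)) \<and> g \<in> (\<Pi>\<^sub>E i\<in>I. carrier (M i))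
    \<and> eventually (\<lambda>i. f i = g i) U}"

definition ultraproduct :: "'i set \<Rightarrow> 'i filter \<Rightarrow> ('i \<Rightarrow> 'a mv) \<Rightarrow> ('i \<Rightarrow> 'a) set mv"
  where "ultraproduct I U M = \<lparr>
    carrier = (\<Pi>\<^sub>E i\<in>I. carrier (M i)) // ultra_rel I U M,
    mv_zero = ultra_rel I U M `` {\<lambda>i\<in>I. mv_zero (M i)},
    mv_add = (\<lambda>X Y. \<Union>f\<in>X. \<Union>g\<in>Y. ultra_rel I U M `` {\<lambda>i\<in>I. mv_add (M i) (f i) (g i)}),
    mv_neg = (\<lambda>X. \<Union>f\<in>X. ultra_rel I U M `` {\<lambda>i\<in>I. mv_neg (M i) (f i)})\<rparr>"

end

theory Submission
  imports Defs "HOL-Algebra.Free_Abelian_Groups" "HOL-Library.Multiset"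
begin

text \<open>For an infinite atomic MV-chain \<open>A\<close>, regularity says that \<open>G\<^sub>A / \<int> \<epsilon>\<^sub>A\<close> is divisible, so that \<open>G\<^sub>A\<close> is
  a model of Presburger arithmetic in which \<open>u\<^sub>A\<close> exceeds every \<open>n \<epsilon>\<^sub>A\<close>. A back-and-forth argument
  bounds, for each sentence, a modulus and a threshold such that its truth in \<open>A\<close> depends only on the
  residue of \<open>u\<^sub>A\<close> for that modulus, provided that \<open>u\<^sub>A\<close> is above the threshold. The same holds for the
  chains \<open>[0, n]\<close>, which therefore share each sentence true in \<open>A\<close> for suitable \<open>n\<close>. The formula
  \<open>D\<^bsub>q,k\<^esub>\<close> says \<open>u\<^sub>A \<equiv> - k \<epsilon>\<^sub>A\<close> modulo \<open>q\<close>; residues modulo prime powers determine all others. It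
  is expressed by one sentence, to which the theorem of Los applies in the ultraproduct.\<close>

section \<open>Discretely preordered groups\<close>

text \<open>The game is played with explicit bounds because part (2) compares an infinite chain with
  finite ones. These are not elementarily equivalent, so no back-and-forth system of partial
  isomorphisms exists, and agreement can be kept only for the rounds that a given sentence needs.
  Bounding the coefficients of linear forms and the modulus gives an invariant that both kinds of
  chain can satisfy. At the start the only elements in play are e and u; once u is above the
  threshold, c e + d u has the sign of d, or that of c if d = 0, so nothing but the residue of u is
  left to compare.

  Equality modulo \<open>Z\<close> comes from the ambient type. The Chang group lives on a set that
  depends on the chain, while forms are handled best in a type with integer multiples. The order is
  therefore pulled back along a surjection from a free abelian group, which turns it into a
  preorder.

  The definition of \<open>mv_D\<close> quantifies over all integer multiples of u, which is not
  first-order. The strict inequalities in it leave u itself as the only possible multiple, and this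
  makes a single sentence possible.\<close>

text \<open>\<open>N\<close> is the cone of non-negative elements. Of the ring only the additive group matters; its
  multiplication provides the integer multiples \<open>of_int k * x\<close>. \<open>Z\<close> is the subgroup of the elements
  that vanish in the ordered quotient group.\<close>

locale cone =
  fixes N :: "'g::comm_ring_1 \<Rightarrow> bool"
  assumes N_add: "N x \<Longrightarrow> N y \<Longrightarrow> N (x + y)"
    and N_total: "N x \<or> N (- x)"
begin

definition Z :: "'g \<Rightarrow> bool"
  where "Z x \<longleftrightarrow> N x \<and> N (- x)"

lemma N_0 [simp]: "N 0"
  using N_total[of 0] by simp

lemma Z_0 [simp]: "Z 0"
  by (simp add: Z_def)

lemma Z_N: "Z x \<Longrightarrow> N x"
  by (simp add: Z_def)

lemma Z_add: "Z x \<Longrightarrow> Z y \<Longrightarrow> Z (x + y)"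
  using N_add[of x y] N_add[of "-x" "-y"] by (simp add: Z_def)

lemma Z_minus: "Z x \<Longrightarrow> Z (- x)"
  by (simp add: Z_def)

lemma Z_diff: "Z x \<Longrightarrow> Z y \<Longrightarrow> Z (x - y)"
  using Z_add[of x "- y"] by (simp add: Z_minus)

lemma Z_sym: "Z (x - y) \<Longrightarrow> Z (y - x)"
  using Z_minus[of "x - y"] by simp

lemma Z_trans: "Z (x - y) \<Longrightarrow> Z (y - w) \<Longrightarrow> Z (x - w)"
  using Z_add[of "x - y" "y - w"] by simp

lemma N_trans: "N (x - y) \<Longrightarrow> N (y - w) \<Longrightarrow> N (x - w)"
  using N_add[of "x - y" "y - w"] by simp

lemma N_cong: "Z (x - y) \<Longrightarrow> N x \<longleftrightarrow> N y"
  using N_add[of x "y - x"] N_add[of y "x - y"] by (auto simp: Z_def)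

lemma Z_cong: "Z (x - y) \<Longrightarrow> Z x \<longleftrightarrow> Z y"
  using N_cong[of x y] N_cong[of "- x" "- y"] Z_minus[of "x - y"] by (simp add: Z_def)

lemma N_of_nat: "N x \<Longrightarrow> N (of_nat k * x)"
  by (induction k) (auto simp: algebra_simps N_add)

lemma N_of_int: "N x \<Longrightarrow> 0 \<le> k \<Longrightarrow> N (of_int k * x)"
  using N_of_nat[of x "nat k"] by simp

lemma Z_of_int: "Z x \<Longrightarrow> Z (of_int k * x)"
  using N_of_int[of x k] N_of_int[of "-x" k] N_of_int[of x "-k"] N_of_int[of "-x" "-k"]
  by (cases "0 \<le> k") (auto simp: Z_def)

text \<open>Totality makes the group torsion-free modulo \<open>Z\<close>: if x were negative,
  adding (k - 1) (- x) \<ge> 0 to k x \<ge> 0 would give back x \<ge> 0.\<close>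

lemma N_cancel:
  assumes "0 < k"
  shows "N (of_int k * x) \<longleftrightarrow> N x"
proof
  assume kx: "N (of_int k * x)"
  show "N x"
  proof (rule ccontr)
    assume "\<not> N x"
    then have "N (of_int (k - 1) * (- x))" using N_total assms by (intro N_of_int) auto
    from N_add[OF kx this] \<open>\<not> N x\<close> show False by (simp add: algebra_simps)
  qed
qed (use assms in \<open>auto intro: N_of_int\<close>)

lemma not_N: "\<not> N x \<Longrightarrow> N (- x)"
  using N_total by blast

lemma finite_max:
  assumes "finite S" "S \<noteq> {}"
  shows "\<exists>s\<in>S. \<forall>t\<in>S. N (s - t)"
  using assms
proof (induction rule: finite_ne_induct)
  case (insert x S)
  then obtain s where s: "s \<in> S" "\<forall>t\<in>S. N (s - t)" by blast
  show ?case
  proof (cases "N (s - x)")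
    case True
    then show ?thesis using s by auto
  next
    case False
    then have "N (x - s)" using not_N[of "s - x"] by simp
    then show ?thesis using s N_trans[of x s] by auto
  qed
qed auto

end

section \<open>Residues in a discretely preordered group\<close>

locale discrete_cone = cone +
  fixes e
  assumes e_pos: "\<not> N (- e)"
    and discrete: "N x \<Longrightarrow> N (- x) \<or> N (x - e)"
begin

lemma N_e: "N e"
  using e_pos not_N[of "- e"] by simp

lemma N_int: "N (of_int k * e) \<longleftrightarrow> 0 \<le> k"
proof (cases "0 \<le> k")
  case False
  then have "N (of_int (- k) * (- e)) \<longleftrightarrow> N (- e)" by (intro N_cancel) simp
  with False e_pos show ?thesis by simp
qed (simp add: N_of_int N_e)

lemma Z_int: "Z (of_int k * e) \<longleftrightarrow> k = 0"
  using N_int[of k] N_int[of "-k"] by (auto simp: Z_def)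

text \<open>Residues are counted in multiples of \<open>e\<close>, up to \<open>Z\<close>. The
  notion is a relation because existence is an extra property (\<open>z_cone\<close>) and uniqueness
  holds only modulo n.\<close>

definition congr :: "int \<Rightarrow> 'a \<Rightarrow> int \<Rightarrow> bool"
  where "congr n x r \<longleftrightarrow> (\<exists>v. Z (x - (of_int r * e + of_int n * v)))"

lemma congrI: "Z (x - (of_int r * e + of_int n * v)) \<Longrightarrow> congr n x r"
  by (auto simp: congr_def)

lemma congr_add: "congr n x r \<Longrightarrow> congr n y s \<Longrightarrow> congr n (x + y) (r + s)"
proof -
  assume "congr n x r" "congr n y s"
  then obtain v w where "Z (x - (of_int r * e + of_int n * v))" "Z (y - (of_int s * e + of_int n * w))"
    by (auto simp: congr_def)
  from Z_add[OF this] show ?thesis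
    by (intro congrI[where v = "v + w"]) (simp add: algebra_simps)
qed

lemma congr_mult: "congr n x r \<Longrightarrow> congr n (of_int k * x) (k * r)"
proof -
  assume "congr n x r"
  then obtain v where "Z (x - (of_int r * e + of_int n * v))" by (auto simp: congr_def)
  from Z_of_int[OF this, of k] show ?thesis
    by (intro congrI[where v = "of_int k * v"]) (simp add: algebra_simps)
qed

lemma congr_scale: "congr n x r \<Longrightarrow> congr (k * n) (of_int k * x) (k * r)"
proof -
  assume "congr n x r"
  then obtain v where "Z (x - (of_int r * e + of_int n * v))" by (auto simp: congr_def)
  from Z_of_int[OF this, of k] show ?thesis
    by (intro congrI[where v = v]) (simp add: algebra_simps)
qed

lemma congr_minus: "congr n x r \<Longrightarrow> congr n (- x) (- r)"
  using congr_mult[of n x r "-1"] by simp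

lemma congr_diff: "congr n x r \<Longrightarrow> congr n y s \<Longrightarrow> congr n (x - y) (r - s)"
  using congr_add[of n x r "-y" "-s"] congr_minus by simp

lemma congr_cong: "Z (x - y) \<Longrightarrow> congr n x r \<longleftrightarrow> congr n y r"
  unfolding congr_def by (intro ex_cong1 Z_cong) simp

lemma congr_dvd: "congr n x r \<Longrightarrow> m dvd n \<Longrightarrow> congr m x r"
proof -
  assume "congr n x r" "m dvd n"
  then obtain v k where "Z (x - (of_int r * e + of_int n * v))" "n = m * k" by (auto simp: congr_def)
  then show ?thesis
    by (intro congrI[where v = "of_int k * v"]) (simp add: algebra_simps)
qed

lemma congr_0: "congr n 0 0"
  by (rule congrI[where v = 0]) simp

lemma congr_int: "n dvd k - r \<Longrightarrow> congr n (of_int k * e) r"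
proof -
  assume "n dvd k - r"
  then obtain q where "k = r + n * q" by (metis add.commute diff_eq_eq dvdE)
  then show ?thesis
    by (intro congrI[where v = "of_int q * e"]) (simp add: algebra_simps)
qed

lemma congr_e: "congr n e 1"
  using congr_int[of n 1 1] by simp

lemma congr_sum:
  "(\<And>i. i \<in> I \<Longrightarrow> congr n (x i) (r i)) \<Longrightarrow> congr n (sum x I) (sum r I)"
  by (induction I rule: infinite_finite_induct) (auto intro!: congr_add congr_0)

text \<open>Nothing lies strictly between 0 and e. If s e = n w with 0 < s < n, then w is positive,
  so w \<ge> e and n w \<ge> n e > s e.\<close>

lemma congr_int_iff:
  assumes "0 < n"
  shows "congr n (of_int k * e) r \<longleftrightarrow> n dvd k - r"
proof
  assume "congr n (of_int k * e) r"
  then obtain v where v: "Z (of_int k * e - (of_int r * e + of_int n * v))" by (auto simp: congr_def)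
  define s q where "s = (k - r) mod n" and "q = (k - r) div n"
  have kr: "k = r + s + n * q" by (simp add: s_def q_def)
  define w where "w = v - of_int q * e"
  have w: "Z (of_int s * e - of_int n * w)" using v by (simp add: kr w_def algebra_simps)
  have s: "0 \<le> s" "s < n" using assms by (auto simp: s_def)
  have "s = 0"
  proof (rule ccontr)
    assume "s \<noteq> 0"
    then have "\<not> N (of_int (- s) * e)" using s by (simp only: N_int)
    moreover have "Z (of_int (- s) * e - of_int n * (- w))" using Z_minus[OF w] by simp
    ultimately have "\<not> N (- w)" using N_cong N_cancel[OF assms] by blast
    with discrete[of w] not_N[of w] not_N[of "- w"] have "N (w - e)" by auto
    then have "N (of_int n * (w - e))" using assms by (intro N_of_int) auto
    from N_add[OF this Z_N[OF w]] have "N (of_int (s - n) * e)" by (simp add: algebra_simps)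
    with s show False by (auto simp only: N_int)
  qed
  then show "n dvd k - r" by (simp add: s_def dvd_eq_mod_eq_0)
qed (rule congr_int)

lemma congr_unique:
  assumes "0 < n" "congr n x r" "congr n x s"
  shows "n dvd r - s"
proof -
  have "congr n (of_int r * e) s"
  proof -
    from assms obtain v w where v: "Z (x - (of_int r * e + of_int n * v))"
      and w: "Z (x - (of_int s * e + of_int n * w))" by (auto simp: congr_def)
    from Z_diff[OF w v] show ?thesis
      by (intro congrI[where v = "w - v"]) (simp add: algebra_simps)
  qed
  with assms show ?thesis by (simp add: congr_int_iff)
qed

lemma congr_shift: "congr n x r \<Longrightarrow> n dvd r - s \<Longrightarrow> congr n x s"
  using congr_add[of n x r 0 "s - r"] congr_int[of n 0 "s - r"] by (simp add: dvd_diff_commute)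

end

text \<open>These are the Z-groups, up to the preorder: existence of all residues is divisibility of
  the quotient by the multiples of \<open>e\<close>.\<close>

locale z_cone = discrete_cone +
  assumes div_exists: "0 < n \<Longrightarrow> \<exists>r. congr n x r"

section \<open>The back-and-forth step\<close>

definition form :: "nat \<Rightarrow> (nat \<Rightarrow> int) \<Rightarrow> (nat \<Rightarrow> 'g::comm_ring_1) \<Rightarrow> 'g"
  where "form n c a = (\<Sum>i<n. of_int (c i) * a i)"

lemma form_lin:
  "form n (\<lambda>i. s * c i + t * d i) a = of_int s * form n c a + of_int t * form n d a"
  by (simp add: form_def sum_distrib_left sum.distrib algebra_simps)

lemma form_unit: "j < n \<Longrightarrow> form n (\<lambda>i. if i = j then k else 0) a = of_int k * a j"
  by (simp add: form_def if_distrib[of of_int] if_distrib[of "\<lambda>x. x * _"] sum.delta cong: if_cong)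

lemma form_upd:
  assumes "i < n"
  shows "form n c (a(i := x)) = of_int (c i) * x + form n (c(i := 0)) a"
proof -
  have "form n c (a(i := x)) = of_int (c i) * x + (\<Sum>j\<in>{..<n}-{i}. of_int (c j) * a j)"
    using assms by (auto simp: form_def sum.remove[of "{..<n}" i])
  moreover have "form n (c(i := 0)) a = (\<Sum>j\<in>{..<n}-{i}. of_int (c j) * a j)"
    using assms by (auto simp: form_def sum.remove[of "{..<n}" i])
  ultimately show ?thesis by simp
qed

text \<open>Coefficient functions are total on the naturals, so there are infinitely many of them;
  only their restrictions to i < n affect the form. Finiteness provides the greatest form below a
  given element.\<close>

lemma finite_forms:
  fixes a :: "nat \<Rightarrow> 'g::comm_ring_1"
  shows "finite ((\<lambda>c. form n c a) ` {c. (\<forall>i<n. \<bar>c i\<bar> \<le> B) \<and> P c})"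
proof (rule finite_subset)
  show "(\<lambda>c. form n c a) ` {c. (\<forall>i<n. \<bar>c i\<bar> \<le> B) \<and> P c}
      \<subseteq> (\<lambda>c. form n c a) ` (PiE {..<n} (\<lambda>_. {-B..B}))"
  proof (rule image_subsetI)
    fix c assume "c \<in> {c. (\<forall>i<n. \<bar>c i\<bar> \<le> B) \<and> P c}"
    then have "restrict c {..<n} \<in> PiE {..<n} (\<lambda>_. {-B..B})" by (auto simp: abs_le_iff minus_le_iff)
    moreover have "form n c a = form n (restrict c {..<n}) a" by (simp add: form_def)
    ultimately show "form n c a \<in> (\<lambda>c. form n c a) ` (PiE {..<n} (\<lambda>_. {-B..B}))" by blast
  qed
qed (simp add: finite_PiE)

text \<open>The invariant of the game, a bounded substitute for a partial isomorphism. Both bounds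
  shrink in each round.\<close>

definition sim where
  "sim N e N' e' n L M a b \<longleftrightarrow>
    (\<forall>c. (\<forall>i<n. \<bar>c i\<bar> \<le> L) \<longrightarrow> (N (form n c a) \<longleftrightarrow> N' (form n c b))) \<and>
    (\<forall>i<n. \<exists>r. discrete_cone.congr N e M (a i) r \<and> discrete_cone.congr N' e' M (b i) r)"

lemma sim_sym: "sim N e N' e' n L M a b \<Longrightarrow> sim N' e' N e n L M b a"
  unfolding sim_def by blast

lemma sim_mono:
  assumes "sim N e N' e' n L M a b" "discrete_cone N e" "discrete_cone N' e'" "L' \<le> L" "M' dvd M"
  shows "sim N e N' e' n L' M' a b"
  using assms unfolding sim_def
  by (meson discrete_cone.congr_dvd order_trans)

text \<open>Needed because an element of the unit interval is reached by an embedded chain element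
  only modulo \<open>Z\<close>.\<close>

lemma sim_cong:
  assumes N: "discrete_cone N e" and N': "discrete_cone N' e'" and s: "sim N e N' e' n L M a b"
    and z: "\<And>i. cone.Z N' (b i - b' i)"
  shows "sim N e N' e' n L M a b'"
proof -
  interpret N': discrete_cone N' e' by fact
  have "N'.Z (form n c b - form n c b')" for c
  proof -
    have "N'.Z (\<Sum>i<n. of_int (c i) * (b i - b' i))"
      by (induction n) (auto intro: N'.Z_add N'.Z_of_int z)
    then show ?thesis by (simp add: form_def algebra_simps sum_subtractf)
  qed
  then show ?thesis using s N'.N_cong N'.congr_cong[OF z] unfolding sim_def by blast
qed

text \<open>With K = L! and |k| \<le> L, multiplying k x0 + a \<cdot> c0 by K gives k (a \<cdot> tl)
  + K (a \<cdot> c0) + k j e in \<open>forth\<close>. The three summands bound the three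
  contributions to its coefficients.\<close>

definition step_L :: "int \<Rightarrow> int \<Rightarrow> int"
  where "step_L L M = fact (nat L) * L * L + fact (nat L) * L + L * (fact (nat L) * M)"

definition step_M :: "int \<Rightarrow> int \<Rightarrow> int"
  where "step_M L M = fact (nat L) * M"

text \<open>With \<open>K = L!\<close>, the type of \<open>x\<close> over \<open>a\<close> is determined by the residue of \<open>x\<close> and the position of
  \<open>K x\<close> among the forms in \<open>a\<close> with coefficients at most \<open>K L\<close>. If \<open>a \<cdot> tl\<close> is the greatest such form below
  \<open>K x\<close>, then \<open>x\<close> may be replaced by some \<open>x0\<close> with \<open>K x0 = a \<cdot> tl + j e\<close> for some \<open>j \<le> K M\<close>; the
  corresponding equation for \<open>b\<close> defines \<open>y\<close>.\<close>

lemma forth: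
  fixes N :: "'g::comm_ring_1 \<Rightarrow> bool" and N' :: "'h::comm_ring_1 \<Rightarrow> bool"
  assumes N: "z_cone N e" and N': "z_cone N' e'"
    and L: "1 \<le> L" and M: "1 \<le> M"
    and s: "sim N e N' e' n (step_L L M) (step_M L M) a b"
    and i: "0 < i" "i < n" and a0: "a 0 = e" and b0: "b 0 = e'"
    and x: "N x"
  shows "\<exists>y. sim N e N' e' n L M (a(i := x)) (b(i := y))"
proof -
  interpret N: z_cone N e by fact
  interpret N': z_cone N' e' by fact
  \<comment> \<open>Every k with 1 \<le> |k| \<le> L divides K, so scaling by K / |k| turns the sign
    of k x + a \<cdot> c0 into a comparison of K x with a form free of x.\<close>
  define K :: int where "K = fact (nat L)"
  have K: "0 < K" by (simp add: K_def)
  have Kdvd: "k dvd K" if "0 < k" "k \<le> L" for k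
  proof -
    have "nat k dvd fact (nat L)" using that by (intro dvd_fact) auto
    then have "int (nat k) dvd int (fact (nat L))" by (simp only: int_dvd_int_iff)
    then show ?thesis using that by (simp add: K_def)
  qed
  have sgn: "N (form n c a) \<longleftrightarrow> N' (form n c b)" if "\<forall>j<n. \<bar>c j\<bar> \<le> K*L*L + K*L + L*(K*M)" for c
    using s that by (simp add: sim_def step_L_def K_def)
  have "\<forall>j. \<exists>r. j < n \<longrightarrow> N.congr (K*M) (a j) r \<and> N'.congr (K*M) (b j) r"
    using s by (auto simp: sim_def step_M_def K_def)
  then obtain r where r: "\<And>j. j < n \<Longrightarrow> N.congr (K*M) (a j) (r j) \<and> N'.congr (K*M) (b j) (r j)"
    by metis
  \<comment> \<open>Position i is about to be overwritten, so it must not occur in the forms that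
    locate x.\<close>
  define T where "T = {t. (\<forall>j<n. \<bar>t j\<bar> \<le> K*L) \<and> t i = (0::int)}"
  define z where "z = of_int K * x"
  have z: "N z" using x K by (simp add: z_def N.N_of_int)
  define S where "S = (\<lambda>t. form n t a) ` {t. (\<forall>j<n. \<bar>t j\<bar> \<le> K*L) \<and> (t i = 0 \<and> N (z - form n t a))}"
  have "finite S" unfolding S_def by (rule finite_forms)
  \<comment> \<open>This is where x \<ge> 0 enters: the zero form is below z, so a greatest form
    below z exists.\<close>
  moreover have "form n (\<lambda>_. 0) a \<in> S"
    using K L z unfolding S_def by (intro imageI) (auto simp: form_def)
  ultimately obtain sl where sl: "sl \<in> S" "\<forall>s\<in>S. N (sl - s)"
    using N.finite_max[of S] by blast
  then obtain tl where tl: "tl \<in> T" "N (z - form n tl a)" and sl_eq: "sl = form n tl a"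
    by (auto simp: S_def T_def)
  have max: "N (form n tl a - form n t a)" if "t \<in> T" "N (z - form n t a)" for t
    using that sl by (auto simp: S_def T_def sl_eq)
  define \<rho> where "\<rho> = (\<Sum>j<n. tl j * r j)"
  have \<rho>a: "N.congr (K*M) (form n tl a) \<rho>" and \<rho>b: "N'.congr (K*M) (form n tl b) \<rho>"
    unfolding form_def \<rho>_def using r by (auto intro!: N.congr_sum N'.congr_sum N.congr_mult N'.congr_mult)
  obtain rx where rx: "N.congr M x rx" using N.div_exists[of M] M by auto
  have KM: "0 < K * M" using K M by simp
  have cz: "N.congr (K*M) (z - form n tl a) (K * rx - \<rho>)"
    using N.congr_diff[OF N.congr_scale[OF rx, of K] \<rho>a] by (simp add: z_def)
  \<comment> \<open>j represents the residue of z - a \<cdot> tl modulo K M. It is taken from 1,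
    ..., K M unless z meets the form, since j = 0 would put z0 on the form although z lies strictly
    above it.\<close>
  obtain j where j: "0 \<le> j" "j \<le> K*M" "K*M dvd j - (K * rx - \<rho>)"
    and j0: "j = 0 \<longleftrightarrow> N.Z (z - form n tl a)"
  proof (cases "N.Z (z - form n tl a)")
    case True
    then have "N.congr (K*M) (of_int 0 * e) (K * rx - \<rho>)"
      using cz N.congr_cong[of "z - form n tl a" "of_int 0 * e"] by simp
    then have "K*M dvd 0 - (K * rx - \<rho>)" using N.congr_int_iff[OF KM] by metis
    then show ?thesis using KM True by (intro that[of 0]) simp_all
  next
    case False
    define j where "j = (K * rx - \<rho> - 1) mod (K*M) + 1"
    have "K*M dvd j - (K * rx - \<rho>)"
    proof -
      have "j - (K * rx - \<rho>) = - (K*M * ((K * rx - \<rho> - 1) div (K*M)))"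
        unfolding j_def using minus_mult_div_eq_mod[of "K * rx - \<rho> - 1" "K*M"] by linarith
      then show ?thesis by simp
    qed
    moreover have "0 < j" "j \<le> K*M"
      using pos_mod_bound[OF KM, of "K * rx - \<rho> - 1"] pos_mod_sign[OF KM, of "K * rx - \<rho> - 1"]
      unfolding j_def by linarith+
    ultimately show ?thesis using False by (intro that[of j]) simp_all
  qed
  define z0 where "z0 = form n tl a + of_int j * e"
  have "N.congr (K*M) (z - form n tl a) j"
    using N.congr_shift[OF cz] j(3) by (simp add: dvd_diff_commute)
  then obtain w where w: "N.Z (z - z0 - of_int (K*M) * w)"
    by (auto simp: N.congr_def z0_def algebra_simps)
  have z0_ge: "N (z0 - form n tl a)" using j by (simp add: z0_def N.N_int)
  \<comment> \<open>z - z0 is a multiple of K M. If z < z0, then z \<le> z0 - K M e \<le> a \<cdot>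
    tl because j \<le> K M, and z would meet the form, contrary to j \<noteq> 0.\<close>
  have z0_le: "N (z - z0)"
  proof (cases "j = 0")
    case True
    then show ?thesis using j0 by (simp add: z0_def N.Z_N)
  next
    case False
    show ?thesis
    proof (rule ccontr)
      assume "\<not> ?thesis"
      then have "\<not> N (of_int (K*M) * w)" using w N.N_cong by blast
      then have nw: "\<not> N w" using N.N_cancel[OF KM] by blast
      then have "N (- w - e)" using N.discrete[of "- w"] N.not_N by auto
      then have "N (of_int (K*M) * (- w - e))" using KM by (intro N.N_of_int) auto
      from N.N_add[OF this N.Z_N[OF N.Z_minus[OF w]]]
      have "N (z0 - z - of_int (K*M) * e)" by (simp add: algebra_simps)
      moreover have "N (of_int (K*M - j) * e)" using j by (simp only: N.N_int)
      ultimately have "N ((z0 - z - of_int (K*M) * e) + of_int (K*M - j) * e)" by (rule N.N_add)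
      then have "N (- (z - form n tl a))" by (simp add: z0_def algebra_simps)
      then have "N.Z (z - form n tl a)" using tl by (simp add: N.Z_def)
      with j0 False show False by simp
    qed
  qed
  \<comment> \<open>z and z0 realise the same cut: a form at most z is at most a \<cdot> tl by
    maximality, hence at most z0.\<close>
  have below: "N (z - form n t a) \<longleftrightarrow> N (z0 - form n t a)" if "t \<in> T" for t
    using max[OF that] z0_ge z0_le N.N_trans by blast
  have above: "N (form n t a - z) \<longleftrightarrow> N (form n t a - z0)" if "t \<in> T" for t
  proof
    show "N (form n t a - z) \<Longrightarrow> N (form n t a - z0)" using z0_le N.N_trans by blast
    assume t: "N (form n t a - z0)"
    show "N (form n t a - z)"
    proof (rule ccontr)
      assume nt: "\<not> N (form n t a - z)"
      then have "N (z - form n t a)" using N.not_N[of "form n t a - z"] by simp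
      then have 1: "N (form n tl a - form n t a)" by (rule max[OF that])
      then have "N (form n tl a - z0)" using t N.N_trans by blast
      then have "N (of_int (- j) * e)" by (simp add: z0_def)
      then have "j = 0" using j by (auto simp only: N.N_int)
      then have "N.Z (z - form n tl a)" using j0 by simp
      then have "N (form n tl a - z)" using N.Z_def by simp
      moreover have "N (form n t a - form n tl a)" using t \<open>j = 0\<close> by (simp add: z0_def)
      ultimately show False using nt N.N_trans by blast
    qed
  qed
  \<comment> \<open>Since z - z0 = K M w modulo \<open>Z\<close>, this x0 solves K x0 = z0.\<close>
  define x0 where "x0 = x - of_int M * w"
  have x0: "N.Z (of_int K * x0 - z0)" using w by (simp add: x0_def z_def algebra_simps)
  obtain v where v: "N'.Z (form n tl b - (of_int \<rho> * e' + of_int (K*M) * v))"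
    using \<rho>b by (auto simp: N'.congr_def)
  obtain q where q: "j + \<rho> = K * rx + K*M*q"
  proof -
    obtain q where "j - (K * rx - \<rho>) = K*M*q" using j(3) by (elim dvdE)
    then show ?thesis using that[of q] by linarith
  qed
  \<comment> \<open>The quotient by K of b \<cdot> tl + j e' = (j + \<rho>) e' + K M v, where j +
    \<rho> = K rx + K M q. In this form the residue rx modulo M is visible.\<close>
  define y where "y = of_int rx * e' + of_int M * (of_int q * e' + v)"
  have y: "N'.Z (of_int K * y - (form n tl b + of_int j * e'))"
  proof -
    have "of_int K * y = of_int (K * rx + K*M*q) * e' + of_int (K*M) * v"
      by (simp add: y_def algebra_simps)
    also have "\<dots> = of_int j * e' + (of_int \<rho> * e' + of_int (K*M) * v)"
      by (simp only: q[symmetric]) (simp add: algebra_simps)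
    finally have "of_int K * y - (form n tl b + of_int j * e')
      = - (form n tl b - (of_int \<rho> * e' + of_int (K*M) * v))" by simp
    then show ?thesis using N'.Z_minus[OF v] by (simp only:)
  qed
  have "N (form n c (a(i := x))) \<longleftrightarrow> N' (form n c (b(i := y)))" if c: "\<forall>j<n. \<bar>c j\<bar> \<le> L" for c
  proof -
    define k where "k = c i"
    define c0 where "c0 = c(i := 0)"
    have k: "\<bar>k\<bar> \<le> L" using c i by (simp add: k_def)
    have c0: "c0 i = 0" "\<forall>j<n. \<bar>c0 j\<bar> \<le> L" using c L by (auto simp: c0_def)
    have T: "(\<lambda>j. h * c0 j) \<in> T" if "\<bar>h\<bar> \<le> K" for h
      using c0 that K L by (auto simp: T_def abs_mult intro!: mult_mono)
    have frm: "form n (\<lambda>j. h * c0 j) a = of_int h * form n c0 a" for h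
      using form_lin[of n h c0 0 c0] by simp
    have "N (of_int k * x + form n c0 a) \<longleftrightarrow> N (of_int k * x0 + form n c0 a)"
    proof (cases k "0::int" rule: linorder_cases)
      case greater
      then obtain h where h: "K = k * h" using Kdvd[of k] k by auto
      have h0: "0 < h" using K h greater by (simp add: zero_less_mult_iff)
      have "\<bar>- h\<bar> \<le> K" using h h0 greater by simp
      from below[OF T[OF this]]
      have *: "N (z + of_int h * form n c0 a) \<longleftrightarrow> N (z0 + of_int h * form n c0 a)"
        by (simp only: frm) simp
      have "N (of_int k * x + form n c0 a) \<longleftrightarrow> N (of_int h * (of_int k * x + form n c0 a))"
        using N.N_cancel[OF h0] by simp
      also have "of_int h * (of_int k * x + form n c0 a) = z + of_int h * form n c0 a"
        by (simp add: z_def h algebra_simps)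
      also note *
      also have "N (z0 + of_int h * form n c0 a) \<longleftrightarrow> N (of_int K * x0 + of_int h * form n c0 a)"
        using x0 by (intro N.N_cong) (simp add: N.Z_sym)
      also have "of_int K * x0 + of_int h * form n c0 a = of_int h * (of_int k * x0 + form n c0 a)"
        by (simp add: h algebra_simps)
      also have "N \<dots> \<longleftrightarrow> N (of_int k * x0 + form n c0 a)" using N.N_cancel[OF h0] .
      finally show ?thesis .
    next
      case less
      then have "- k dvd K" using k by (intro Kdvd) auto
      then obtain h where h: "K = (- k) * h" by (rule dvdE)
      have h0: "0 < h" using K h less by (simp add: zero_less_mult_iff mult_less_0_iff)
      have "1 * h \<le> (- k) * h" using h0 less by (intro mult_right_mono) auto
      then have "\<bar>h\<bar> \<le> K" using h h0 by simp
      from above[OF T[OF this]]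
      have *: "N (of_int h * form n c0 a - z) \<longleftrightarrow> N (of_int h * form n c0 a - z0)"
        by (simp only: frm)
      have "N (of_int k * x + form n c0 a) \<longleftrightarrow> N (of_int h * (of_int k * x + form n c0 a))"
        using N.N_cancel[OF h0] by simp
      also have "of_int h * (of_int k * x + form n c0 a) = of_int h * form n c0 a - z"
        by (simp add: z_def h algebra_simps)
      also note *
      also have "N (of_int h * form n c0 a - z0) \<longleftrightarrow> N (of_int h * form n c0 a - of_int K * x0)"
        using x0 by (intro N.N_cong) simp
      also have "of_int h * form n c0 a - of_int K * x0 = of_int h * (of_int k * x0 + form n c0 a)"
        by (simp add: h algebra_simps)
      also have "N \<dots> \<longleftrightarrow> N (of_int k * x0 + form n c0 a)" using N.N_cancel[OF h0] .
      finally show ?thesis .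
    qed simp
    also have "\<dots> \<longleftrightarrow> N' (of_int k * y + form n c0 b)"
    proof -
      \<comment> \<open>K (k x0 + a \<cdot> c0) as a form in the old tuple alone; the multiple of e
        is charged to entry 0.\<close>
      define d where "d l = 1 * (k * tl l + K * c0 l) + (k * j) * (if l = 0 then 1 else 0)" for l
      have fd: "form n d a' = of_int k * form n tl a' + of_int K * form n c0 a' + of_int (k * j) * a' 0"
        for a' :: "nat \<Rightarrow> 'x::comm_ring_1"
        unfolding d_def form_lin using form_unit[of 0 n 1 a'] i by simp
      have "\<bar>d l\<bar> \<le> K*L*L + K*L + L*(K*M)" if "l < n" for l
      proof -
        have "\<bar>k * tl l\<bar> \<le> L * (K*L)" using k tl that L K
          by (auto simp: abs_mult T_def intro!: mult_mono)
        moreover have "\<bar>K * c0 l\<bar> \<le> K * L" using c0 that L K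
          by (auto simp: abs_mult intro!: mult_mono)
        moreover have "\<bar>k * j\<bar> \<le> L * (K*M)" using k j L K
          by (auto simp: abs_mult intro!: mult_mono)
        moreover have "0 \<le> L * (K*M)" using L K M by simp
        ultimately show ?thesis by (auto simp: d_def algebra_simps abs_le_iff)
      qed
      then have "N (form n d a) \<longleftrightarrow> N' (form n d b)" by (intro sgn) auto
      moreover have "N (of_int k * x0 + form n c0 a) \<longleftrightarrow> N (form n d a)"
      proof -
        have "N (of_int k * x0 + form n c0 a) \<longleftrightarrow> N (of_int K * (of_int k * x0 + form n c0 a))"
          using N.N_cancel[OF K] by simp
        also have "\<dots> \<longleftrightarrow> N (form n d a)"
          using N.Z_of_int[OF x0, of k]
          by (intro N.N_cong) (simp add: fd a0 z0_def algebra_simps)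
        finally show ?thesis .
      qed
      moreover have "N' (of_int k * y + form n c0 b) \<longleftrightarrow> N' (form n d b)"
      proof -
        have "N' (of_int k * y + form n c0 b) \<longleftrightarrow> N' (of_int K * (of_int k * y + form n c0 b))"
          using N'.N_cancel[OF K] by simp
        also have "\<dots> \<longleftrightarrow> N' (form n d b)"
          using N'.Z_of_int[OF y, of k]
          by (intro N'.N_cong) (simp add: fd b0 algebra_simps)
        finally show ?thesis .
      qed
      ultimately show ?thesis by blast
    qed
    finally show ?thesis using i by (simp add: form_upd k_def c0_def)
  qed
  moreover have "\<exists>r. N.congr M ((a(i := x)) l) r \<and> N'.congr M ((b(i := y)) l) r" if "l < n" for l
  proof (cases "l = i")
    case True
    have "N'.congr M y rx" by (rule N'.congrI[where v = "of_int q * e' + v"]) (simp add: y_def)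
    then show ?thesis using True rx by auto
  next
    case False
    have "N.congr M (a l) (r l)" "N'.congr M (b l) (r l)"
      using r[OF that] N.congr_dvd[of "K*M" _ _ M] N'.congr_dvd[of "K*M" _ _ M] by auto
    with False show ?thesis by auto
  qed
  ultimately show ?thesis unfolding sim_def by blast
qed

section \<open>MV-chains as intervals of preordered groups\<close>

lemma (in mv_chain) atom_iff:
  "mv_atom A x \<longleftrightarrow> x \<in> carrier A \<and> mv_lt A \<zero> x \<and> (\<forall>y\<in>carrier A. mv_lt A \<zero> y \<longrightarrow> mv_le A x y)"
proof
  assume x: "mv_atom A x"
  have "mv_le A x y" if y: "y \<in> carrier A" "mv_lt A \<zero> y" for y
  proof (rule ccontr)
    assume n: "\<not> mv_le A x y"
    then have "mv_le A y x" using linear[of x y] x y by (auto simp: mv_atom_def)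
    then have "y = \<zero> \<or> y = x" using x y unfolding mv_atom_def by blast
    then show False using n y x le_refl[of x] by (auto simp: mv_lt_def mv_atom_def)
  qed
  then show "x \<in> carrier A \<and> mv_lt A \<zero> x \<and> (\<forall>y\<in>carrier A. mv_lt A \<zero> y \<longrightarrow> mv_le A x y)"
    using x by (auto simp: mv_atom_def)
next
  assume x: "x \<in> carrier A \<and> mv_lt A \<zero> x \<and> (\<forall>y\<in>carrier A. mv_lt A \<zero> y \<longrightarrow> mv_le A x y)"
  have "y = \<zero> \<or> y = x" if "y \<in> carrier A" "mv_le A y x" for y
    using x that zero_le[of y] le_antisym[of x y] by (auto simp: mv_lt_def)
  then show "mv_atom A x"
    using x le_refl[of x] zero_le[of x] by (auto simp: mv_atom_def)
qed

lemma (in mv_chain) mv_eps_eq: "mv_atom A x \<Longrightarrow> mv_eps A = x"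
  unfolding mv_eps_def by (rule the_equality) (auto simp: atom_iff intro: le_antisym)

lemma (in mv_chain) mult_closed [simp]: "x \<in> carrier A \<Longrightarrow> mv_mult A n x \<in> carrier A"
  by (induction n) auto

text \<open>\<open>A\<close> is identified with the interval \<open>[0, u]\<close> of a group that is only preordered, so that it can
  be the universe of a type; elements are to be compared modulo \<open>Z\<close>.\<close>

locale mv_rep = mv_chain A + cone N
  for A :: "('a, 'x) mv_scheme" (structure) and N :: "'g::comm_ring_1 \<Rightarrow> bool" +
  fixes emb :: "'a \<Rightarrow> 'g" and u :: 'g
  assumes emb_zero: "Z (emb \<zero>)"
    and emb_neg: "x \<in> carrier A \<Longrightarrow> Z (emb (\<sim> x) - (u - emb x))"
    and emb_add: "x \<in> carrier A \<Longrightarrow> y \<in> carrier A \<Longrightarrow>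
      Z (emb (x \<oplus> y) - (if N (u - (emb x + emb y)) then emb x + emb y else u))"
    and emb_ge: "x \<in> carrier A \<Longrightarrow> N (emb x)"
    and emb_le: "x \<in> carrier A \<Longrightarrow> N (u - emb x)"
    and emb_inj: "x \<in> carrier A \<Longrightarrow> y \<in> carrier A \<Longrightarrow> Z (emb x - emb y) \<Longrightarrow> x = y"
    and emb_surj: "N g \<Longrightarrow> N (u - g) \<Longrightarrow> \<exists>x\<in>carrier A. Z (emb x - g)"
    and unit_pos: "\<not> N (- u)"
    and decomp: "\<exists>m x. x \<in> carrier A \<and> Z (g - (of_int m * u + emb x))"
begin

definition trunc :: "'g \<Rightarrow> 'g"
  where "trunc g = (if N (u - g) then g else u)"

lemma N_u: "N u"
  using not_N[OF unit_pos] by simp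

lemma emb_one: "Z (emb (\<sim> \<zero>) - u)"
  using Z_add[OF emb_neg[OF zero_closed]] Z_minus[OF emb_zero] by fastforce

lemma emb_eq_iff: "x \<in> carrier A \<Longrightarrow> y \<in> carrier A \<Longrightarrow> x = y \<longleftrightarrow> Z (emb x - emb y)"
  using emb_inj by auto

lemma eq_iff:
  assumes "x \<in> carrier A" "y \<in> carrier A" "Z (emb x - g)" "Z (emb y - h)"
  shows "x = y \<longleftrightarrow> Z (g - h)"
  using assms emb_eq_iff Z_trans Z_sym by meson

lemma trunc_cong: "Z (g - h) \<Longrightarrow> Z (trunc g - trunc h)"
  using N_cong[of "u - g" "u - h"] Z_sym[of g h] by (auto simp: trunc_def)

text \<open>Truncating early does no harm: if one non-negative summand exceeds u, so does the full
  sum, and both sides are u. Iterated sums can thus be computed in the group and truncated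
  once.\<close>

lemma trunc_add:
  assumes "N g" "N h"
  shows "Z (trunc (trunc g + trunc h) - trunc (g + h))"
proof -
  have 1: "Z (trunc (u + k) - u)" if "N k" for k
    using that by (auto simp: trunc_def Z_def algebra_simps)
  have 2: "\<not> N (u - (g + h))" if "\<not> N (u - g) \<or> \<not> N (u - h)"
  proof
    assume "N (u - (g + h))"
    from N_add[OF this assms(1)] N_add[OF this assms(2)] that show False by auto
  qed
  show ?thesis
    using 1[OF assms(1)] 1[OF assms(2)] 1[OF N_u] 2
    by (auto simp: trunc_def add.commute)
qed

lemma emb_add_trunc:
  assumes "x \<in> carrier A" "y \<in> carrier A" "Z (emb x - trunc g)" "Z (emb y - trunc h)" "N g" "N h"
  shows "Z (emb (x \<oplus> y) - trunc (g + h))"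
proof -
  have "Z (emb (x \<oplus> y) - trunc (emb x + emb y))" using emb_add[OF assms(1,2)] by (simp add: trunc_def)
  moreover have "Z (trunc (emb x + emb y) - trunc (trunc g + trunc h))"
    using Z_add[OF assms(3,4)] by (intro trunc_cong) (simp add: algebra_simps)
  ultimately show ?thesis using trunc_add[OF assms(5,6)] Z_trans by blast
qed

lemma emb_trunc: "x \<in> carrier A \<Longrightarrow> Z (emb x - trunc (emb x))"
  by (simp add: trunc_def emb_le)

lemma emb_mult:
  assumes x: "x \<in> carrier A"
  shows "Z (emb (mv_mult A n x) - trunc (of_nat n * emb x))"
proof (induction n)
  case 0
  then show ?case by (simp add: emb_zero trunc_def N_u)
next
  case (Suc n)
  have "Z (emb (mv_mult A n x \<oplus> x) - trunc (of_nat n * emb x + emb x))"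
    using x Suc by (intro emb_add_trunc emb_trunc N_of_nat emb_ge) auto
  then show ?case by (simp add: algebra_simps)
qed

lemma le_iff: "x \<in> carrier A \<Longrightarrow> y \<in> carrier A \<Longrightarrow> mv_le A x y \<longleftrightarrow> N (emb y - emb x)"
proof -
  assume x: "x \<in> carrier A" and y: "y \<in> carrier A"
  have "mv_le A x y \<longleftrightarrow> Z (emb (\<sim> x \<oplus> y) - emb (\<sim> \<zero>))"
    unfolding mv_le_def using x y by (intro emb_eq_iff) auto
  also have "\<dots> \<longleftrightarrow> Z (emb (\<sim> x \<oplus> y) - u)"
    using emb_one by (intro Z_cong) (simp add: Z_sym)
  also have "\<dots> \<longleftrightarrow> Z (trunc (emb (\<sim> x) + emb y) - u)"
    using emb_add[of "\<sim> x" y] x y by (intro Z_cong) (simp add: trunc_def)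
  also have "\<dots> \<longleftrightarrow> Z (trunc (u - emb x + emb y) - u)"
    using trunc_cong[of "emb (\<sim> x) + emb y" "u - emb x + emb y"] emb_neg[OF x]
    by (intro Z_cong) simp
  also have "\<dots> \<longleftrightarrow> N (emb y - emb x)"
    using not_N[of "emb x - emb y"] by (auto simp: trunc_def Z_def)
  finally show ?thesis .
qed

lemma le_iff':
  assumes "x \<in> carrier A" "y \<in> carrier A" "Z (emb x - g)" "Z (emb y - h)"
  shows "mv_le A x y \<longleftrightarrow> N (h - g)"
  unfolding le_iff[OF assms(1,2)] using Z_diff[OF assms(4,3)] by (intro N_cong) (simp add: algebra_simps)

lemma lt_iff: "x \<in> carrier A \<Longrightarrow> y \<in> carrier A \<Longrightarrow> mv_lt A x y \<longleftrightarrow> \<not> N (emb x - emb y)"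
  using not_N[of "emb x - emb y"] by (auto simp: mv_lt_def le_iff emb_eq_iff Z_def)

lemma lt_iff':
  assumes "x \<in> carrier A" "y \<in> carrier A" "Z (emb x - g)" "Z (emb y - h)"
  shows "mv_lt A x y \<longleftrightarrow> \<not> N (g - h)"
  unfolding lt_iff[OF assms(1,2)] using Z_diff[OF assms(3,4)]
  by (intro arg_cong[where f = HOL.Not] N_cong) (simp add: algebra_simps)

lemma zero_lt_iff: "x \<in> carrier A \<Longrightarrow> mv_lt A \<zero> x \<longleftrightarrow> \<not> N (- emb x)"
  using lt_iff'[of \<zero> x 0 "emb x"] emb_zero by simp

lemma lt_one_iff: "x \<in> carrier A \<Longrightarrow> Z (emb x - trunc g) \<Longrightarrow> mv_lt A x (\<sim> \<zero>) \<longleftrightarrow> \<not> N (g - u)"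
  using lt_iff'[of x "\<sim> \<zero>" "trunc g" u] emb_one not_N[of "u - g"] by (auto simp: trunc_def)

text \<open>The step from i.x to (i + 1).x is strict exactly when x > 0 and i x < u. The last step,
  i = n - 1, implies the others; n.x itself may already be truncated.\<close>

lemma increasing_iff:
  assumes x: "x \<in> carrier A" and n: "1 \<le> n"
  shows "mv_increasing A n x \<longleftrightarrow> \<not> N (- emb x) \<and> \<not> N (of_nat (n - 1) * emb x - u)"
proof -
  have step: "mv_lt A (mv_mult A i x) (mv_mult A (Suc i) x) \<longleftrightarrow> \<not> N (- emb x) \<and> \<not> N (of_nat i * emb x - u)"
    for i
  proof -
    have s: "of_nat (Suc i) * emb x = of_nat i * emb x + emb x" by (simp add: algebra_simps)
    have "mv_lt A (mv_mult A i x) (mv_mult A (Suc i) x) \<longleftrightarrow>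
        \<not> N (trunc (of_nat i * emb x) - trunc (of_nat i * emb x + emb x))"
      using x emb_mult[OF x, of i] emb_mult[OF x, of "Suc i"] unfolding s
      by (intro lt_iff' mult_closed)
    also have "\<dots> \<longleftrightarrow> \<not> N (- emb x) \<and> \<not> N (of_nat i * emb x - u)"
    proof (cases "N (u - of_nat i * emb x)")
      case True
      show ?thesis
      proof (cases "N (u - (of_nat i * emb x + emb x))")
        case T2: True
        have "\<not> N (of_nat i * emb x - u)" if "\<not> N (- emb x)"
        proof
          assume "N (of_nat i * emb x - u)"
          from N_add[OF this T2] that show False by simp
        qed
        then show ?thesis using True T2 by (auto simp: trunc_def)
      next
        case F2: False
        have "\<not> N (- emb x)"
        proof
          assume "N (- emb x)"
          from N_add[OF this True] F2 show False by (simp add: algebra_simps)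
        qed
        then show ?thesis using True F2 by (auto simp: trunc_def)
      qed
    next
      case False
      have "\<not> N (u - (of_nat i * emb x + emb x))"
      proof
        assume "N (u - (of_nat i * emb x + emb x))"
        from N_add[OF this emb_ge[OF x]] False show False by simp
      qed
      moreover have "N (of_nat i * emb x - u)" using not_N[OF False] by simp
      ultimately show ?thesis using False by (auto simp: trunc_def)
    qed
    finally show ?thesis .
  qed
  have "\<not> N (of_nat i * emb x - u)" if "\<not> N (of_nat (n - 1) * emb x - u)" "i < n" for i
  proof
    assume "N (of_nat i * emb x - u)"
    from N_add[OF this N_of_nat[OF emb_ge[OF x], of "n - 1 - i"]] that
    show False by (simp add: of_nat_diff algebra_simps)
  qed
  moreover have "n - 1 < n" using n by simp
  ultimately show ?thesis unfolding mv_increasing_def step by blast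
qed

text \<open>Minimality within the chain extends to the whole group, since an element not below u
  exceeds the atom anyway.\<close>

lemma atom_discrete:
  assumes "mv_atom A \<epsilon>"
  shows "discrete_cone N (emb \<epsilon>)"
proof
  have \<epsilon>: "\<epsilon> \<in> carrier A" and pos: "\<not> N (- emb \<epsilon>)"
    and min: "\<And>y. y \<in> carrier A \<Longrightarrow> \<not> N (- emb y) \<Longrightarrow> N (emb y - emb \<epsilon>)"
    using assms by (auto simp: atom_iff zero_lt_iff le_iff)
  show "\<not> N (- emb \<epsilon>)" by fact
  fix x assume x: "N x"
  show "N (- x) \<or> N (x - emb \<epsilon>)"
  proof (cases "N (u - x)")
    case True
    then obtain y where y: "y \<in> carrier A" "Z (emb y - x)" using emb_surj x by blast
    then show ?thesis using min[of y] N_cong[of "- emb y" "- x"] N_cong[of "emb y - emb \<epsilon>" "x - emb \<epsilon>"]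
        Z_minus[OF y(2)] by auto
  next
    case False
    from N_add[OF not_N[OF False] emb_le[OF \<epsilon>]] show ?thesis by simp
  qed
qed

end

section \<open>Transfer of formulas between represented chains\<close>

primrec term_weight :: "mv_term \<Rightarrow> int"
  where
    "term_weight (Var i) = 1"
  | "term_weight Zero = 0"
  | "term_weight (Add s t) = term_weight s + term_weight t + 1"
  | "term_weight (Neg t) = term_weight t + 1"

text \<open>The bounds that \<open>sim\<close> must have for the formula to be transferred. A
  quantifier costs one round of the game, and the product of two moduli serves as their common
  multiple.\<close>

primrec level :: "mv_formula \<Rightarrow> int \<times> int"
  where
    "level (Equal s t) = (term_weight s + term_weight t + 1, 1)"
  | "level (Not \<phi>) = level \<phi>"
  | "level (And \<phi> \<psi>) = (max (fst (level \<phi>)) (fst (level \<psi>)), snd (level \<phi>) * snd (level \<psi>))"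
  | "level (Exists i \<phi>) =
      (step_L (fst (level \<phi>)) (snd (level \<phi>)), step_M (fst (level \<phi>)) (snd (level \<phi>)))"

lemma term_weight_nonneg: "0 \<le> term_weight t"
  by (induction t) auto

lemma level_pos: "1 \<le> fst (level \<phi>) \<and> 1 \<le> snd (level \<phi>)"
proof (induction \<phi>)
  case (Equal s t)
  then show ?case using term_weight_nonneg[of s] term_weight_nonneg[of t] by simp
next
  case (Exists i \<phi>)
  define F where "F = (fact (nat (fst (level \<phi>))) :: int)"
  have F: "1 \<le> F" by (simp add: F_def)
  have "1 * 1 \<le> F * fst (level \<phi>)" "1 * 1 \<le> F * snd (level \<phi>)"
    using Exists F by (intro mult_mono; simp)+
  moreover have "0 \<le> F * fst (level \<phi>) * fst (level \<phi>)" "0 \<le> fst (level \<phi>) * (F * snd (level \<phi>))"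
    using Exists F by auto
  ultimately show ?case unfolding level.simps step_L_def step_M_def F_def[symmetric] by simp
next
  case (And \<phi> \<psi>)
  then have "1 * 1 \<le> snd (level \<phi>) * snd (level \<psi>)" by (intro mult_mono) auto
  with And show ?case by auto
qed auto

primrec all_vars :: "mv_formula \<Rightarrow> nat set"
  where
    "all_vars (Equal s t) = term_vars s \<union> term_vars t"
  | "all_vars (Not \<phi>) = all_vars \<phi>"
  | "all_vars (And \<phi> \<psi>) = all_vars \<phi> \<union> all_vars \<psi>"
  | "all_vars (Exists i \<phi>) = insert i (all_vars \<phi>)"

lemma finite_all_vars: "finite (all_vars \<phi>)"
proof -
  have "finite (term_vars t)" for t by (induction t) auto
  then show ?thesis by (induction \<phi>) auto
qed

text \<open>The constants e and u are played as the first two entries, so that forms cover them too;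
  variables are therefore shifted by two.\<close>

definition tuple :: "'g \<Rightarrow> 'g \<Rightarrow> ('a \<Rightarrow> 'g) \<Rightarrow> (nat \<Rightarrow> 'a) \<Rightarrow> nat \<Rightarrow> 'g"
  where "tuple e u emb v i = (case i of 0 \<Rightarrow> e | Suc 0 \<Rightarrow> u | Suc (Suc j) \<Rightarrow> emb (v j))"

lemma tuple_simps [simp]:
  "tuple e u emb v 0 = e" "tuple e u emb v (Suc 0) = u" "tuple e u emb v (Suc (Suc j)) = emb (v j)"
  by (simp_all add: tuple_def)

lemma tuple_upd: "tuple e u emb (v(i := x)) = (tuple e u emb v)(Suc (Suc i) := emb x)"
  by (auto simp: tuple_def fun_eq_iff split: nat.splits)

text \<open>Truncation makes a term only piecewise linear. The piece is selected by the signs of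
  forms u - (s + t), which \<open>sim\<close> preserves, so one coefficient vector serves both
  chains. In \<open>term_weight\<close>, the extra one at \<open>Neg\<close> and \<open>Add\<close>
  accounts for the coefficient of u.\<close>

lemma term_form:
  assumes A: "mv_rep A N emb u" and B: "mv_rep B N' emb' u'"
    and v: "v \<in> UNIV \<rightarrow> carrier A" and v': "v' \<in> UNIV \<rightarrow> carrier B"
    and s: "sim N e N' e' n L M (tuple e u emb v) (tuple e' u' emb' v')"
    and "term_weight t \<le> L" "\<forall>i\<in>term_vars t. Suc (Suc i) < n" and n: "1 < n"
  shows "\<exists>c. (\<forall>i<n. \<bar>c i\<bar> \<le> term_weight t) \<and>
    cone.Z N (emb (term_val A v t) - form n c (tuple e u emb v)) \<and>
    cone.Z N' (emb' (term_val B v' t) - form n c (tuple e' u' emb' v'))"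
  using assms(6,7)
proof (induction t)
  case (Var i)
  interpret A: mv_rep A N emb u by fact
  interpret B: mv_rep B N' emb' u' by fact
  show ?case using Var
    by (intro exI[of _ "\<lambda>j. if j = Suc (Suc i) then 1 else 0"]) (simp add: form_unit)
next
  case Zero
  interpret A: mv_rep A N emb u by fact
  interpret B: mv_rep B N' emb' u' by fact
  show ?case by (intro exI[of _ "\<lambda>_. 0"]) (simp add: form_def A.emb_zero B.emb_zero)
next
  case (Neg t)
  interpret A: mv_rep A N emb u by fact
  interpret B: mv_rep B N' emb' u' by fact
  note cA = term_val_closed[OF A.mv_algebra_axioms v]
  note cB = term_val_closed[OF B.mv_algebra_axioms v']
  obtain c where c: "\<forall>i<n. \<bar>c i\<bar> \<le> term_weight t"
    "A.Z (emb (term_val A v t) - form n c (tuple e u emb v))"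
    "B.Z (emb' (term_val B v' t) - form n c (tuple e' u' emb' v'))"
    using Neg by auto
  define d where "d = (\<lambda>i. 1 * (if i = Suc 0 then 1 else 0) + (-1) * c i)"
  have d: "form n d a = a (Suc 0) - form n c a" for a :: "nat \<Rightarrow> 'y::comm_ring_1"
    unfolding d_def form_lin using form_unit[of "Suc 0" n 1 a] n by simp
  have "A.Z (emb (term_val A v (Neg t)) - form n d (tuple e u emb v))"
    using A.Z_diff[OF A.emb_neg[OF cA[of t]] c(2)] by (simp add: d algebra_simps)
  moreover have "B.Z (emb' (term_val B v' (Neg t)) - form n d (tuple e' u' emb' v'))"
    using B.Z_diff[OF B.emb_neg[OF cB[of t]] c(3)] by (simp add: d algebra_simps)
  moreover have "\<forall>i<n. \<bar>d i\<bar> \<le> term_weight (Neg t)"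
    using c(1) by (force simp: d_def abs_le_iff)
  ultimately show ?case by blast
next
  case (Add t1 t2)
  interpret A: mv_rep A N emb u by fact
  interpret B: mv_rep B N' emb' u' by fact
  note cA = term_val_closed[OF A.mv_algebra_axioms v]
  note cB = term_val_closed[OF B.mv_algebra_axioms v']
  let ?a = "tuple e u emb v" and ?b = "tuple e' u' emb' v'"
  have w: "term_weight t1 \<le> L" "term_weight t2 \<le> L"
    using Add.prems term_weight_nonneg[of t1] term_weight_nonneg[of t2] by auto
  obtain c1 where c1: "\<forall>i<n. \<bar>c1 i\<bar> \<le> term_weight t1"
    "A.Z (emb (term_val A v t1) - form n c1 ?a)" "B.Z (emb' (term_val B v' t1) - form n c1 ?b)"
    using Add.IH(1) w Add.prems by auto
  obtain c2 where c2: "\<forall>i<n. \<bar>c2 i\<bar> \<le> term_weight t2"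
    "A.Z (emb (term_val A v t2) - form n c2 ?a)" "B.Z (emb' (term_val B v' t2) - form n c2 ?b)"
    using Add.IH(2) w Add.prems by auto
  define c where "c = (\<lambda>i. 1 * c1 i + 1 * c2 i)"
  define d where "d = (\<lambda>i. 1 * (if i = Suc 0 then 1 else 0) + (-1) * c i)"
  have c: "form n c a = form n c1 a + form n c2 a" for a :: "nat \<Rightarrow> 'y::comm_ring_1"
    unfolding c_def form_lin by simp
  have d: "form n d a = a (Suc 0) - form n c a" for a :: "nat \<Rightarrow> 'y::comm_ring_1"
    unfolding d_def form_lin using form_unit[of "Suc 0" n 1 a] n by simp
  have cb: "\<forall>i<n. \<bar>c i\<bar> \<le> term_weight (Add t1 t2)"
    using c1(1) c2(1) by (force simp: c_def abs_le_iff)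
  have db: "\<forall>i<n. \<bar>d i\<bar> \<le> L"
    using c1(1) c2(1) Add.prems(1) by (force simp: c_def d_def abs_le_iff)
  have dN: "N (u - form n c ?a) \<longleftrightarrow> N' (u' - form n c ?b)"
    using s db unfolding sim_def by (metis d tuple_simps(2))
  have ZA: "A.Z (emb (term_val A v (Add t1 t2)) - A.trunc (form n c ?a))"
  proof -
    have "A.Z (emb (term_val A v (Add t1 t2)) - A.trunc (emb (term_val A v t1) + emb (term_val A v t2)))"
      using A.emb_add[OF cA cA] by (simp add: A.trunc_def)
    moreover have "A.Z (A.trunc (emb (term_val A v t1) + emb (term_val A v t2)) - A.trunc (form n c ?a))"
      using A.Z_add[OF c1(2) c2(2)] by (intro A.trunc_cong) (simp add: c algebra_simps)
    ultimately show ?thesis by (rule A.Z_trans)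
  qed
  have ZB: "B.Z (emb' (term_val B v' (Add t1 t2)) - B.trunc (form n c ?b))"
  proof -
    have "B.Z (emb' (term_val B v' (Add t1 t2)) - B.trunc (emb' (term_val B v' t1) + emb' (term_val B v' t2)))"
      using B.emb_add[OF cB cB] by (simp add: B.trunc_def)
    moreover have "B.Z (B.trunc (emb' (term_val B v' t1) + emb' (term_val B v' t2)) - B.trunc (form n c ?b))"
      using B.Z_add[OF c1(3) c2(3)] by (intro B.trunc_cong) (simp add: c algebra_simps)
    ultimately show ?thesis by (rule B.Z_trans)
  qed
  show ?case
  proof (cases "N (u - form n c ?a)")
    case True
    then show ?thesis using ZA ZB cb dN by (intro exI[of _ c]) (simp add: A.trunc_def B.trunc_def)
  next
    case False
    have "1 \<le> term_weight (Add t1 t2)"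
      using term_weight_nonneg[of t1] term_weight_nonneg[of t2] by simp
    with False show ?thesis using ZA ZB dN n
      by (intro exI[of _ "\<lambda>i. if i = Suc 0 then 1 else 0"])
        (simp add: A.trunc_def B.trunc_def form_unit)
  qed
qed

text \<open>The response found in the group lies in the unit interval because the signs of y and u'
  - y are among those preserved. It is then moved within its class modulo \<open>Z\<close> onto an
  embedded element.\<close>

lemma forth_mv:
  assumes A: "mv_rep A N emb u" and B: "mv_rep B N' emb' u'"
    and N: "z_cone N e" and N': "z_cone N' e'"
    and L: "1 \<le> L" and M: "1 \<le> M"
    and s: "sim N e N' e' n (step_L L M) (step_M L M) (tuple e u emb v) (tuple e' u' emb' v')"
    and i: "Suc (Suc i) < n" and x: "x \<in> carrier A"
  shows "\<exists>y\<in>carrier B. sim N e N' e' n L M (tuple e u emb (v(i := x))) (tuple e' u' emb' (v'(i := y)))"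
proof -
  interpret A: mv_rep A N emb u by fact
  interpret B: mv_rep B N' emb' u' by fact
  interpret N: z_cone N e by fact
  interpret N': z_cone N' e' by fact
  obtain y where y: "sim N e N' e' n L M ((tuple e u emb v)(Suc (Suc i) := emb x))
      ((tuple e' u' emb' v')(Suc (Suc i) := y))" (is "sim _ _ _ _ _ _ _ ?a ?b")
    using forth[OF N N' L M s _ i _ _ A.emb_ge[OF x]] by auto
  have sg: "N (form n c ?a) \<longleftrightarrow> N' (form n c ?b)" if "\<forall>i<n. \<bar>c i\<bar> \<le> L" for c
    using y that unfolding sim_def by blast
  have "N' y"
    using sg[of "\<lambda>j. if j = Suc (Suc i) then 1 else 0"] L i A.emb_ge[OF x]
    by (simp add: form_unit)
  moreover have "N' (u' - y)"
  proof -
    define d :: "nat \<Rightarrow> int" where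
      "d = (\<lambda>j. 1 * (if j = Suc 0 then 1 else 0) + (-1) * (if j = Suc (Suc i) then 1 else 0))"
    have d: "form n d a = a (Suc 0) - a (Suc (Suc i))" for a :: "nat \<Rightarrow> 'y::comm_ring_1"
      unfolding d_def form_lin using i by (simp add: form_unit)
    have "\<forall>i<n. \<bar>d i\<bar> \<le> L" using L by (auto simp: d_def)
    from sg[OF this] show ?thesis using A.emb_le[OF x] by (simp add: d)
  qed
  ultimately obtain y' where y': "y' \<in> carrier B" "B.Z (emb' y' - y)" using B.emb_surj by blast
  have "sim N e N' e' n L M ?a ((tuple e' u' emb' v')(Suc (Suc i) := emb' y'))"
    using N.discrete_cone_axioms N'.discrete_cone_axioms y
    by (rule sim_cong) (use B.Z_sym[OF y'(2)] in auto)
  then show ?thesis using y' by (auto simp: tuple_upd)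
qed

lemma sat_transfer:
  assumes A: "mv_rep A N emb u" and B: "mv_rep B N' emb' u'"
    and N: "z_cone N e" and N': "z_cone N' e'"
    and "v \<in> UNIV \<rightarrow> carrier A" "v' \<in> UNIV \<rightarrow> carrier B"
    and "sim N e N' e' n (fst (level \<phi>)) (snd (level \<phi>)) (tuple e u emb v) (tuple e' u' emb' v')"
    and n: "1 < n" "\<forall>i\<in>all_vars \<phi>. Suc (Suc i) < n"
  shows "sat A v \<phi> \<longleftrightarrow> sat B v' \<phi>"
  using assms(5-7) n(2)
proof (induction \<phi> arbitrary: v v')
  case (Equal t1 t2)
  interpret A: mv_rep A N emb u by fact
  interpret B: mv_rep B N' emb' u' by fact
  note cA = term_val_closed[OF A.mv_algebra_axioms Equal.prems(1)]
  note cB = term_val_closed[OF B.mv_algebra_axioms Equal.prems(2)]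
  note tf = term_form[OF A B Equal.prems(1-3) _ _ n(1)]
  let ?a = "tuple e u emb v" and ?b = "tuple e' u' emb' v'"
  have w: "0 \<le> term_weight t1" "0 \<le> term_weight t2" by (simp_all add: term_weight_nonneg)
  obtain c1 where c1: "\<forall>i<n. \<bar>c1 i\<bar> \<le> term_weight t1"
    "A.Z (emb (term_val A v t1) - form n c1 ?a)" "B.Z (emb' (term_val B v' t1) - form n c1 ?b)"
    using tf[of t1] w Equal.prems(4) by auto
  obtain c2 where c2: "\<forall>i<n. \<bar>c2 i\<bar> \<le> term_weight t2"
    "A.Z (emb (term_val A v t2) - form n c2 ?a)" "B.Z (emb' (term_val B v' t2) - form n c2 ?b)"
    using tf[of t2] w Equal.prems(4) by auto
  have sg: "N (form n c ?a) \<longleftrightarrow> N' (form n c ?b)"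
    if "\<forall>i<n. \<bar>c i\<bar> \<le> term_weight t1 + term_weight t2 + 1" for c
    using Equal.prems(3) that unfolding sim_def by simp
  \<comment> \<open>Equality modulo \<open>Z\<close> amounts to two signs, those of the difference
    and of its negative.\<close>
  define c d where "c = (\<lambda>i. 1 * c1 i + (-1) * c2 i)" and "d = (\<lambda>i. 1 * c2 i + (-1) * c1 i)"
  have cd: "form n c a = form n c1 a - form n c2 a" "form n d a = form n c2 a - form n c1 a"
    for a :: "nat \<Rightarrow> 'y::comm_ring_1"
    unfolding c_def d_def form_lin by simp_all
  have "\<forall>i<n. \<bar>c i\<bar> \<le> term_weight t1 + term_weight t2 + 1"
    "\<forall>i<n. \<bar>d i\<bar> \<le> term_weight t1 + term_weight t2 + 1"
    using c1(1) c2(1) by (force simp: c_def d_def abs_le_iff)+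
  from sg[OF this(1)] sg[OF this(2)]
  have "A.Z (form n c1 ?a - form n c2 ?a) \<longleftrightarrow> B.Z (form n c1 ?b - form n c2 ?b)"
    by (simp add: A.Z_def B.Z_def cd)
  then show ?case
    using A.eq_iff[OF cA cA c1(2) c2(2)] B.eq_iff[OF cB cB c1(3) c2(3)] by simp
next
  case (And \<phi> \<psi>)
  interpret N: z_cone N e by fact
  interpret N': z_cone N' e' by fact
  note m = sim_mono[OF And.prems(3) N.discrete_cone_axioms N'.discrete_cone_axioms]
  show ?case using And.IH(1)[OF And.prems(1,2) m] And.IH(2)[OF And.prems(1,2) m] And.prems(4) by simp
next
  case (Exists i \<phi>)
  have lv: "1 \<le> fst (level \<phi>)" "1 \<le> snd (level \<phi>)" using level_pos by blast+
  have i: "Suc (Suc i) < n" and vars: "\<forall>i\<in>all_vars \<phi>. Suc (Suc i) < n" using Exists.prems(4) by auto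
  have s: "sim N e N' e' n (step_L (fst (level \<phi>)) (snd (level \<phi>))) (step_M (fst (level \<phi>)) (snd (level \<phi>)))
      (tuple e u emb v) (tuple e' u' emb' v')" using Exists.prems(3) by simp
  have IH: "sat A (v(i := x)) \<phi> \<longleftrightarrow> sat B (v'(i := y)) \<phi>"
    if "x \<in> carrier A" "y \<in> carrier B" "sim N e N' e' n (fst (level \<phi>)) (snd (level \<phi>))
      (tuple e u emb (v(i := x))) (tuple e' u' emb' (v'(i := y)))" for x y
    by (rule Exists.IH[OF _ _ that(3) vars]) (use Exists.prems(1,2) that in auto)
  show ?case
  proof
    assume "sat A v (Exists i \<phi>)"
    then obtain x where x: "x \<in> carrier A" "sat A (v(i := x)) \<phi>" by auto
    from forth_mv[OF A B N N' lv s i x(1)] IH x show "sat B v' (Exists i \<phi>)" by auto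
  next
    assume "sat B v' (Exists i \<phi>)"
    then obtain y where y: "y \<in> carrier B" "sat B (v'(i := y)) \<phi>" by auto
    from forth_mv[OF B A N' N lv sim_sym[OF s] i y(1)] IH y sim_sym show "sat A v (Exists i \<phi>)"
      by (metis sat.simps(4))
  qed
qed auto

lemma sat_free_vars: "(\<And>i. i \<in> free_vars \<phi> \<Longrightarrow> v i = w i) \<Longrightarrow> sat A v \<phi> \<longleftrightarrow> sat A w \<phi>"
proof -
  have tv: "(\<And>i. i \<in> term_vars t \<Longrightarrow> v i = w i) \<Longrightarrow> term_val A v t = term_val A w t" for t v w
    by (induction t) auto
  show "(\<And>i. i \<in> free_vars \<phi> \<Longrightarrow> v i = w i) \<Longrightarrow> ?thesis"
  proof (induction \<phi> arbitrary: v w)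
    case (Equal s t)
    then show ?case using tv[of s v w] tv[of t v w] by simp
  next
    case (Exists i \<phi>)
    have "sat A (v(i := a)) \<phi> \<longleftrightarrow> sat A (w(i := a)) \<phi>" for a
      by (rule Exists.IH) (use Exists.prems in auto)
    then show ?case by simp
  next
    case (And \<phi> \<psi>)
    have "sat A v \<phi> \<longleftrightarrow> sat A w \<phi>" by (rule And.IH(1)) (simp add: And.prems)
    moreover have "sat A v \<psi> \<longleftrightarrow> sat A w \<psi>" by (rule And.IH(2)) (simp add: And.prems)
    ultimately show ?case by simp
  next
    case (Not \<phi>)
    have "sat A v \<phi> \<longleftrightarrow> sat A w \<phi>" by (rule Not.IH) (simp add: Not.prems)
    then show ?case by simp
  qed
qed

lemma models_iff_sat:
  assumes "sentence \<phi>" "v \<in> UNIV \<rightarrow> carrier A"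
  shows "models A \<phi> \<longleftrightarrow> sat A v \<phi>"
proof -
  have "sat A w \<phi> \<longleftrightarrow> sat A v \<phi>" for w
    using assms(1) by (intro sat_free_vars) (simp add: sentence_def)
  then show ?thesis using assms(2) unfolding models_def by blast
qed

text \<open>With all variables at zero, every form reduces to c 0 e + c 1 u. As |c 0| \<le> L and L
  e < u, its sign is read lexicographically from c 1 and c 0, in the same way in both
  chains.\<close>

lemma models_transfer:
  assumes A: "mv_rep A N emb u" and B: "mv_rep B N' emb' u'"
    and N: "z_cone N e" and N': "z_cone N' e'"
    and big: "\<not> N (of_int (fst (level \<phi>)) * e - u)" "\<not> N' (of_int (fst (level \<phi>)) * e' - u')"
    and r: "discrete_cone.congr N e (snd (level \<phi>)) u r" "discrete_cone.congr N' e' (snd (level \<phi>)) u' r"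
    and \<phi>: "sentence \<phi>"
  shows "models A \<phi> \<longleftrightarrow> models B \<phi>"
proof -
  interpret A: mv_rep A N emb u by fact
  interpret B: mv_rep B N' emb' u' by fact
  interpret N: z_cone N e by fact
  interpret N': z_cone N' e' by fact
  let ?v = "\<lambda>_::nat. mv_zero A" and ?w = "\<lambda>_::nat. mv_zero B"
  define L where "L = fst (level \<phi>)"
  obtain n0 where n0: "\<And>i. i \<in> all_vars \<phi> \<Longrightarrow> i < n0"
    using finite_all_vars[of \<phi>] by (auto simp: finite_nat_set_iff_bounded)
  define n where "n = n0 + 2"
  let ?a = "tuple e u emb ?v" and ?b = "tuple e' u' emb' ?w"
  have sgn: "N (form n c ?a) \<longleftrightarrow> N' (form n c ?b)" if c: "\<forall>i<n. \<bar>c i\<bar> \<le> L" for c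
  proof -
    have fa: "A.Z (form n c ?a - (of_int (c 0) * e + of_int (c 1) * u))"
      unfolding n_def
    proof (induction n0)
      case (Suc n0)
      have "A.Z (of_int (c (Suc (Suc n0))) * emb (mv_zero A))" by (intro A.Z_of_int A.emb_zero)
      from A.Z_add[OF Suc this] show ?case by (simp add: form_def algebra_simps)
    qed (simp add: form_def numeral_2_eq_2)
    have fb: "B.Z (form n c ?b - (of_int (c 0) * e' + of_int (c 1) * u'))"
      unfolding n_def
    proof (induction n0)
      case (Suc n0)
      have "B.Z (of_int (c (Suc (Suc n0))) * emb' (mv_zero B))" by (intro B.Z_of_int B.emb_zero)
      from B.Z_add[OF Suc this] show ?case by (simp add: form_def algebra_simps)
    qed (simp add: form_def numeral_2_eq_2)
    have c0: "\<bar>c 0\<bar> \<le> L" using c by (simp add: n_def)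
    have sg: "N1 (of_int (c 0) * e1 + of_int (c 1) * u1) \<longleftrightarrow> 0 < c 1 \<or> c 1 = 0 \<and> 0 \<le> c 0"
      if "discrete_cone N1 e1" "\<not> N1 (of_int L * e1 - u1)" for N1 and e1 u1 :: "'z::comm_ring_1"
    proof -
      interpret N1: discrete_cone N1 e1 by fact
      have uL: "N1 (u1 - of_int L * e1)" using N1.not_N[OF that(2)] by simp
      have pm: "N1 (of_int (L + c 0) * e1)" "N1 (of_int (L - c 0) * e1)"
        using c0 by (auto simp only: N1.N_int)
      have "0 \<le> L" using c0 by simp
      then have "N1 (of_int L * e1)" by (simp only: N1.N_int)
      from N1.N_add[OF uL this] have u1: "N1 u1" by simp
      show ?thesis
      proof (cases "c 1" "0::int" rule: linorder_cases)
        case greater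
        then have "N1 (of_int (c 1 - 1) * u1)" using u1 by (intro N1.N_of_int) auto
        from N1.N_add[OF N1.N_add[OF this uL] pm(1)] greater show ?thesis by (simp add: algebra_simps)
      next
        case less
        have "\<not> N1 (of_int (c 0) * e1 + of_int (c 1) * u1)"
        proof
          assume 1: "N1 (of_int (c 0) * e1 + of_int (c 1) * u1)"
          have "N1 (of_int (- c 1 - 1) * u1)" using u1 less by (intro N1.N_of_int) auto
          from N1.N_add[OF N1.N_add[OF 1 this] pm(2)] that(2) show False by (simp add: algebra_simps)
        qed
        with less show ?thesis by simp
      qed (simp add: N1.N_int)
    qed
    show ?thesis
      using A.N_cong[OF fa] B.N_cong[OF fb]
        sg[OF N.discrete_cone_axioms] sg[OF N'.discrete_cone_axioms] big unfolding L_def by simp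
  qed
  have "\<exists>r. N.congr m (?a i) r \<and> N'.congr m (?b i) r" if "m = snd (level \<phi>)" for i m
  proof -
    consider "i = 0" | "i = Suc 0" | j where "i = Suc (Suc j)" by (metis not0_implies_Suc)
    then show ?thesis
    proof cases
      case 1
      then show ?thesis using N.congr_e N'.congr_e by auto
    next
      case 2
      then show ?thesis using r that by auto
    next
      case 3
      have "N.congr m (emb (mv_zero A)) 0" "N'.congr m (emb' (mv_zero B)) 0"
        using N.congr_cong[of "emb (mv_zero A)" 0 m 0] A.emb_zero N.congr_0
          N'.congr_cong[of "emb' (mv_zero B)" 0 m 0] B.emb_zero N'.congr_0 by auto
      then show ?thesis using 3 by auto
    qed
  qed
  with sgn have "sim N e N' e' n (fst (level \<phi>)) (snd (level \<phi>)) ?a ?b"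
    unfolding sim_def L_def by blast
  then have "sat A ?v \<phi> \<longleftrightarrow> sat B ?w \<phi>"
    using n0 by (intro sat_transfer[OF A B N N']) (auto simp: n_def)
  then show ?thesis
    using models_iff_sat[OF \<phi>, of ?v A] models_iff_sat[OF \<phi>, of ?w B] by simp
qed

text \<open>One implication is enough, because u has a residue of the form - k and residues of u'
  are unique. Hence all prime powers dividing M divide s - r, and comparing multiplicities gives M
  dvd s - r.\<close>

lemma congr_prime_powers:
  assumes N: "z_cone N e" and N': "z_cone N' e'" and M: "0 < M"
    and eq: "\<And>p m k. prime p \<Longrightarrow> 1 \<le> m \<Longrightarrow> k < p ^ m \<Longrightarrow>
      discrete_cone.congr N e (int (p ^ m)) u (- int k) \<Longrightarrow>
      discrete_cone.congr N' e' (int (p ^ m)) u' (- int k)"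
  shows "\<exists>r. discrete_cone.congr N e M u r \<and> discrete_cone.congr N' e' M u' r"
proof -
  interpret N: z_cone N e by fact
  interpret N': z_cone N' e' by fact
  obtain r where r: "N.congr M u r" using N.div_exists[OF M] by blast
  obtain s where s: "N'.congr M u' s" using N'.div_exists[OF M] by blast
  have "M dvd s - r"
  proof (cases "s - r = 0")
    case False
    have pp: "int (p ^ m) dvd s - r" if p: "prime p" and m: "1 \<le> m" and d: "int (p ^ m) dvd M" for p m
    proof -
      have q: "0 < int (p ^ m)" using p by (simp add: prime_gt_0_nat)
      define k where "k = nat ((- r) mod int (p ^ m))"
      have k: "int k = (- r) mod int (p ^ m)" using q by (simp add: k_def)
      have "int k < int (p ^ m)" unfolding k using q by (rule pos_mod_bound)
      then have kl: "k < p ^ m" by simp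
      have "int (p ^ m) dvd - r - int k" unfolding k by (rule dvd_minus_mod)
      then have rk: "int (p ^ m) dvd r - - int k"
        using dvd_minus_iff[of "int (p ^ m)" "- r - int k"] by (simp add: algebra_simps)
      have "N.congr (int (p ^ m)) u (- int k)"
        using N.congr_shift[OF N.congr_dvd[OF r d] rk] .
      then have "N'.congr (int (p ^ m)) u' (- int k)" by (rule eq[OF p m kl])
      from N'.congr_unique[OF q N'.congr_dvd[OF s d] this]
      have "int (p ^ m) dvd s - - int k" .
      from dvd_diff[OF this rk] show ?thesis by simp
    qed
    show ?thesis
    proof (rule multiplicity_le_imp_dvd)
      show "M \<noteq> 0" using M by simp
      fix P :: int assume P: "prime P"
      define p where "p = nat P"
      have Pp: "P = int p" using prime_ge_0_int[OF P] by (simp add: p_def)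
      then have p: "prime p" "P = int p" using P by simp_all
      define m where "m = multiplicity P M"
      show "multiplicity P M \<le> multiplicity P (s - r)"
      proof (cases "m = 0")
        case False
        then have "int (p ^ m) dvd s - r"
          using p multiplicity_dvd[of P M] by (intro pp) (auto simp: m_def)
        then have "P ^ m dvd s - r" using p by simp
        moreover have "\<not> is_unit P" using P not_prime_unit by blast
        ultimately show ?thesis using \<open>s - r \<noteq> 0\<close> unfolding m_def by (intro multiplicity_geI)
      qed (simp add: m_def)
    qed
  qed simp
  then have "N'.congr M u' r" using N'.congr_shift[OF s] by blast
  with r show ?thesis by blast
qed

section \<open>Regularity and divisibility\<close>

lemma (in discrete_cone) bounded_multiple:
  "N x \<Longrightarrow> N (of_nat k * e - x) \<Longrightarrow> \<exists>j\<le>k. Z (x - of_nat j * e)"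
proof (induction k arbitrary: x)
  case 0
  then show ?case by (simp add: Z_def)
next
  case (Suc k)
  from discrete[OF Suc.prems(1)] show ?case
  proof
    assume "N (- x)"
    then show ?thesis using Suc.prems by (intro exI[of _ 0]) (simp add: Z_def)
  next
    assume "N (x - e)"
    moreover have "N (of_nat k * e - (x - e))" using Suc.prems(2) by (simp add: algebra_simps)
    ultimately obtain j where "j \<le> k" "Z (x - e - of_nat j * e)" using Suc.IH by blast
    then show ?thesis by (intro exI[of _ "Suc j"]) (simp add: algebra_simps)
  qed
qed

locale mv_discrete_rep = mv_rep +
  fixes \<epsilon>
  assumes atom: "mv_atom A \<epsilon>"
begin

abbreviation "e \<equiv> emb \<epsilon>"

lemma eps_closed [simp]: "\<epsilon> \<in> carrier A"
  using atom by (simp add: mv_atom_def)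

sublocale discrete_cone N e
  by (rule atom_discrete[OF atom])

lemma N_nat: "N (of_nat k * e)"
  by (intro N_of_nat N_e)

lemma e_le: "\<not> N (- x) \<Longrightarrow> N (x - e)"
  using discrete[of x] not_N[of "- x"] by auto

text \<open>If u \<le> k e, then by discreteness every element of the chain is one of 0, e, ..., k
  e.\<close>

lemma infinite_unit:
  assumes "infinite (carrier A)"
  shows "\<not> N (of_int k * e - u)"
proof
  assume k: "N (of_int k * e - u)"
  have "N (of_int k * e)" using N_add[OF k N_u] by simp
  then have "0 \<le> k" by (simp only: N_int)
  then obtain n where n: "k = int n" using nonneg_int_cases by blast
  have "\<exists>j\<le>n. Z (emb x - of_nat j * e)" if "x \<in> carrier A" for x
    using bounded_multiple[of "emb x" n] emb_ge[OF that] N_add[OF k emb_le[OF that]] n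
    by (simp add: algebra_simps)
  then obtain f where f: "\<And>x. x \<in> carrier A \<Longrightarrow> f x \<le> n \<and> Z (emb x - of_nat (f x) * e)" by metis
  have "inj_on f (carrier A)"
  proof (rule inj_onI)
    fix x y assume xy: "x \<in> carrier A" "y \<in> carrier A" "f x = f y"
    then show "x = y" using eq_iff[OF xy(1,2) conjunct2[OF f] conjunct2[OF f]] by simp
  qed
  moreover have "f ` carrier A \<subseteq> {..n}" using f by auto
  ultimately show False using assms by (meson finite_atMost finite_imageD finite_subset)
qed

text \<open>If u exceeded every k e, these multiples would be infinitely many elements of the chain.
  So u is a multiple of e, and \<open>decomp\<close> extends this to the whole group.\<close>

lemma finite_multiples:
  assumes "finite (carrier A)"
  shows "\<exists>j. Z (x - of_int j * e)"
proof -
  have "\<exists>k. N (of_nat k * e - u)"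
  proof (rule ccontr)
    assume "\<nexists>k. N (of_nat k * e - u)"
    then have "N (u - of_nat k * e)" for k using not_N[of "of_nat k * e - u"] by simp
    then have "\<exists>x\<in>carrier A. Z (emb x - of_nat k * e)" for k
      using emb_surj[OF N_nat] by blast
    then obtain f where f: "\<And>k. f k \<in> carrier A" "\<And>k. Z (emb (f k) - of_nat k * e)" by metis
    have "inj f"
    proof (rule injI)
      fix j k assume "f j = f k"
      then have "Z (of_int (int j - int k) * e)" using eq_iff[OF f(1) f(1) f(2) f(2), of j k]
        by (simp add: algebra_simps)
      then have "int j - int k = 0" by (simp only: Z_int)
      then show "j = k" by simp
    qed
    then show False using f(1) assms by (meson finite_subset image_subset_iff range_inj_infinite)
  qed
  then obtain k where k: "N (of_nat k * e - u)" by blast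
  obtain ju where ju: "Z (u - of_nat ju * e)" using bounded_multiple[OF N_u k] by blast
  obtain m y where y: "y \<in> carrier A" "Z (x - (of_int m * u + emb y))" using decomp by blast
  have "N (of_nat k * e - emb y)" using N_add[OF k emb_le[OF y(1)]] by simp
  then obtain jy where jy: "Z (emb y - of_nat jy * e)" using bounded_multiple[OF emb_ge[OF y(1)]] by blast
  from Z_add[OF Z_add[OF y(2) jy] Z_of_int[OF ju, of m]]
  show ?thesis by (intro exI[of _ "m * int ju + int jy"]) (simp add: algebra_simps)
qed

lemma finite_z_cone: "finite (carrier A) \<Longrightarrow> z_cone N e"
proof
  fix n :: int and x assume fin: "finite (carrier A)"
  then obtain j where "Z (x - of_int j * e)" using finite_multiples by blast
  then show "\<exists>r. congr n x r" by (intro exI[of _ j] congrI[where v = 0]) simp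
qed

lemma emb_add_eps:
  assumes "x \<in> carrier A"
  shows "Z (emb (x \<oplus> mv_mult A k \<epsilon>) - trunc (emb x + of_nat k * e))"
  using assms by (intro emb_add_trunc emb_trunc emb_mult emb_ge N_nat) auto

text \<open>Among the n successive elements x, x + e, ..., x + (n - 1) e one is a multiple of n; the
  residue of - x tells which.\<close>

lemma z_cone_multiple:
  assumes "z_cone N e" "1 \<le> n"
  shows "\<exists>y. N (of_nat n * y - x) \<and> N (x + of_nat (n - 1) * e - of_nat n * y)"
proof -
  interpret z_cone N e by fact
  have n: "0 < int n" using assms by simp
  obtain r0 where r0: "congr (int n) (- x) r0" using div_exists[OF n] by blast
  define r where "r = r0 mod int n"
  have "congr (int n) (- x) r" using r0 by (rule congr_shift) (simp add: r_def)
  then obtain v where v: "Z (- x - (of_int r * e + of_int (int n) * v))" by (auto simp: congr_def)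
  have r: "0 \<le> r" "r < int n" using n by (auto simp: r_def)
  have "N (of_int r * e)" "N (of_int (int (n - 1) - r) * e)" using r assms(2) by (auto simp only: N_int)
  note s = N_add[OF this(1) Z_N[OF v]] N_add[OF this(2) Z_N[OF Z_minus[OF v]]]
  have "of_int r * e + (- x - (of_int r * e + of_int (int n) * v)) = of_nat n * (- v) - x"
    by simp
  with s(1) have "N (of_nat n * (- v) - x)" by (simp only:)
  moreover have "N (x + of_nat (n - 1) * e - of_nat n * (- v))"
    using s(2) by (simp add: algebra_simps)
  ultimately show ?thesis by blast
qed

text \<open>The part of regularity that concerns \<open>n\<close>; only intervals of minimal length matter.\<close>

definition dense :: "nat \<Rightarrow> bool"
  where "dense n \<longleftrightarrow> (\<forall>x\<in>carrier A. \<not> N (- emb x) \<and> N (u - (emb x + of_nat (n - 1) * e)) \<longrightarrow>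
    (\<exists>y\<in>carrier A. mv_increasing A n y \<and> mv_le A x (mv_mult A n y)
      \<and> mv_le A (mv_mult A n y) (x \<oplus> mv_mult A (n - 1) \<epsilon>)))"

lemma z_cone_dense:
  assumes zc: "z_cone N e" and n: "1 \<le> n"
  shows "dense n"
  unfolding dense_def
proof (intro ballI impI; elim conjE)
  fix a assume a: "a \<in> carrier A" and apos: "\<not> N (- emb a)" and au: "N (u - (emb a + of_nat (n - 1) * e))"
  define x where "x = emb a"
  note assms = zc n apos[folded x_def] au[folded x_def]
  obtain y where y: "N (of_nat n * y - x)" "N (x + of_nat (n - 1) * e - of_nat n * y)"
    using z_cone_multiple[OF zc n] by blast
  have pos: "\<not> N (- y)"
  proof
    assume "N (- y)"
    from N_add[OF y(1) N_of_nat[OF this, of n]] assms(3) show False by (simp add: algebra_simps)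
  qed
  then have Ny: "N y" using not_N by force
  have ny: "N (u - of_nat n * y)" using N_add[OF y(2) assms(4)] by simp
  have n1: "of_nat n * y = of_nat (n - 1) * y + y" using assms(2) by (simp add: of_nat_diff algebra_simps)
  have "N (u - y)" using N_add[OF ny N_of_nat[OF Ny, of "n - 1"]] by (simp add: n1)
  then obtain z where z: "z \<in> carrier A" "Z (emb z - y)" using emb_surj Ny by blast
  have nz: "Z (of_nat k * (emb z - y))" for k using Z_of_int[OF z(2), of "int k"] by simp
  have c1: "N (of_nat n * emb z - x)" using N_add[OF y(1) Z_N[OF nz[of n]]] by (simp add: algebra_simps)
  have c2: "N (x + of_nat (n - 1) * e - of_nat n * emb z)"
    using N_add[OF y(2) Z_N[OF Z_minus[OF nz[of n]]]] by (simp add: algebra_simps)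
  \<comment> \<open>The target interval ends at or below u, so n.z is the group multiple n z,
    untruncated.\<close>
  have "N (u - of_nat n * emb z)" using N_add[OF c2 assms(4)] by simp
  then have c3: "Z (emb (mv_mult A n z) - of_nat n * emb z)"
    using emb_mult[OF z(1), of n] by (simp add: trunc_def)
  have "\<not> N (- emb z)"
    using pos N_cong[of "- emb z" "- y"] Z_minus[OF z(2)] by simp
  moreover have "\<not> N (of_nat (n - 1) * emb z - u)"
  proof
    assume "N (of_nat (n - 1) * emb z - u)"
    from N_add[OF N_add[OF this Z_N[OF Z_minus[OF nz[of "n - 1"]]]] ny] pos show False
      unfolding n1 by (simp add: algebra_simps)
  qed
  ultimately have "mv_increasing A n z" using z assms(2) by (simp add: increasing_iff)
  moreover have "mv_le A a (mv_mult A n z)"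
    using a z(1) c1 c3 le_iff'[of a "mv_mult A n z" x "of_nat n * emb z"] by (simp add: x_def)
  moreover have "mv_le A (mv_mult A n z) (a \<oplus> mv_mult A (n - 1) \<epsilon>)"
    using a z(1) c2 c3 assms(4) emb_add_eps[OF a, of "n - 1"]
      le_iff'[of "mv_mult A n z" "a \<oplus> mv_mult A (n - 1) \<epsilon>" "of_nat n * emb z" "x + of_nat (n - 1) * e"]
    by (simp add: x_def trunc_def)
  ultimately show "\<exists>y\<in>carrier A. mv_increasing A n y \<and> mv_le A a (mv_mult A n y)
      \<and> mv_le A (mv_mult A n y) (a \<oplus> mv_mult A (n - 1) \<epsilon>)"
    using z(1) by blast
qed

text \<open>By discreteness each strict step is at least e, so x_n \<ge> x_1 + (n - 1) e and the
  given elements span the minimal interval.\<close>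

lemma dense_regular:
  assumes "\<And>n. 2 \<le> n \<Longrightarrow> dense n"
  shows "mv_regular A"
  unfolding mv_regular_def
proof (intro allI impI ballI)
  fix n :: nat and xs assume n: "2 \<le> n" and xs: "xs \<in> {1..n} \<rightarrow> carrier A"
    and x: "mv_lt A \<zero> (xs 1) \<and> (\<forall>i\<in>{1..<n}. mv_lt A (xs i) (xs (Suc i)))"
  have cl: "xs i \<in> carrier A" if "1 \<le> i" "i \<le> n" for i using xs that by auto
  have grow: "N (emb (xs (Suc i)) - (emb (xs 1) + of_nat i * e))" if "i < n" for i
    using that
  proof (induction i)
    case (Suc i)
    have "\<not> N (- (emb (xs (Suc (Suc i))) - emb (xs (Suc i))))"
      using x Suc.prems cl by (simp add: lt_iff)
    from N_add[OF e_le[OF this] Suc.IH] Suc.prems show ?case by (simp add: algebra_simps)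
  qed simp
  have g: "N (emb (xs n) - (emb (xs 1) + of_nat (n - 1) * e))" using grow[of "n - 1"] n by simp
  have "\<not> N (- emb (xs 1))" using x cl n by (simp add: zero_lt_iff)
  moreover have xu: "N (u - (emb (xs 1) + of_nat (n - 1) * e))"
    using N_add[OF g emb_le[OF cl[of n]]] n by (simp add: algebra_simps)
  ultimately obtain y where y: "y \<in> carrier A" "mv_increasing A n y" "mv_le A (xs 1) (mv_mult A n y)"
    "mv_le A (mv_mult A n y) (xs 1 \<oplus> mv_mult A (n - 1) \<epsilon>)"
    using assms[OF n] cl[of 1] n unfolding dense_def by auto
  have "mv_le A (xs 1 \<oplus> mv_mult A (n - 1) \<epsilon>) (xs n)"
    using cl n g xu emb_add_eps[of "xs 1" "n - 1"]
      le_iff'[of "xs 1 \<oplus> mv_mult A (n - 1) \<epsilon>" "xs n" "emb (xs 1) + of_nat (n - 1) * e" "emb (xs n)"]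
    by (simp add: trunc_def)
  then have "mv_le A (mv_mult A n y) (xs n)"
    using y cl n le_trans[of "mv_mult A n y" "xs 1 \<oplus> mv_mult A (n - 1) \<epsilon>" "xs n"] by simp
  then show "\<exists>x\<in>carrier A. mv_le A (xs 1) (mv_mult A n x) \<and> mv_le A (mv_mult A n x) (xs n)
        \<and> mv_increasing A n x" using y by blast
qed

text \<open>Regularity is applied to x, x + e, ..., x + (n - 1) e; the multiple of n it yields is x
  + j e for some j. Strictness of the bound by u matters: a truncated multiple would equal u and lie
  above the last of these elements.\<close>

lemma regular_dense:
  assumes reg: "mv_regular A" and n: "2 \<le> n"
    and x: "\<not> N (- x)" and xu: "\<not> N (x + of_nat (n - 1) * e - u)"
  shows "\<exists>r. congr (int n) x r"
proof -
  have Nx: "N x" using not_N[OF x] by simp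
  have le: "N (x + of_nat i * e)" for i using N_add[OF Nx N_nat] .
  have leu: "N (u - (x + of_nat i * e))" if "i < n" for i
    using N_add[OF not_N[OF xu] N_nat[of "n - 1 - i"]] that
    by (simp add: of_nat_diff algebra_simps)
  have "\<exists>y\<in>carrier A. Z (emb y - (x + of_nat (i - 1) * e))" if "i \<in> {1..n}" for i
    by (intro emb_surj le leu) (use that in auto)
  then obtain xs where xs: "\<And>i. i \<in> {1..n} \<Longrightarrow> xs i \<in> carrier A"
    "\<And>i. i \<in> {1..n} \<Longrightarrow> Z (emb (xs i) - (x + of_nat (i - 1) * e))" by metis
  have "mv_lt A \<zero> (xs 1)"
    using lt_iff'[of \<zero> "xs 1" 0 x] xs[of 1] n x emb_zero by simp
  moreover have "mv_lt A (xs i) (xs (Suc i))" if "i \<in> {1..<n}" for i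
  proof -
    have "mv_lt A (xs i) (xs (Suc i)) \<longleftrightarrow>
        \<not> N ((x + of_nat (i - 1) * e) - (x + of_nat (Suc i - 1) * e))"
      using that xs[of i] xs[of "Suc i"] by (intro lt_iff') auto
    also have "(x + of_nat (i - 1) * e) - (x + of_nat (Suc i - 1) * e) = - e"
      using that by (simp add: of_nat_diff algebra_simps)
    finally show ?thesis using e_pos by simp
  qed
  moreover have "xs \<in> {1..n} \<rightarrow> carrier A" using xs by auto
  ultimately obtain y where y: "y \<in> carrier A" "mv_le A (xs 1) (mv_mult A n y)"
    "mv_le A (mv_mult A n y) (xs n)" using reg n unfolding mv_regular_def by blast
  have my: "Z (emb (mv_mult A n y) - trunc (of_nat n * emb y))" by (rule emb_mult[OF y(1)])
  have n1: "1 \<in> {1..n}" "n \<in> {1..n}" using n by auto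
  have lo: "N (trunc (of_nat n * emb y) - x)"
    using y my xs[OF n1(1)] le_iff'[of "xs 1" "mv_mult A n y" x] by simp
  have hi: "N (x + of_nat (n - 1) * e - trunc (of_nat n * emb y))"
    using y my xs[OF n1(2)] le_iff'[of "mv_mult A n y" "xs n"] by simp
  have t: "trunc (of_nat n * emb y) = of_nat n * emb y"
    using hi xu by (auto simp: trunc_def split: if_splits)
  have "N (of_nat (n - 1) * e - (of_nat n * emb y - x))" using hi by (simp add: t algebra_simps)
  then obtain j where j: "Z (of_nat n * emb y - x - of_nat j * e)"
    using bounded_multiple[of "of_nat n * emb y - x"] lo t by metis
  then have "congr (int n) x (- int j)"
    using Z_minus[OF j] by (intro congrI[where v = "emb y"]) (simp add: algebra_simps)
  then show ?thesis by blast
qed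

text \<open>\<open>regular_dense\<close> does not reach the elements within n - 1 atoms of u, among
  them u itself. In an infinite chain one can step down by n e, which leaves the residue unchanged.
  \<open>decomp\<close> then covers the whole group.\<close>

lemma regular_z_cone:
  assumes reg: "mv_regular A" and inf: "infinite (carrier A)"
  shows "z_cone N e"
proof
  fix n :: int and x assume "0 < n"
  then obtain n0 where n0: "n = int n0" "0 < n0" using zero_less_imp_eq_int by auto
  show "\<exists>r. congr n x r"
  proof (cases "n0 = 1")
    case True
    then show ?thesis using n0 by (intro exI[of _ 0] congrI[where v = x]) simp
  next
    case False
    then have n2: "2 \<le> n0" using n0 by simp
    have big: "\<not> N (of_int k * e - u)" for k using infinite_unit[OF inf] .
    have top: "\<exists>r. congr n (u - of_nat k * e) r" for k
    proof -
      have "\<not> N (- (u - of_nat (k + n0) * e))" using big[of "int k + int n0"] by (simp add: algebra_simps)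
      moreover have "\<not> N ((u - of_nat (k + n0) * e) + of_nat (n0 - 1) * e - u)"
      proof -
        have "(u - of_nat (k + n0) * e) + of_nat (n0 - 1) * e - u = of_int (- int k - 1) * e"
          using n0 by (simp add: of_nat_diff algebra_simps)
        then show ?thesis by (auto simp only: N_int)
      qed
      ultimately obtain r where "congr n (u - of_nat (k + n0) * e) r"
        using regular_dense[OF reg n2] n0 by blast
      from congr_add[OF this congr_int[of n n 0]] show ?thesis using n0 by (auto simp: algebra_simps)
    qed
    have elt: "\<exists>r. congr n (emb y) r" if y: "y \<in> carrier A" for y
    proof (cases "N (- emb y)")
      case True
      then have "Z (emb y - 0)" using emb_ge[OF y] by (simp add: Z_def)
      then show ?thesis using congr_cong congr_0 by blast
    next
      case F1: False
      show ?thesis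
      proof (cases "N (emb y + of_nat (n0 - 1) * e - u)")
        case True
        then obtain j where "Z (u - emb y - of_nat j * e)"
          using bounded_multiple[of "u - emb y" "n0 - 1"] emb_le[OF y] by (auto simp: algebra_simps)
        then have "Z (u - of_nat j * e - emb y)" by (simp add: algebra_simps)
        then show ?thesis using top congr_cong by blast
      next
        case False
        then show ?thesis using regular_dense[OF reg n2 F1] n0 by simp
      qed
    qed
    obtain m y where y: "y \<in> carrier A" "Z (x - (of_int m * u + emb y))" using decomp by blast
    obtain r s where "congr n u r" "congr n (emb y) s" using top[of 0] elt[OF y(1)] by auto
    then have "congr n (of_int m * u + emb y) (m * r + s)" by (intro congr_add congr_mult)
    then show ?thesis using congr_cong[OF y(2)] by blast
  qed
qed

end

section \<open>Representations of Chang groups and of finite chains\<close>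

lemma (in nontrivial_mv_chain) chang_unit_int_pow: "u [^]\<^bsub>G\<^esub> (n::int) = (n, \<zero>)"
proof -
  interpret G: comm_group G by (rule chang_comm_group)
  show ?thesis
  proof (cases n)
    case (nonneg m)
    then show ?thesis by (simp add: int_pow_int chang_unit_pow)
  next
    case (neg m)
    have "u [^]\<^bsub>G\<^esub> n = inv\<^bsub>G\<^esub> (int (Suc m), \<zero>)"
      unfolding neg using chang_unit_pow[of "Suc m"]
      by (subst G.int_pow_neg) (use nontrivial in \<open>auto simp: chang_unit_def chang_carrier int_pow_int simp del: of_nat_Suc\<close>)
    also have "\<dots> = (n, \<zero>)"
      using nontrivial by (intro G.inv_equality) (auto simp: neg chang_mult chang_one chang_carrier add_zero)
    finally show ?thesis .
  qed
qed

text \<open>Unlike the Chang group, the polynomial ring over \<open>\<int>\<close> with indeterminates in \<open>'a\<close> is a type. Its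
  additive group is mapped onto the Chang group; only the linear monomials matter.\<close>

lemma (in nontrivial_mv_chain) chang_representation:
  assumes \<epsilon>: "mv_atom A \<epsilon>"
  obtains N :: "('a multiset \<Rightarrow>\<^sub>0 int) \<Rightarrow> bool" and emb w where "mv_discrete_rep A N emb w \<epsilon>"
    and "\<And>q k. mv_D A q k \<longleftrightarrow> (\<exists>x\<in>carrier A. mv_increasing A (q - 1) x \<and>
      mv_lt A (mv_mult A (q - 1) x) \<one>\<^sub>A \<and>
      (\<exists>z::int. cone.Z N (of_nat q * emb x - of_nat k * emb \<epsilon> - of_int z * w)))"
proof -
  interpret G: comm_group G by (rule chang_comm_group)
  \<comment> \<open>Generators that are not singletons of chain elements go to the neutral
    element.\<close>
  define f where "f m = (if \<exists>x\<in>carrier A. m = {#x#} then chang_emb A (the_elem (set_mset m)) else \<one>\<^bsub>G\<^esub>)"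
    for m
  have ecl: "chang_emb A x \<in> carrier G" if "x \<in> carrier A" for x
    using bij_betwE[OF chang_emb_bij] that by auto
  have "range f \<subseteq> carrier G" using ecl by (auto simp: f_def)
  \<comment> \<open>The free abelian group on the multisets is the additive group of the polynomial
    ring, so h is defined on the whole type.\<close>
  then obtain h where h: "h \<in> hom (free_Abelian_group UNIV) G" "\<And>m. h (frag_of m) = f m"
    using G.free_Abelian_group_universal[of f UNIV] by auto
  interpret F: group_hom "free_Abelian_group (UNIV :: 'a multiset set)" G h
    using h by (intro group_hom.intro group_hom_axioms.intro) auto
  have hcl [simp]: "h g \<in> carrier G" for g using F.hom_closed[of g] by simp
  have hadd: "h (g + g') = h g \<otimes>\<^bsub>G\<^esub> h g'" for g g' using F.hom_mult[of g g'] by simp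
  have h0: "h 0 = \<one>\<^bsub>G\<^esub>" using F.hom_one by simp
  have hneg: "h (- g) = inv\<^bsub>G\<^esub> h g" for g using F.hom_inv[of g] by simp
  have hdiff: "h (g - g') = h g \<otimes>\<^bsub>G\<^esub> inv\<^bsub>G\<^esub> h g'" for g g'
    using hadd[of g "- g'"] by (simp add: hneg)
  have hnat: "h (of_nat n * g) = h g [^]\<^bsub>G\<^esub> n" for n g
    by (induction n) (simp_all add: h0 hadd algebra_simps G.m_comm)
  have hint: "h (of_int n * g) = h g [^]\<^bsub>G\<^esub> n" for n g
  proof (cases n)
    case (neg m)
    have "h (of_int n * g) = h (- (of_nat (Suc m) * g))"
      unfolding neg of_int_minus of_int_of_nat_eq by (simp only: mult_minus_left)
    also have "\<dots> = h g [^]\<^bsub>G\<^esub> n" unfolding hneg hnat neg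
      by (simp add: G.int_pow_neg int_pow_int del: of_nat_Suc nat_pow_Suc)
    finally show ?thesis .
  qed (simp add: hnat int_pow_int)
  define N where "N g \<longleftrightarrow> chang_le A \<one>\<^bsub>G\<^esub> (h g)" for g
  define emb where "emb x = frag_of {#x#}" for x :: 'a
  define w where "w = emb \<one>\<^sub>A"
  have hemb: "h (emb x) = chang_emb A x" if "x \<in> carrier A" for x
    using that by (simp add: emb_def h f_def)
  have hw: "h w = u" by (simp add: w_def hemb chang_emb_ops(2)[of \<zero> \<zero>])
  have N_diff: "N (g - g') \<longleftrightarrow> chang_le A (h g') (h g)" for g g'
  proof
    assume "N (g - g')"
    then have "chang_le A \<one>\<^bsub>G\<^esub> (h (g - g'))" by (simp add: N_def)
    then have "chang_le A (\<one>\<^bsub>G\<^esub> \<otimes>\<^bsub>G\<^esub> h g') (h (g - g') \<otimes>\<^bsub>G\<^esub> h g')" by (intro chang_translation) auto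
    then show "chang_le A (h g') (h g)" by (simp flip: hadd)
  next
    assume "chang_le A (h g') (h g)"
    then have "chang_le A (h g' \<otimes>\<^bsub>G\<^esub> h (- g')) (h g \<otimes>\<^bsub>G\<^esub> h (- g'))" by (intro chang_translation) auto
    then show "N (g - g')" by (simp add: N_def h0 flip: hadd)
  qed
  interpret C: cone N
  proof
    fix x y assume "N x" "N y"
    then have "chang_le A (h 0) (h x)" "chang_le A (h x) (h (x + y))"
      using N_diff[of x 0] N_diff[of "x + y" x] by auto
    then have "chang_le A (h 0) (h (x + y))" by (rule chang_order(3)[rotated 3]) auto
    then show "N (x + y)" using N_diff[of "x + y" 0] by simp
  next
    fix x
    show "N x \<or> N (- x)" using N_diff[of x 0] N_diff[of 0 x] chang_order(4)[of "h x" "h 0"] by auto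
  qed
  have Z: "C.Z (g - g') \<longleftrightarrow> h g = h g'" for g g'
    using N_diff[of g g'] N_diff[of g' g] chang_order(1)[of "h g"] chang_order(2)[of "h g" "h g'"]
    by (auto simp: C.Z_def)
  have rep: "mv_rep A N emb w"
  proof
    show "C.Z (emb \<zero>)"
      using Z[of "emb \<zero>" 0] by (simp add: hemb h0 chang_emb_ops(1)[of \<zero> \<zero>])
  next
    fix x assume x: "x \<in> carrier A"
    show "C.Z (emb (\<sim> x) - (w - emb x))"
      using x chang_emb_ops(3)[of x x] by (simp add: Z hdiff hemb hw)
    have "chang_emb A x \<in> {g \<in> carrier G. chang_le A \<one>\<^bsub>G\<^esub> g \<and> chang_le A g u}"
      using bij_betwE[OF chang_emb_bij] x by blast
    then show "N (emb x)" "N (w - emb x)"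
      using x by (simp_all add: N_diff hemb hw) (simp add: N_def hemb)
    fix y assume y: "y \<in> carrier A"
    show "C.Z (emb (x \<oplus> y) - (if N (w - (emb x + emb y)) then emb x + emb y else w))"
      using x y chang_emb_ops(4)[of x y] by (simp add: Z N_diff hadd hemb hw Let_def)
    show "x = y" if "C.Z (emb x - emb y)"
      using that x y bij_betw_imp_inj_on[OF chang_emb_bij] by (simp add: Z hemb inj_on_eq_iff)
  next
    fix g assume "N g" "N (w - g)"
    then have "h g \<in> {g \<in> carrier G. chang_le A \<one>\<^bsub>G\<^esub> g \<and> chang_le A g u}"
      by (simp add: N_diff hw) (simp add: N_def)
    then obtain x where "x \<in> carrier A" "h g = chang_emb A x"
      using bij_betw_imp_surj_on[OF chang_emb_bij] by blast
    then show "\<exists>x\<in>carrier A. C.Z (emb x - g)" by (auto simp: Z hemb)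
  next
    show "\<not> N (- w)"
      using N_diff[of 0 w] by (simp add: hw h0 chang_le_def chang_unit_def chang_one)
  next
    fix g
    obtain m x where g: "h g = (m, x)" by (cases "h g")
    have x: "x \<in> carrier A" "x \<noteq> \<one>\<^sub>A" using hcl[of g] by (auto simp: g chang_carrier)
    have "h (of_int m * w + emb x) = (m, x)"
      using x by (simp add: hadd hint hw chang_unit_int_pow hemb chang_emb_def chang_mult zero_add)
    then show "\<exists>m x. x \<in> carrier A \<and> C.Z (g - (of_int m * w + emb x))"
      using x g by (intro exI[of _ m] exI[of _ x]) (simp add: Z)
  qed
  show thesis
  proof (rule that)
    show "mv_discrete_rep A N emb w \<epsilon>"
      using rep \<epsilon> by (intro mv_discrete_rep.intro mv_discrete_rep_axioms.intro)
    fix q k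
    have eps: "\<epsilon> \<in> carrier A" using \<epsilon> by (simp add: mv_atom_def)
    have "(chang_emb A x [^]\<^bsub>G\<^esub> q) \<otimes>\<^bsub>G\<^esub> inv\<^bsub>G\<^esub> (chang_emb A (mv_eps A) [^]\<^bsub>G\<^esub> k)
        \<in> range (\<lambda>z::int. u [^]\<^bsub>G\<^esub> z) \<longleftrightarrow>
      (\<exists>z::int. C.Z (of_nat q * emb x - of_nat k * emb \<epsilon> - of_int z * w))"
      if "x \<in> carrier A" for x
      using that eps by (auto simp: Z hdiff hnat hint hemb hw image_iff mv_eps_eq[OF \<epsilon>])
    then show "mv_D A q k \<longleftrightarrow> (\<exists>x\<in>carrier A. mv_increasing A (q - 1) x \<and>
      mv_lt A (mv_mult A (q - 1) x) \<one>\<^sub>A \<and>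
      (\<exists>z::int. C.Z (of_nat q * emb x - of_nat k * emb \<epsilon> - of_int z * w)))"
      unfolding mv_D_def by auto
  qed
qed

lemma fin_chain_rep:
  assumes "1 \<le> n"
  shows "mv_rep (fin_chain n) (\<lambda>x::int. 0 \<le> x) int (int n)"
proof -
  interpret mv_chain "fin_chain n" by (rule fin_chain_mv_chain)
  interpret C: cone "\<lambda>x::int. 0 \<le> x" by unfold_locales auto
  have Z: "C.Z x \<longleftrightarrow> x = 0" for x by (auto simp: C.Z_def)
  show ?thesis
  proof
    fix g :: int
    show "\<exists>x\<in>carrier (fin_chain n). C.Z (int x - g)" if "0 \<le> g" "0 \<le> int n - g"
      using that by (intro bexI[of _ "nat g"]) (auto simp: Z fin_chain_def)
    have "nat (g mod int n) \<le> n"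
      by (subst nat_le_iff, rule less_imp_le, rule pos_mod_bound) (use assms in simp)
    then show "\<exists>m x. x \<in> carrier (fin_chain n) \<and> C.Z (g - (of_int m * int n + int x))"
      using assms
      by (intro exI[of _ "g div int n"] exI[of _ "nat (g mod int n)"]) (auto simp: Z fin_chain_def)
  qed (use assms in \<open>auto simp: Z fin_chain_def\<close>)
qed

lemma int_z_cone: "z_cone (\<lambda>x::int. 0 \<le> x) 1"
proof -
  interpret discrete_cone "\<lambda>x::int. 0 \<le> x" 1 by unfold_locales auto
  have "congr n x x" for n x by (rule congrI[where v = 0]) simp
  then show ?thesis by unfold_locales blast
qed

lemma int_congr: "discrete_cone.congr (\<lambda>x::int. 0 \<le> x) 1 n x r \<longleftrightarrow> n dvd x - r" if "0 < n"
proof -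
  interpret z_cone "\<lambda>x::int. 0 \<le> x" 1 by (rule int_z_cone)
  show ?thesis using congr_int_iff[OF that, of x r] by simp
qed

section \<open>The sentences\<close>

definition Imp :: "mv_formula \<Rightarrow> mv_formula \<Rightarrow> mv_formula"
  where "Imp \<phi> \<psi> = Not (And \<phi> (Not \<psi>))"

definition Forall :: "nat \<Rightarrow> mv_formula \<Rightarrow> mv_formula"
  where "Forall i \<phi> = Not (Exists i (Not \<phi>))"

definition Lequal :: "mv_term \<Rightarrow> mv_term \<Rightarrow> mv_formula"
  where "Lequal s t = Equal (Add (Neg s) t) (Neg Zero)"

definition Less :: "mv_term \<Rightarrow> mv_term \<Rightarrow> mv_formula"
  where "Less s t = And (Lequal s t) (Not (Equal s t))"

primrec Mult :: "nat \<Rightarrow> mv_term \<Rightarrow> mv_term"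
  where
    "Mult 0 t = Zero"
  | "Mult (Suc n) t = Add (Mult n t) t"

primrec Increasing :: "nat \<Rightarrow> mv_term \<Rightarrow> mv_formula"
  where
    "Increasing 0 t = Equal Zero Zero"
  | "Increasing (Suc n) t = And (Increasing n t) (Less (Mult n t) (Mult (Suc n) t))"

definition Atom :: "nat \<Rightarrow> nat \<Rightarrow> mv_formula"
  where "Atom i j = And (Less Zero (Var i)) (Forall j (Imp (Less Zero (Var j)) (Lequal (Var i) (Var j))))"

lemma sat_connectives [simp]:
  "sat A v (Imp \<phi> \<psi>) \<longleftrightarrow> (sat A v \<phi> \<longrightarrow> sat A v \<psi>)"
  "sat A v (Forall i \<phi>) \<longleftrightarrow> (\<forall>a\<in>carrier A. sat A (v(i := a)) \<phi>)"
  "sat A v (Lequal s t) \<longleftrightarrow> mv_le A (term_val A v s) (term_val A v t)"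
  "sat A v (Less s t) \<longleftrightarrow> mv_lt A (term_val A v s) (term_val A v t)"
  by (auto simp: Imp_def Forall_def Lequal_def Less_def mv_le_def mv_lt_def)

lemma free_vars_connectives [simp]:
  "free_vars (Imp \<phi> \<psi>) = free_vars \<phi> \<union> free_vars \<psi>"
  "free_vars (Forall i \<phi>) = free_vars \<phi> - {i}"
  "free_vars (Lequal s t) = term_vars s \<union> term_vars t"
  "free_vars (Less s t) = term_vars s \<union> term_vars t"
  by (auto simp: Imp_def Forall_def Lequal_def Less_def)

lemma term_val_Mult [simp]: "term_val A v (Mult n t) = mv_mult A n (term_val A v t)"
  by (induction n) auto

lemma term_vars_Mult: "term_vars (Mult n t) \<subseteq> term_vars t"
  by (induction n) auto

lemma sat_Increasing [simp]: "sat A v (Increasing n t) \<longleftrightarrow> mv_increasing A n (term_val A v t)"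
  by (induction n) (auto simp: mv_increasing_def less_Suc_eq)

lemma free_vars_Increasing: "free_vars (Increasing n t) \<subseteq> term_vars t"
  using term_vars_Mult by (induction n) auto

lemma (in mv_chain) sat_Atom:
  "i \<noteq> j \<Longrightarrow> v i \<in> carrier A \<Longrightarrow> sat A v (Atom i j) \<longleftrightarrow> mv_atom A (v i)"
  by (auto simp: Atom_def atom_iff)

lemma free_vars_Atom: "free_vars (Atom i j) \<subseteq> {i}"
  by (auto simp: Atom_def)

text \<open>The premise exempts the one-element chain, which is finite but has no atom.\<close>

definition atomic_sentence :: mv_formula
  where "atomic_sentence = Imp (Not (Equal Zero (Neg Zero))) (Exists 1 (Atom 1 2))"

text \<open>Since \<open>\<oplus>\<close> truncates, \<open>x + (n - 1) \<epsilon> \<le> u\<close> is expressed as \<open>x \<oplus> (n - 2).\<epsilon> < 1\<close>.\<close>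

definition dense_sentence :: "nat \<Rightarrow> mv_formula"
  where "dense_sentence n = Forall 0 (Forall 1 (Imp
    (And (Atom 1 2) (And (Less Zero (Var 0)) (Less (Add (Var 0) (Mult (n - 2) (Var 1))) (Neg Zero))))
    (Exists 2 (And (Increasing n (Var 2)) (And (Lequal (Var 0) (Mult n (Var 2)))
      (Lequal (Mult n (Var 2)) (Add (Var 0) (Mult (n - 1) (Var 1)))))))))"

text \<open>The equation q x = u + k \<epsilon> is rearranged to x = (u - (q - 1) x) + k \<epsilon>,
  so that the left-hand side and both summands can be written as terms of the chain.\<close>

definition D_sentence :: "nat \<Rightarrow> nat \<Rightarrow> mv_formula"
  where "D_sentence q k = Exists 0 (Exists 1 (And (Atom 1 2) (And (Increasing (q - 1) (Var 0))
    (And (Less (Mult (q - 1) (Var 0)) (Neg Zero))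
      (Equal (Var 0) (Add (Neg (Mult (q - 1) (Var 0))) (Mult k (Var 1))))))))"

lemma sentences:
  "sentence atomic_sentence" "sentence (dense_sentence n)" "sentence (D_sentence q k)"
  using free_vars_Atom[of 1 2] term_vars_Mult[of _ "Var 0"] term_vars_Mult[of _ "Var 1"]
    term_vars_Mult[of _ "Var 2"] free_vars_Increasing[of _ "Var 0"] free_vars_Increasing[of _ "Var 2"]
  by (fastforce simp: sentence_def atomic_sentence_def dense_sentence_def D_sentence_def)+

lemma (in mv_chain) models_sentence:
  "sentence \<phi> \<Longrightarrow> models A \<phi> \<longleftrightarrow> sat A (\<lambda>_. \<zero>) \<phi>"
  by (intro models_iff_sat) auto

lemma (in mv_chain) models_atomic_sentence:
  "models A atomic_sentence \<longleftrightarrow> (\<zero> \<noteq> \<one>\<^sub>A \<longrightarrow> mv_atomic A)"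
  unfolding models_sentence[OF sentences(1)]
  by (auto simp: atomic_sentence_def mv_atomic_def sat_Atom mv_atom_def)

lemma (in mv_chain) models_dense_sentence:
  "models A (dense_sentence n) \<longleftrightarrow> (\<forall>x\<in>carrier A. \<forall>\<epsilon>\<in>carrier A.
    mv_atom A \<epsilon> \<and> mv_lt A \<zero> x \<and> mv_lt A (x \<oplus> mv_mult A (n - 2) \<epsilon>) \<one>\<^sub>A \<longrightarrow>
    (\<exists>y\<in>carrier A. mv_increasing A n y \<and> mv_le A x (mv_mult A n y)
      \<and> mv_le A (mv_mult A n y) (x \<oplus> mv_mult A (n - 1) \<epsilon>)))"
  unfolding models_sentence[OF sentences(2)] by (simp add: dense_sentence_def sat_Atom)

lemma (in mv_chain) models_D_sentence:
  "models A (D_sentence q k) \<longleftrightarrow> (\<exists>x\<in>carrier A. \<exists>\<epsilon>\<in>carrier A. mv_atom A \<epsilon> \<and>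
    mv_increasing A (q - 1) x \<and> mv_lt A (mv_mult A (q - 1) x) \<one>\<^sub>A \<and>
    x = \<sim> (mv_mult A (q - 1) x) \<oplus> mv_mult A k \<epsilon>)"
  unfolding models_sentence[OF sentences(3)] by (simp add: D_sentence_def sat_Atom)

section \<open>The sentences read in the group\<close>

context mv_discrete_rep
begin

lemma atom_unique: "mv_atom A x \<Longrightarrow> x = \<epsilon>"
  using mv_eps_eq atom by blast

lemma models_dense_iff:
  assumes n: "2 \<le> n"
  shows "models A (dense_sentence n) \<longleftrightarrow> dense n"
proof -
  have "mv_lt A (x \<oplus> mv_mult A (n - 2) \<epsilon>) \<one>\<^sub>A \<longleftrightarrow> N (u - (emb x + of_nat (n - 1) * e))"
    if x: "x \<in> carrier A" for x
  proof -
    have n1: "of_nat (n - 1) * e = of_nat (n - 2) * e + e"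
      using n by (simp add: of_nat_diff algebra_simps)
    have "mv_lt A (x \<oplus> mv_mult A (n - 2) \<epsilon>) \<one>\<^sub>A \<longleftrightarrow> \<not> N (emb x + of_nat (n - 2) * e - u)"
      using x by (intro lt_one_iff emb_add_eps) auto
    also have "\<dots> \<longleftrightarrow> N (u - (emb x + of_nat (n - 1) * e))"
    proof
      assume "\<not> N (emb x + of_nat (n - 2) * e - u)"
      then have "N (u - (emb x + of_nat (n - 2) * e) - e)" by (intro e_le) simp
      then show "N (u - (emb x + of_nat (n - 1) * e))" unfolding n1 by (simp add: algebra_simps)
    next
      assume 1: "N (u - (emb x + of_nat (n - 1) * e))"
      show "\<not> N (emb x + of_nat (n - 2) * e - u)"
      proof
        assume "N (emb x + of_nat (n - 2) * e - u)"
        from N_add[OF this 1] e_pos show False unfolding n1 by simp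
      qed
    qed
    finally show ?thesis .
  qed
  moreover have "(\<forall>a\<in>carrier A. mv_atom A a \<and> Q a \<longrightarrow> R a) \<longleftrightarrow> (Q \<epsilon> \<longrightarrow> R \<epsilon>)" for Q R
    using atom atom_unique eps_closed by metis
  ultimately show ?thesis
    unfolding models_dense_sentence dense_def by (simp add: zero_lt_iff cong: ball_cong)
qed

text \<open>For \<open>x\<close> in \<open>A\<close> with \<open>(q - 1) x < u\<close>, the condition \<open>q x - k e \<in> \<int> u\<close> forces \<open>q x = u + k e\<close>.\<close>

definition D_group where
  "D_group q k x \<longleftrightarrow> \<not> N (- x) \<and> \<not> N (of_nat (q - 1) * x - u) \<and>
    Z (of_nat q * x - (u + of_nat k * e))"

lemma lt_one_mult_iff:
  "x \<in> carrier A \<Longrightarrow> mv_lt A (mv_mult A n x) \<one>\<^sub>A \<longleftrightarrow> \<not> N (of_nat n * emb x - u)"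
  by (intro lt_one_iff emb_mult) auto

lemma increasing_lt_one_iff:
  assumes x: "x \<in> carrier A" and q: "2 \<le> q"
  shows "mv_increasing A (q - 1) x \<and> mv_lt A (mv_mult A (q - 1) x) \<one>\<^sub>A \<longleftrightarrow>
    \<not> N (- emb x) \<and> \<not> N (of_nat (q - 1) * emb x - u)"
proof -
  have "\<not> N (of_nat (q - 1 - 1) * emb x - u)" if "\<not> N (of_nat (q - 1) * emb x - u)"
  proof
    assume "N (of_nat (q - 1 - 1) * emb x - u)"
    from N_add[OF this emb_ge[OF x]] that q show False by (simp add: of_nat_diff algebra_simps)
  qed
  then show ?thesis using x q by (auto simp: increasing_iff lt_one_mult_iff)
qed

lemma models_D_iff:
  assumes q: "2 \<le> q"
  shows "models A (D_sentence q k) \<longleftrightarrow> (\<exists>x\<in>carrier A. D_group q k (emb x))"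
proof -
  have "(x = \<sim> (mv_mult A (q - 1) x) \<oplus> mv_mult A k \<epsilon>) \<longleftrightarrow> Z (of_nat q * emb x - (u + of_nat k * e))"
    if x: "x \<in> carrier A" and pos: "\<not> N (- emb x)" and lt: "\<not> N (of_nat (q - 1) * emb x - u)" for x
  proof -
    define y where "y = of_nat (q - 1) * emb x"
    have y: "N y" unfolding y_def using x by (intro N_of_nat emb_ge)
    have uy: "N (u - y)" using not_N[OF lt] by (simp add: y_def)
    have my: "Z (emb (mv_mult A (q - 1) x) - y)" using emb_mult[OF x, of "q - 1"] uy
      by (simp add: y_def trunc_def)
    have "Z (emb (\<sim> (mv_mult A (q - 1) x)) - (u - y))"
      using Z_diff[OF emb_neg[OF mult_closed[OF x, of "q - 1"]] my] by (simp add: algebra_simps)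
    then have ny: "Z (emb (\<sim> (mv_mult A (q - 1) x)) - trunc (u - y))" using y by (simp add: trunc_def)
    have sum: "Z (emb (\<sim> (mv_mult A (q - 1) x) \<oplus> mv_mult A k \<epsilon>) - trunc (u - y + of_nat k * e))"
      using x ny uy by (intro emb_add_trunc emb_mult N_nat) auto
    have xu: "\<not> N (emb x - u)"
    proof
      assume "N (emb x - u)"
      from N_add[OF this N_of_nat[OF emb_ge[OF x], of "q - 2"]] lt q show False
        by (simp add: of_nat_diff algebra_simps)
    qed
    have "(x = \<sim> (mv_mult A (q - 1) x) \<oplus> mv_mult A k \<epsilon>) \<longleftrightarrow> Z (emb x - trunc (u - y + of_nat k * e))"
      using x by (intro eq_iff sum) auto
    also have "\<dots> \<longleftrightarrow> Z (emb x - (u - y + of_nat k * e))"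
    proof (cases "N (u - (u - y + of_nat k * e))")
      \<comment> \<open>Here the sum exceeds u. Its truncation u differs from x because x < u, and
        the untruncated sum differs from x because x \<le> u; both equations fail.\<close>
      case False
      have "\<not> Z (emb x - (u - y + of_nat k * e))"
      proof
        assume "Z (emb x - (u - y + of_nat k * e))"
        from N_add[OF emb_le[OF x] Z_N[OF this]] False show False by (simp add: algebra_simps)
      qed
      moreover have "\<not> Z (emb x - u)" using xu by (simp add: Z_def)
      ultimately show ?thesis using False by (simp add: trunc_def)
    qed (simp add: trunc_def)
    also have "emb x - (u - y + of_nat k * e) = of_nat q * emb x - (u + of_nat k * e)"
      using q by (simp add: y_def of_nat_diff algebra_simps)
    finally show ?thesis .
  qed
  then have "(mv_increasing A (q - 1) x \<and> mv_lt A (mv_mult A (q - 1) x) \<one>\<^sub>A \<and>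
      x = \<sim> (mv_mult A (q - 1) x) \<oplus> mv_mult A k \<epsilon>) \<longleftrightarrow> D_group q k (emb x)" if "x \<in> carrier A" for x
    using increasing_lt_one_iff[OF that q] that unfolding D_group_def by blast
  then show ?thesis unfolding models_D_sentence using atom_unique atom eps_closed by metis
qed

text \<open>If z \<le> 0, then q x \<le> k e < q e although x \<ge> e. If z \<ge> 2, then x and (q -
  1) x are both at most u - e, since q \<ge> 2, so q x < 2 u.\<close>

lemma D_unit_multiple:
  assumes x: "x \<in> carrier A" "\<not> N (- emb x)" "\<not> N (of_nat (q - 1) * emb x - u)"
    and q: "2 \<le> q" "k < q" and z: "Z (of_nat q * emb x - of_nat k * e - of_int z * u)"
  shows "z = 1"
proof (rule ccontr)
  assume "z \<noteq> 1"
  then consider "z \<le> 0" | "2 \<le> z" by linarith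
  then show False
  proof cases
    case 1
    have "N (of_int (- z) * u)" using 1 N_u by (intro N_of_int) auto
    moreover have "N (of_nat q * (emb x - e))" using x by (intro N_of_nat e_le)
    ultimately have "N (of_nat q * (emb x - e) + of_int (- z) * u + - (of_nat q * emb x - of_nat k * e - of_int z * u))"
      by (intro N_add Z_N[OF Z_minus[OF z]])
    then have "N (of_int (int k - int q) * e)" by (simp add: algebra_simps)
    then show False using q by (auto simp only: N_int)
  next
    case 2
    have "\<not> N (- (u - of_nat (q - 1) * emb x))" using x by simp
    then have "N (u - of_nat (q - 1) * emb x - e)" by (rule e_le)
    then have 3: "N (u - of_nat (q - 1) * emb x - e + (u - of_nat (q - 1) * emb x - e))" by (intro N_add)
    have 4: "N (of_nat (q - 2) * emb x)" using x by (intro N_of_nat emb_ge)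
    have 5: "N (of_int (z - 2) * u)" using 2 N_u by (intro N_of_int) auto
    from N_add[OF N_add[OF N_add[OF N_add[OF 3 4] 5] Z_N[OF z]] N_nat[of k]]
    have "N (of_int (- 2) * e)" using q by (simp add: of_nat_diff algebra_simps)
    then show False by (auto simp only: N_int)
  qed
qed

text \<open>A solution v of q v = u + k e satisfies (q - 1) v < u by itself: otherwise v \<le> k e
  and u \<le> (q k - k) e, which an infinite chain excludes. So v lies in the unit interval.\<close>

lemma D_group_infinite:
  assumes inf: "infinite (carrier A)" and q: "2 \<le> q"
  shows "(\<exists>x\<in>carrier A. D_group q k (emb x)) \<longleftrightarrow> congr (int q) u (- int k)"
proof
  assume "\<exists>x\<in>carrier A. D_group q k (emb x)"
  then obtain x where "Z (of_nat q * emb x - (u + of_nat k * e))" by (auto simp: D_group_def)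
  from Z_minus[OF this] show "congr (int q) u (- int k)"
    by (intro congrI[where v = "emb x"]) (simp add: algebra_simps)
next
  assume "congr (int q) u (- int k)"
  then obtain v where v: "Z (u - (of_int (- int k) * e + of_int (int q) * v))" by (auto simp: congr_def)
  have pos: "\<not> N (- v)"
  proof
    assume "N (- v)"
    from N_add[OF N_add[OF Z_N[OF Z_minus[OF v]] N_of_nat[OF this, of q]] N_nat[of k]] unit_pos
    show False by (simp add: algebra_simps)
  qed
  then have Nv: "N v" using not_N by force
  have lt: "\<not> N (of_nat (q - 1) * v - u)"
  proof
    assume "N (of_nat (q - 1) * v - u)"
    from N_add[OF this Z_N[OF v]] have "N (of_nat k * e - v)"
      using q by (simp add: of_nat_diff algebra_simps)
    then have 1: "N (of_nat q * (of_nat k * e - v))" by (rule N_of_nat)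
    have "N (of_int (int q * int k - int k) * e - u)"
      using N_add[OF 1 Z_N[OF Z_minus[OF v]]] by (simp add: algebra_simps)
    then show False using infinite_unit[OF inf] by blast
  qed
  have "N (u - v)"
    using N_add[OF not_N[OF lt] N_of_nat[OF Nv, of "q - 2"]] q by (simp add: of_nat_diff algebra_simps)
  then obtain x where x: "x \<in> carrier A" "Z (emb x - v)" using emb_surj Nv by blast
  have nx: "Z (of_nat n * (emb x - v))" for n using Z_of_int[OF x(2), of "int n"] by simp
  have "\<not> N (- emb x)" using pos N_cong[of "- emb x" "- v"] Z_minus[OF x(2)] by simp
  moreover have "\<not> N (of_nat (q - 1) * emb x - u)"
    using lt nx[of "q - 1"] N_cong[of "of_nat (q - 1) * emb x - u" "of_nat (q - 1) * v - u"]
    by (simp add: algebra_simps)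
  moreover have "Z (of_nat q * emb x - (u + of_nat k * e))"
    using Z_diff[OF nx[of q] v] by (simp add: algebra_simps)
  ultimately show "\<exists>x\<in>carrier A. D_group q k (emb x)" using x by (auto simp: D_group_def)
qed

end

text \<open>Replaces membership in the multiples of u by one equation, via
  \<open>D_unit_multiple\<close>. This makes \<open>mv_D\<close> accessible to elementary
  equivalence and to \<open>los\<close>.\<close>

lemma (in nontrivial_mv_chain) mv_D_iff_models:
  assumes at: "mv_atomic A" and q: "2 \<le> q" "k < q"
  shows "mv_D A q k \<longleftrightarrow> models A (D_sentence q k)"
proof -
  obtain \<epsilon> where \<epsilon>: "mv_atom A \<epsilon>" using at by (auto simp: mv_atomic_def)
  obtain N :: "('a multiset \<Rightarrow>\<^sub>0 int) \<Rightarrow> bool" and emb w where rep: "mv_discrete_rep A N emb w \<epsilon>"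
    and D: "\<And>q k. mv_D A q k \<longleftrightarrow> (\<exists>x\<in>carrier A. mv_increasing A (q - 1) x \<and>
      mv_lt A (mv_mult A (q - 1) x) \<one>\<^sub>A \<and>
      (\<exists>z::int. cone.Z N (of_nat q * emb x - of_nat k * emb \<epsilon> - of_int z * w)))"
    using chang_representation[OF \<epsilon>] by blast
  interpret R: mv_discrete_rep A N emb w \<epsilon> by fact
  have "(\<exists>z::int. R.Z (of_nat q * emb x - of_nat k * emb \<epsilon> - of_int z * w)) \<longleftrightarrow>
      R.Z (of_nat q * emb x - (w + of_nat k * emb \<epsilon>))"
    if x: "x \<in> carrier A" and inc: "\<not> N (- emb x)" "\<not> N (of_nat (q - 1) * emb x - w)" for x
  proof -
    have *: "of_nat q * emb x - of_nat k * emb \<epsilon> - of_int 1 * w = of_nat q * emb x - (w + of_nat k * emb \<epsilon>)"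
      by (simp add: algebra_simps)
    show ?thesis using R.D_unit_multiple[OF x inc q] * by metis
  qed
  then show ?thesis
    unfolding D R.models_D_iff[OF q(1)] R.D_group_def
    using R.increasing_lt_one_iff[OF _ q(1)] by blast
qed

lemma (in nontrivial_mv_chain) chang_discrete_rep:
  assumes \<epsilon>: "mv_atom A \<epsilon>"
  shows "\<exists>(N :: ('a multiset \<Rightarrow>\<^sub>0 int) \<Rightarrow> bool) emb w. mv_discrete_rep A N emb w \<epsilon>"
  using \<epsilon> by (rule chang_representation) (intro exI)

section \<open>Finite chains\<close>

lemma (in mv_chain) trivial_carrier: "\<zero> = \<one>\<^sub>A \<Longrightarrow> x \<in> carrier A \<Longrightarrow> x = \<zero>"
  using le_antisym[of x \<zero>] le_one[of x] zero_le[of x] by simp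

lemma (in mv_chain) infinite_nontrivial: "infinite (carrier A) \<Longrightarrow> nontrivial_mv_chain A"
proof
  assume inf: "infinite (carrier A)"
  show "\<zero> \<noteq> \<one>\<^sub>A"
  proof
    assume "\<zero> = \<one>\<^sub>A"
    then have "carrier A \<subseteq> {\<zero>}" using trivial_carrier by blast
    with inf show False using finite_subset by blast
  qed
qed

lemma (in nontrivial_mv_chain) finite_atomic:
  assumes fin: "finite (carrier A)"
  shows "mv_atomic A"
proof -
  \<comment> \<open>The size of the initial segment is a rank in the naturals; a positive element of
    least rank is an atom.\<close>
  define c where "c x = card {y \<in> carrier A. mv_le A y x}" for x
  have "\<one>\<^sub>A \<in> carrier A \<and> mv_lt A \<zero> \<one>\<^sub>A"
    using nontrivial zero_le[of "\<one>\<^sub>A"] by (simp add: mv_lt_def)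
  then obtain x where x: "x \<in> carrier A" "mv_lt A \<zero> x"
    and min: "\<And>y. y \<in> carrier A \<Longrightarrow> mv_lt A \<zero> y \<Longrightarrow> c x \<le> c y"
    using ex_has_least_nat[of "\<lambda>x. x \<in> carrier A \<and> mv_lt A \<zero> x" "\<one>\<^sub>A" c] by blast
  have "mv_le A x y" if y: "y \<in> carrier A" "mv_lt A \<zero> y" for y
  proof (rule ccontr)
    assume n: "\<not> mv_le A x y"
    then have yx: "mv_le A y x" using linear x y by blast
    have "{z \<in> carrier A. mv_le A z y} \<subset> {z \<in> carrier A. mv_le A z x}"
      using le_trans[OF _ y(1) x(1) _ yx] n le_refl[OF x(1)] x(1) by blast
    then have "c y < c x" using fin unfolding c_def by (intro psubset_card_mono) auto
    with min[OF y] show False by simp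
  qed
  then show ?thesis using x by (auto simp: mv_atomic_def atom_iff)
qed

lemma (in mv_chain) finite_models_atomic:
  "finite (carrier A) \<Longrightarrow> models A atomic_sentence"
  unfolding models_atomic_sentence
  using nontrivial_mv_chain.finite_atomic[of A] nontrivial_mv_chain.intro[OF mv_chain_axioms]
    nontrivial_mv_chain_axioms.intro[of A] by blast

lemma (in mv_chain) finite_models_dense:
  assumes fin: "finite (carrier A)" and n: "2 \<le> n"
  shows "models A (dense_sentence n)"
proof (cases "\<zero> = \<one>\<^sub>A")
  case True
  then have "\<not> mv_lt A \<zero> x" if "x \<in> carrier A" for x
    using trivial_carrier[OF True that] by (simp add: mv_lt_def)
  then show ?thesis unfolding models_dense_sentence by blast
next
  case False
  then interpret nontrivial_mv_chain A by unfold_locales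
  obtain \<epsilon> where "mv_atom A \<epsilon>" using finite_atomic[OF fin] by (auto simp: mv_atomic_def)
  then obtain N :: "('a multiset \<Rightarrow>\<^sub>0 int) \<Rightarrow> bool" and emb w where "mv_discrete_rep A N emb w \<epsilon>"
    using chang_discrete_rep by blast
  then interpret R: mv_discrete_rep A N emb w \<epsilon> .
  show ?thesis using R.z_cone_dense[OF R.finite_z_cone[OF fin]] n by (simp add: R.models_dense_iff)
qed

lemma fin_chain_discrete_rep:
  assumes "1 \<le> n"
  shows "mv_discrete_rep (fin_chain n) (\<lambda>x::int. 0 \<le> x) int (int n) 1"
proof -
  interpret mv_rep "fin_chain n" "\<lambda>x::int. 0 \<le> x" int "int n" by (rule fin_chain_rep[OF assms])
  have c: "carrier (fin_chain n) = {0..n}" "mv_zero (fin_chain n) = 0" by (simp_all add: fin_chain_def)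
  have "mv_atom (fin_chain n) 1"
    using assms unfolding atom_iff by (auto simp: lt_iff le_iff c)
  then show ?thesis by unfold_locales
qed

text \<open>If q j = n + k, then (q - 1) j < n means k < j, which can fail for small n. The bound q
  k < n guarantees it and excludes only finitely many n.\<close>

lemma fin_chain_D:
  assumes q: "2 \<le> q" and k: "k < q" and n: "q * k < n"
  shows "models (fin_chain n) (D_sentence q k) \<longleftrightarrow> n \<in> {q * j - k | j. j \<ge> 1}"
proof -
  have n1: "1 \<le> n" using n by simp
  interpret mv_discrete_rep "fin_chain n" "\<lambda>x::int. 0 \<le> x" int "int n" 1
    by (rule fin_chain_discrete_rep[OF n1])
  have c: "carrier (fin_chain n) = {0..n}" by (simp add: fin_chain_def)
  have D: "D_group q k (int x) \<longleftrightarrow> 0 < x \<and> (q - 1) * x < n \<and> q * x = n + k" for x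
  proof -
    have "of_nat (q - 1) * int x = int ((q - 1) * x)" "of_nat q * int x = int (q * x)"
      by (simp_all only: of_nat_mult)
    then show ?thesis unfolding D_group_def Z_def by (simp del: of_nat_mult) linarith
  qed
  show ?thesis
  proof
    assume "models (fin_chain n) (D_sentence q k)"
    then obtain x where "0 < x" "q * x = n + k" unfolding models_D_iff[OF q] D by blast
    then show "n \<in> {q * j - k | j. j \<ge> 1}" by (auto intro!: exI[of _ x])
  next
    assume "n \<in> {q * j - k | j. j \<ge> 1}"
    then obtain j where j: "n = q * j - k" by blast
    \<comment> \<open>As n \<ge> 1, the subtraction q j - k on the naturals is not cut off at
      0.\<close>
    then have eq: "q * j = n + k" using n1 by simp
    have "q * k < q * j" using n eq by simp
    then have "k < j" by simp
    have "(q - 1) * j + j = Suc (q - 1) * j" by simp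
    also have "\<dots> = n + k" using q eq by simp
    finally have lt: "(q - 1) * j < n" using \<open>k < j\<close> by linarith
    have "1 * j \<le> (q - 1) * j" using q by (intro mult_right_mono) auto
    with lt have "j \<le> n" by linarith
    with lt show "models (fin_chain n) (D_sentence q k)"
      unfolding models_D_iff[OF q] D c using \<open>k < j\<close> eq by (intro bexI[of _ j]) auto
  qed
qed

section \<open>Ultraproducts\<close>

locale mv_ultraproduct =
  fixes I :: "'i set" and U :: "'i filter" and M :: "'i \<Rightarrow> 'a mv"
  assumes ultra: "ultrafilter_on I U"
    and chains: "\<And>i. i \<in> I \<Longrightarrow> mv_chain (M i)"
begin

definition P :: "('i \<Rightarrow> 'a) set"
  where "P = (\<Pi>\<^sub>E i\<in>I. carrier (M i))"

lemma P_mem: "f \<in> P \<Longrightarrow> i \<in> I \<Longrightarrow> f i \<in> carrier (M i)"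
  by (auto simp: P_def)

definition cls :: "('i \<Rightarrow> 'a) \<Rightarrow> ('i \<Rightarrow> 'a) set"
  where "cls f = ultra_rel I U M `` {f}"

abbreviation "UP \<equiv> ultraproduct I U M"

lemma ev_I: "eventually (\<lambda>i. i \<in> I) U"
  using ultra by (auto simp: ultrafilter_on_def le_principal)

lemma ev_not: "eventually (\<lambda>i. \<not> Q i) U \<longleftrightarrow> \<not> eventually Q U"
proof
  assume 1: "eventually (\<lambda>i. \<not> Q i) U"
  show "\<not> eventually Q U"
  proof
    assume "eventually Q U"
    with 1 have "eventually (\<lambda>i. False) U" by eventually_elim simp
    then show False using ultra by (simp add: ultrafilter_on_def eventually_False)
  qed
qed (use ultra in \<open>auto simp: ultrafilter_on_def\<close>)

lemma ev_all: "(\<And>i. i \<in> I \<Longrightarrow> Q i) \<Longrightarrow> eventually Q U"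
  by (rule eventually_mono[OF ev_I])

lemma ev_cong: "(\<And>i. i \<in> I \<Longrightarrow> Q i \<longleftrightarrow> R i) \<Longrightarrow> eventually Q U \<longleftrightarrow> eventually R U"
  by (intro eventually_cong eventually_mono[OF ev_I]) auto

lemma cls_eq: "f \<in> P \<Longrightarrow> g \<in> P \<Longrightarrow> cls f = cls g \<longleftrightarrow> eventually (\<lambda>i. f i = g i) U"
proof
  assume f: "f \<in> P" and g: "g \<in> P" and eq: "cls f = cls g"
  have "g \<in> cls g" using g by (simp add: cls_def ultra_rel_def P_def)
  then show "eventually (\<lambda>i. f i = g i) U" unfolding eq[symmetric] by (simp add: cls_def ultra_rel_def P_def)
next
  assume f: "f \<in> P" and g: "g \<in> P" and eq: "eventually (\<lambda>i. f i = g i) U"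
  have "eventually (\<lambda>i. f i = h i) U \<longleftrightarrow> eventually (\<lambda>i. g i = h i) U" for h
    by (intro eventually_cong eventually_mono[OF eq]) auto
  then show "cls f = cls g" using f g by (auto simp: cls_def ultra_rel_def P_def)
qed

lemma cls_self: "f \<in> P \<Longrightarrow> f \<in> cls f"
  by (simp add: cls_def ultra_rel_def P_def)

lemma cls_mem: "g \<in> cls f \<Longrightarrow> g \<in> P \<and> cls g = cls f"
  using cls_eq[of f g] by (auto simp: cls_def ultra_rel_def P_def)

lemma carrier_UP: "carrier UP = cls ` P"
  by (auto simp: ultraproduct_def quotient_def cls_def P_def)

lemma zero_P: "(\<lambda>i\<in>I. mv_zero (M i)) \<in> P"
  using mv_chain.closed(1)[OF chains] by (auto simp: P_def)

lemma add_P: "f \<in> P \<Longrightarrow> g \<in> P \<Longrightarrow> (\<lambda>i\<in>I. mv_add (M i) (f i) (g i)) \<in> P"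
  using mv_chain.closed(2)[OF chains] by (auto simp: P_def PiE_iff)

lemma neg_P: "f \<in> P \<Longrightarrow> (\<lambda>i\<in>I. mv_neg (M i) (f i)) \<in> P"
  using mv_chain.closed(3)[OF chains] by (auto simp: P_def PiE_iff)

lemma UP_zero: "mv_zero UP = cls (\<lambda>i\<in>I. mv_zero (M i))"
  by (simp add: ultraproduct_def cls_def)

text \<open>The operation is a union over all representatives. They all give the same class, and the
  index sets are nonempty, so the union is that class.\<close>

lemma UP_add:
  assumes "f \<in> P" "g \<in> P"
  shows "mv_add UP (cls f) (cls g) = cls (\<lambda>i\<in>I. mv_add (M i) (f i) (g i))"
proof -
  have "cls (\<lambda>i\<in>I. mv_add (M i) (f' i) (g' i)) = cls (\<lambda>i\<in>I. mv_add (M i) (f i) (g i))"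
    if "f' \<in> cls f" "g' \<in> cls g" for f' g'
  proof -
    have P: "f' \<in> P" "g' \<in> P" using that cls_mem by auto
    have "eventually (\<lambda>i. f' i = f i) U" "eventually (\<lambda>i. g' i = g i) U"
      using that assms cls_mem cls_eq by metis+
    then have "eventually (\<lambda>i. (\<lambda>i\<in>I. mv_add (M i) (f' i) (g' i)) i = (\<lambda>i\<in>I. mv_add (M i) (f i) (g i)) i) U"
      by eventually_elim (auto simp: restrict_def)
    then show ?thesis by (simp only: cls_eq[OF add_P[OF P] add_P[OF assms]])
  qed
  then have "(\<Union>f'\<in>cls f. \<Union>g'\<in>cls g. cls (\<lambda>i\<in>I. mv_add (M i) (f' i) (g' i)))
      = (\<Union>f'\<in>cls f. \<Union>g'\<in>cls g. cls (\<lambda>i\<in>I. mv_add (M i) (f i) (g i)))"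
    by (intro SUP_cong refl)
  also have "\<dots> = cls (\<lambda>i\<in>I. mv_add (M i) (f i) (g i))"
    using cls_self[OF assms(1)] cls_self[OF assms(2)] by (simp only: UN_constant) (metis empty_iff)
  finally show ?thesis by (simp add: ultraproduct_def cls_def)
qed

lemma UP_neg:
  assumes "f \<in> P"
  shows "mv_neg UP (cls f) = cls (\<lambda>i\<in>I. mv_neg (M i) (f i))"
proof -
  have "cls (\<lambda>i\<in>I. mv_neg (M i) (f' i)) = cls (\<lambda>i\<in>I. mv_neg (M i) (f i))" if "f' \<in> cls f" for f'
  proof -
    have P: "f' \<in> P" using that cls_mem by auto
    have "eventually (\<lambda>i. f' i = f i) U" using that assms cls_mem cls_eq by metis
    then have "eventually (\<lambda>i. (\<lambda>i\<in>I. mv_neg (M i) (f' i)) i = (\<lambda>i\<in>I. mv_neg (M i) (f i)) i) U"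
      by eventually_elim (auto simp: restrict_def)
    then show ?thesis by (simp only: cls_eq[OF neg_P[OF P] neg_P[OF assms]])
  qed
  then have "(\<Union>f'\<in>cls f. cls (\<lambda>i\<in>I. mv_neg (M i) (f' i))) =
      (\<Union>f'\<in>cls f. cls (\<lambda>i\<in>I. mv_neg (M i) (f i)))"
    by (intro SUP_cong refl)
  also have "\<dots> = cls (\<lambda>i\<in>I. mv_neg (M i) (f i))"
    using cls_self[OF assms] by (simp only: UN_constant) (metis empty_iff)
  finally show ?thesis by (simp add: ultraproduct_def cls_def)
qed

lemma term_val_UP:
  assumes F: "\<And>n. F n \<in> P"
  shows "(\<lambda>i\<in>I. term_val (M i) (\<lambda>n. F n i) t) \<in> P \<and>
    term_val UP (\<lambda>n. cls (F n)) t = cls (\<lambda>i\<in>I. term_val (M i) (\<lambda>n. F n i) t)"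
proof (induction t)
  case (Var n)
  have "(\<lambda>i\<in>I. F n i) = F n" using F[of n] by (auto simp: P_def PiE_iff extensional_def restrict_def)
  then show ?case using F by simp
next
  case Zero
  show ?case unfolding term_val.simps using zero_P UP_zero by blast
next
  case (Add s t)
  let ?f = "\<lambda>i\<in>I. term_val (M i) (\<lambda>n. F n i) s" and ?g = "\<lambda>i\<in>I. term_val (M i) (\<lambda>n. F n i) t"
  have eq: "(\<lambda>i\<in>I. mv_add (M i) (?f i) (?g i)) = (\<lambda>i\<in>I. term_val (M i) (\<lambda>n. F n i) (Add s t))"
    by (rule restrict_ext) simp
  have "term_val UP (\<lambda>n. cls (F n)) (Add s t) = mv_add UP (cls ?f) (cls ?g)"
    using Add unfolding term_val.simps by (simp only:)
  then show ?case
    using add_P[of ?f ?g, unfolded eq] UP_add[of ?f ?g, unfolded eq] Add by (simp only:)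
next
  case (Neg t)
  let ?f = "\<lambda>i\<in>I. term_val (M i) (\<lambda>n. F n i) t"
  have eq: "(\<lambda>i\<in>I. mv_neg (M i) (?f i)) = (\<lambda>i\<in>I. term_val (M i) (\<lambda>n. F n i) (Neg t))"
    by (rule restrict_ext) simp
  have "term_val UP (\<lambda>n. cls (F n)) (Neg t) = mv_neg UP (cls ?f)"
    using Neg unfolding term_val.simps by (simp only:)
  then show ?case
    using neg_P[of ?f, unfolded eq] UP_neg[of ?f, unfolded eq] Neg by (simp only:)
qed

theorem los:
  assumes "\<And>n. F n \<in> P"
  shows "sat UP (\<lambda>n. cls (F n)) \<phi> \<longleftrightarrow> eventually (\<lambda>i. sat (M i) (\<lambda>n. F n i) \<phi>) U"
  using assms
proof (induction \<phi> arbitrary: F)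
  case (Equal s t)
  then show ?case
    using term_val_UP[of F s, OF Equal] term_val_UP[of F t, OF Equal]
    by (simp only: sat.simps cls_eq) (rule ev_cong, simp)
next
  case (Not \<phi>)
  then show ?case by (simp add: ev_not)
next
  case (And \<phi> \<psi>)
  then show ?case by (simp add: eventually_conj_iff)
next
  case (Exists j \<phi>)
  have IH: "sat UP ((\<lambda>n. cls (F n))(j := cls g)) \<phi> \<longleftrightarrow>
      eventually (\<lambda>i. sat (M i) ((\<lambda>n. F n i)(j := g i)) \<phi>) U" if g: "g \<in> P" for g
  proof -
    have "(\<lambda>n. cls (F n))(j := cls g) = (\<lambda>n. cls ((F(j := g)) n))" by (simp add: fun_eq_iff)
    moreover have "(\<lambda>n. F n i)(j := g i) = (\<lambda>n. (F(j := g)) n i)" for i by (simp add: fun_eq_iff)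
    moreover have "(F(j := g)) n \<in> P" for n using g Exists.prems by simp
    ultimately show ?thesis using Exists.IH[of "F(j := g)"] by (simp only:)
  qed
  show ?case
  proof
    assume "sat UP (\<lambda>n. cls (F n)) (Exists j \<phi>)"
    then obtain g where g: "g \<in> P" "sat UP ((\<lambda>n. cls (F n))(j := cls g)) \<phi>"
      by (auto simp: carrier_UP)
    from this(2)[unfolded IH[OF g(1)]] ev_I
    show "eventually (\<lambda>i. sat (M i) (\<lambda>n. F n i) (Exists j \<phi>)) U"
      by eventually_elim (use P_mem[OF g(1)] in \<open>auto simp del: fun_upd_apply\<close>)
  next
    assume ex: "eventually (\<lambda>i. sat (M i) (\<lambda>n. F n i) (Exists j \<phi>)) U"
    \<comment> \<open>A carrier element is demanded at every index, even where no witness exists, so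
      that the choice function belongs to the product.\<close>
    define R where "R i a \<longleftrightarrow> a \<in> carrier (M i) \<and>
      (sat (M i) (\<lambda>n. F n i) (Exists j \<phi>) \<longrightarrow> sat (M i) ((\<lambda>n. F n i)(j := a)) \<phi>)" for i a
    have "\<exists>a. R i a" if "i \<in> I" for i
      using mv_chain.closed(1)[OF chains[OF that]] by (auto simp: R_def)
    then obtain g0 where g0: "\<And>i. i \<in> I \<Longrightarrow> R i (g0 i)" by metis
    define g where "g = restrict g0 I"
    have g: "g \<in> P" using g0 by (auto simp: g_def R_def P_def)
    have "eventually (\<lambda>i. sat (M i) ((\<lambda>n. F n i)(j := g i)) \<phi>) U"
      using ex ev_I by eventually_elim (use g0 in \<open>simp add: g_def R_def\<close>)
    then have "sat UP ((\<lambda>n. cls (F n))(j := cls g)) \<phi>" by (simp only: IH[OF g])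
    then show "sat UP (\<lambda>n. cls (F n)) (Exists j \<phi>)" using g by (auto simp: carrier_UP)
  qed
qed

lemma los_sentence:
  assumes "sentence \<phi>"
  shows "models UP \<phi> \<longleftrightarrow> eventually (\<lambda>i. models (M i) \<phi>) U"
proof -
  let ?z = "\<lambda>i\<in>I. mv_zero (M i)"
  have "models UP \<phi> \<longleftrightarrow> sat UP (\<lambda>_. cls ?z) \<phi>"
    using assms zero_P by (intro models_iff_sat) (auto simp: carrier_UP)
  also have "\<dots> \<longleftrightarrow> eventually (\<lambda>i. sat (M i) (\<lambda>_. ?z i) \<phi>) U"
    using los[of "\<lambda>_. ?z" \<phi>] zero_P by simp
  also have "\<dots> \<longleftrightarrow> eventually (\<lambda>i. models (M i) \<phi>) U"
    by (rule ev_cong) (simp add: mv_chain.models_sentence[OF chains assms])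
  finally show ?thesis .
qed

lemma UP_mv_chain: "mv_chain UP"
proof
  note in_P = zero_P add_P neg_P
  note ops = carrier_UP UP_zero UP_add UP_neg cls_eq in_P
  note axs = mv_chain.axioms(1)[OF chains]
  show "mv_zero UP \<in> carrier UP" by (simp add: ops)
  fix x assume "x \<in> carrier UP"
  then obtain f where f: "f \<in> P" "x = cls f" by (auto simp: carrier_UP)
  have fi: "f i \<in> carrier (M i)" if "i \<in> I" for i using f that P_mem by blast
  show "mv_neg UP x \<in> carrier UP" using f by (auto simp: ops)
  show "mv_add UP x (mv_zero UP) = x"
    by (simp only: f ops, rule ev_all) (simp add: fi mv_algebra.add_zero[OF axs])
  show "mv_neg UP (mv_neg UP x) = x"
    by (simp only: f ops, rule ev_all) (simp add: fi mv_algebra.neg_neg[OF axs])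
  show "mv_add UP x (mv_neg UP (mv_zero UP)) = mv_neg UP (mv_zero UP)"
    by (simp only: f ops, rule ev_all) (simp add: fi mv_algebra.add_one[OF axs])
  fix y assume "y \<in> carrier UP"
  then obtain g where g: "g \<in> P" "y = cls g" by (auto simp: carrier_UP)
  have gi: "g i \<in> carrier (M i)" if "i \<in> I" for i using g that P_mem by blast
  show "mv_add UP x y \<in> carrier UP" using f g by (auto simp: ops)
  show "mv_add UP x y = mv_add UP y x"
    by (simp only: f g ops, rule ev_all) (simp add: fi gi mv_algebra.add_comm[OF axs])
  show "mv_add UP (mv_neg UP (mv_add UP (mv_neg UP x) y)) y = mv_add UP (mv_neg UP (mv_add UP (mv_neg UP y) x)) x"
    by (simp only: f g ops, rule ev_all) (simp add: fi gi mv_algebra.lukasiewicz[OF axs])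
  have le: "mv_le UP (cls f) (cls g) \<longleftrightarrow> eventually (\<lambda>i. mv_le (M i) (f i) (g i)) U"
    if "f \<in> P" "g \<in> P" for f g
    using that by (simp only: mv_le_def ops) (rule ev_cong, simp)
  show "mv_le UP x y \<or> mv_le UP y x"
  \<comment> \<open>The other axioms hold index by index in any filter; this disjunction needs the
    ultrafilter dichotomy.\<close>
  proof (cases "mv_le UP x y")
    case False
    then have "eventually (\<lambda>i. \<not> mv_le (M i) (f i) (g i)) U" using f g by (simp add: le ev_not)
    then have "eventually (\<lambda>i. mv_le (M i) (g i) (f i)) U" using ev_I
      by eventually_elim (use mv_chain.linear[OF chains] fi gi in blast)
    then show ?thesis using f g by (simp add: le)
  qed simp
  fix z assume "z \<in> carrier UP"
  then obtain h where h: "h \<in> P" "z = cls h" by (auto simp: carrier_UP)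
  have hi: "h i \<in> carrier (M i)" if "i \<in> I" for i using h that P_mem by blast
  show "mv_add UP (mv_add UP x y) z = mv_add UP x (mv_add UP y z)"
    by (simp only: f g h ops, rule ev_all) (simp add: fi gi hi mv_algebra.add_assoc[OF axs])
qed

text \<open>If a singleton {a} belonged to the ultrafilter, membership in it would be decided at a,
  making it principal.\<close>

lemma nonprincipal_cofinite:
  assumes "nonprincipal U" "finite S"
  shows "eventually (\<lambda>i. i \<notin> S) U"
  using assms(2)
proof (induction S rule: finite_induct)
  case (insert a S)
  have "\<not> eventually (\<lambda>i. i = a) U"
  proof
    assume a: "eventually (\<lambda>i. i = a) U"
    have "eventually Q U \<longleftrightarrow> Q a" for Q
    proof -
      have "eventually Q U \<longleftrightarrow> eventually (\<lambda>_. Q a) U"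
        by (intro eventually_cong eventually_mono[OF a]) auto
      then show ?thesis using ultra by (simp add: ultrafilter_on_def)
    qed
    then have "U = principal {a}" by (simp add: filter_eq_iff eventually_principal)
    with assms(1) show False by (simp add: nonprincipal_def)
  qed
  then have "eventually (\<lambda>i. i \<noteq> a) U" by (simp add: ev_not)
  with insert.IH show ?case by eventually_elim simp
qed simp

end

text \<open>Atomicity passes to the ultraproduct first, so that \<open>mv_D\<close> becomes a
  sentence there. It is then evaluated in the factors, where the finitely many n \<le> q k are
  negligible.\<close>

lemma ultraproduct_fin_chain_D:
  assumes U: "ultrafilter_on {1..} U" "nonprincipal U" and q: "2 \<le> q" "k < q"
  shows "mv_D (ultraproduct {1..} U fin_chain) q k \<longleftrightarrow>
    eventually (\<lambda>n. n \<in> {q * j - k | j. j \<ge> 1}) U"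
proof -
  interpret mv_ultraproduct "{1..}" U fin_chain
    using U(1) fin_chain_mv_chain by (rule mv_ultraproduct.intro)
  interpret A: mv_chain UP by (rule UP_mv_chain)
  have "mv_zero UP \<noteq> mv_neg UP (mv_zero UP)"
  proof
    assume "mv_zero UP = mv_neg UP (mv_zero UP)"
    then have "eventually (\<lambda>i. (\<lambda>i\<in>{1..}. mv_zero (fin_chain i)) i =
        (\<lambda>i\<in>{1..}. mv_neg (fin_chain i) ((\<lambda>i\<in>{1..}. mv_zero (fin_chain i)) i)) i) U"
      using cls_eq[OF zero_P neg_P[OF zero_P]] by (simp only: UP_zero UP_neg[OF zero_P])
    with ev_I have "eventually (\<lambda>i. False) U"
      by eventually_elim (simp add: fin_chain_def)
    then show False using ev_not[of "\<lambda>_. True"] by simp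
  qed
  then interpret A: nontrivial_mv_chain UP by unfold_locales
  have "models (fin_chain i) atomic_sentence" for i
    by (intro mv_chain.finite_models_atomic fin_chain_mv_chain) (simp add: fin_chain_def)
  then have "models UP atomic_sentence" using los_sentence[OF sentences(1)] by simp
  then have at: "mv_atomic UP" using A.models_atomic_sentence A.nontrivial by blast
  have "mv_D UP q k \<longleftrightarrow> eventually (\<lambda>n. models (fin_chain n) (D_sentence q k)) U"
    using A.mv_D_iff_models[OF at q] los_sentence[OF sentences(3)] by simp
  also have "\<dots> \<longleftrightarrow> eventually (\<lambda>n. n \<in> {q * j - k | j. j \<ge> 1}) U"
  proof (rule eventually_cong)
    have "eventually (\<lambda>n. n \<notin> {..q * k}) U" using U(2) by (rule nonprincipal_cofinite) simp
    then show "eventually (\<lambda>n. q * k < n) U" by (simp add: not_le)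
  qed (rule fin_chain_D[OF q])
  finally show ?thesis .
qed

section \<open>Regular chains\<close>

lemma regular_representation:
  fixes A :: "('a, 'b) mv_scheme"
  assumes A: "mv_chain A" "infinite (carrier A)" "mv_atomic A" "mv_regular A"
  obtains N :: "('a multiset \<Rightarrow>\<^sub>0 int) \<Rightarrow> bool" and emb u e where "mv_rep A N emb u" "z_cone N e"
    "\<And>k. \<not> N (of_int k * e - u)"
    "\<And>q k. 2 \<le> q \<Longrightarrow> k < q \<Longrightarrow> models A (D_sentence q k) \<longleftrightarrow> discrete_cone.congr N e (int q) u (- int k)"
proof -
  interpret mv_chain A by fact
  interpret nontrivial_mv_chain A by (rule infinite_nontrivial[OF A(2)])
  obtain \<epsilon> where "mv_atom A \<epsilon>" using A(3) by (auto simp: mv_atomic_def)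
  then obtain N :: "('a multiset \<Rightarrow>\<^sub>0 int) \<Rightarrow> bool" and emb w where "mv_discrete_rep A N emb w \<epsilon>"
    using chang_discrete_rep by blast
  then interpret R: mv_discrete_rep A N emb w \<epsilon> .
  show thesis
    using R.mv_rep_axioms R.regular_z_cone[OF A(4,2)] R.infinite_unit[OF A(2)]
      R.models_D_iff R.D_group_infinite[OF A(2)] by (intro that) auto
qed

lemma prime_power_bounds:
  fixes p m k :: nat
  assumes "prime p" "m \<ge> 1" "k \<le> p ^ m - 1"
  shows "2 \<le> p ^ m" "k < p ^ m"
proof -
  have "2 \<le> p" using assms by (simp add: prime_ge_2_nat)
  moreover have "p ^ 1 \<le> p ^ m" using assms \<open>2 \<le> p\<close> by (intro power_increasing) auto
  ultimately show "2 \<le> p ^ m" by simp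
  with assms show "k < p ^ m" by linarith
qed

lemma elem_equiv_iff_D:
  fixes A :: "('a, 'b) mv_scheme" and B :: "('c, 'd) mv_scheme"
  assumes A: "mv_chain A" "infinite (carrier A)" "mv_atomic A" "mv_regular A"
    and B: "mv_chain B" "infinite (carrier B)" "mv_atomic B" "mv_regular B"
  shows "elem_equiv A B \<longleftrightarrow>
    (\<forall>p m k. prime p \<and> m \<ge> 1 \<and> k \<le> p ^ m - 1 \<longrightarrow> (mv_D A (p ^ m) k \<longleftrightarrow> mv_D B (p ^ m) k))"
proof -
  interpret A: nontrivial_mv_chain A using A mv_chain.infinite_nontrivial by blast
  interpret B: nontrivial_mv_chain B using B mv_chain.infinite_nontrivial by blast
  show ?thesis
  proof
    assume AB: "elem_equiv A B"
    have "mv_D A (p ^ m) k \<longleftrightarrow> mv_D B (p ^ m) k"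
      if "prime p" "m \<ge> 1" "k \<le> p ^ m - 1" for p m k :: nat
    proof -
      note q = prime_power_bounds[OF that]
      show ?thesis
        using AB sentences(3)[of "p ^ m" k] A.mv_D_iff_models[OF A(3) q] B.mv_D_iff_models[OF B(3) q]
        unfolding elem_equiv_def by simp
    qed
    then show "\<forall>p m k. prime p \<and> m \<ge> 1 \<and> k \<le> p ^ m - 1 \<longrightarrow> (mv_D A (p ^ m) k \<longleftrightarrow> mv_D B (p ^ m) k)"
      by blast
  next
    assume D: "\<forall>p m k. prime p \<and> m \<ge> 1 \<and> k \<le> p ^ m - 1 \<longrightarrow> (mv_D A (p ^ m) k \<longleftrightarrow> mv_D B (p ^ m) k)"
    obtain N :: "('a multiset \<Rightarrow>\<^sub>0 int) \<Rightarrow> bool" and emb u e where RA: "mv_rep A N emb u" "z_cone N e"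
      "\<And>k. \<not> N (of_int k * e - u)"
      "\<And>q k. 2 \<le> q \<Longrightarrow> k < q \<Longrightarrow> models A (D_sentence q k) \<longleftrightarrow> discrete_cone.congr N e (int q) u (- int k)"
      using regular_representation[OF A] by blast
    obtain N' :: "('c multiset \<Rightarrow>\<^sub>0 int) \<Rightarrow> bool" and emb' u' e' where RB: "mv_rep B N' emb' u'" "z_cone N' e'"
      "\<And>k. \<not> N' (of_int k * e' - u')"
      "\<And>q k. 2 \<le> q \<Longrightarrow> k < q \<Longrightarrow> models B (D_sentence q k) \<longleftrightarrow> discrete_cone.congr N' e' (int q) u' (- int k)"
      using regular_representation[OF B] by blast
    show "elem_equiv A B"
      unfolding elem_equiv_def
    proof (intro allI impI)
      fix \<phi> assume \<phi>: "sentence \<phi>"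
      have M: "0 < snd (level \<phi>)" using level_pos[of \<phi>] by linarith
      have "discrete_cone.congr N' e' (int (p ^ m)) u' (- int k)"
        if "prime p" "1 \<le> m" "k < p ^ m" "discrete_cone.congr N e (int (p ^ m)) u (- int k)" for p m k
      proof -
        have k: "k \<le> p ^ m - 1" using that by simp
        note q = prime_power_bounds[OF that(1,2) k]
        have "mv_D A (p ^ m) k"
          using that(4) RA(4)[OF q] A.mv_D_iff_models[OF A(3) q] by simp
        then have "mv_D B (p ^ m) k" using D that k by simp
        then show ?thesis using RB(4)[OF q] B.mv_D_iff_models[OF B(3) q] by simp
      qed
      from congr_prime_powers[OF RA(2) RB(2) M this]
      obtain r where "discrete_cone.congr N e (snd (level \<phi>)) u r"
        "discrete_cone.congr N' e' (snd (level \<phi>)) u' r" by blast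
      then show "models A \<phi> \<longleftrightarrow> models B \<phi>"
        by (intro models_transfer[OF RA(1) RB(1) RA(2) RB(2) RA(3) RB(3) _ _ \<phi>])
    qed
  qed
qed

text \<open>Regularity is reached through the sentences for \<open>dense\<close>, one for each n
  \<ge> 2, all of which hold in every finite chain.\<close>

lemma pseudofinite_regular:
  fixes C :: "('a, 'b) mv_scheme"
  assumes C: "mv_chain C" "infinite (carrier C)" and pf: "pseudofinite C"
  shows "mv_atomic C \<and> mv_regular C"
proof -
  interpret mv_chain C by fact
  interpret nontrivial_mv_chain C by (rule infinite_nontrivial[OF C(2)])
  have "models C atomic_sentence"
    using pf sentences(1) mv_chain.finite_models_atomic unfolding pseudofinite_def by blast
  then have at: "mv_atomic C" using models_atomic_sentence nontrivial by blast
  then obtain \<epsilon> where "mv_atom C \<epsilon>" by (auto simp: mv_atomic_def)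
  then obtain N :: "('a multiset \<Rightarrow>\<^sub>0 int) \<Rightarrow> bool" and emb w where "mv_discrete_rep C N emb w \<epsilon>"
    using chang_discrete_rep by blast
  then interpret R: mv_discrete_rep C N emb w \<epsilon> .
  have "R.dense n" if "2 \<le> n" for n
    using pf sentences(2)[of n] mv_chain.finite_models_dense[OF _ _ that]
    unfolding R.models_dense_iff[OF that, symmetric] pseudofinite_def by blast
  with at show ?thesis using R.dense_regular by blast
qed

lemma regular_pseudofinite:
  fixes C :: "('a, 'b) mv_scheme"
  assumes C: "mv_chain C" "infinite (carrier C)" "mv_atomic C" "mv_regular C"
  shows "pseudofinite C"
  unfolding pseudofinite_def
proof (intro allI impI; elim conjE)
  fix \<phi> assume \<phi>: "sentence \<phi>"
    and fin: "\<forall>B :: nat mv. mv_chain B \<and> finite (carrier B) \<longrightarrow> models B \<phi>"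
  obtain N :: "('a multiset \<Rightarrow>\<^sub>0 int) \<Rightarrow> bool" and emb u e where R: "mv_rep C N emb u" "z_cone N e"
    "\<And>k. \<not> N (of_int k * e - u)"
    using regular_representation[OF C] by metis
  interpret z_cone N e by fact
  define L M where "L = fst (level \<phi>)" and "M = snd (level \<phi>)"
  have L: "1 \<le> L" and M: "1 \<le> M" using level_pos[of \<phi>] by (auto simp: L_def M_def)
  obtain r0 where r0: "congr M u r0" using div_exists[of M] M by auto
  \<comment> \<open>Adding M (L + 1) lifts the representative above the threshold L without changing
    its residue modulo M.\<close>
  define r where "r = r0 mod M + M * (L + 1)"
  have cr: "congr M u r"
    using r0 by (rule congr_shift) (simp add: r_def dvd_diff_right_iff flip: diff_diff_eq)
  have "L < 1 * (L + 1)" by simp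
  also have "\<dots> \<le> M * (L + 1)" using L M by (intro mult_right_mono) auto
  also have "\<dots> \<le> r" using M by (simp add: r_def)
  finally have rL: "L < r" .
  define n where "n = nat r"
  have n: "int n = r" "1 \<le> n" using rL L by (auto simp: n_def)
  have "models C \<phi> \<longleftrightarrow> models (fin_chain n) \<phi>"
    using cr rL M n
    by (intro models_transfer[OF R(1) fin_chain_rep[OF n(2)] R(2) int_z_cone R(3) _ _ _ \<phi>, of r])
      (auto simp: int_congr L_def M_def)
  moreover have "models (fin_chain n) \<phi>"
    using fin fin_chain_mv_chain[of n] by (auto simp: fin_chain_def)
  ultimately show "models C \<phi>" by blast
qed

theorem theorem5p13:
  fixes A :: "'a mv" and B :: "'b mv" and C :: "'c mv"
    and U :: "nat filter" and p m k :: nat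
  shows "(mv_chain A \<and> infinite (carrier A) \<and> mv_atomic A \<and> mv_regular A \<and>
          mv_chain B \<and> infinite (carrier B) \<and> mv_atomic B \<and> mv_regular B \<longrightarrow>
          (elem_equiv A B \<longleftrightarrow>
            (\<forall>p m k. prime p \<and> m \<ge> 1 \<and> k \<le> p ^ m - 1 \<longrightarrow> (mv_D A (p ^ m) k \<longleftrightarrow> mv_D B (p ^ m) k))))
       \<and> (mv_chain C \<and> infinite (carrier C) \<longrightarrow>
          (pseudofinite C \<longleftrightarrow> mv_atomic C \<and> mv_regular C))
       \<and> (ultrafilter_on {1..} U \<and> nonprincipal U \<and> prime p \<and> m \<ge> 1 \<and> k \<le> p ^ m - 1 \<longrightarrow>
          (mv_D (ultraproduct {1..} U fin_chain) (p ^ m) k \<longleftrightarrow>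
            eventually (\<lambda>n. n \<in> {p ^ m * j - k | j. j \<ge> 1}) U))"
proof (intro conjI impI; (elim conjE)?)
  assume "mv_chain A" "infinite (carrier A)" "mv_atomic A" "mv_regular A"
    "mv_chain B" "infinite (carrier B)" "mv_atomic B" "mv_regular B"
  then show "elem_equiv A B \<longleftrightarrow>
      (\<forall>p m k. prime p \<and> m \<ge> 1 \<and> k \<le> p ^ m - 1 \<longrightarrow> (mv_D A (p ^ m) k \<longleftrightarrow> mv_D B (p ^ m) k))"
    by (rule elem_equiv_iff_D)
next
  assume "mv_chain C" "infinite (carrier C)"
  then show "pseudofinite C \<longleftrightarrow> mv_atomic C \<and> mv_regular C"
    using pseudofinite_regular[of C] regular_pseudofinite[of C] by blast
next
  assume U: "ultrafilter_on {1..} U" "nonprincipal U" and p: "prime p" and m: "m \<ge> 1" and k: "k \<le> p ^ m - 1"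
  show "mv_D (ultraproduct {1..} U fin_chain) (p ^ m) k \<longleftrightarrow>
      eventually (\<lambda>n. n \<in> {p ^ m * j - k | j. j \<ge> 1}) U"
    by (rule ultraproduct_fin_chain_D[OF U prime_power_bounds[OF p m k]])
qed

end
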